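(* Let $G$ be a Morse local-to-global group that is not hyperbolic and let $H$ be an infinite normal hyperbolic subgroup of $G$. Then there does not exist a Cannon--Thurston map from $\partial_{*}H$ to $\partial_{*}G$.
   Context: Hyperbolic means (finitely generated and) Gromov hyperbolic. All finite generating sets are symmetric. $\mathrm{Cay}(G,A)$ is the Cayley graph (vertices $g\in G$, $g,h$ joined by an edge if $g^{-1}h\in A$, edges of length $1$), and $e$ is the identity. Morse quasi-geodesics: let $X$ be a metric space and $I\subseteq\mathbb{R}$ a closed interval. A map $\gamma:I\to X$ is a $(k,c)$-quasi-geodesic ($k\ge1$, $c\ge0$) if $\frac1k|s-t|-c\le d(\gamma(s),\gamma(t))\le k|s-t|+c$ for all $s,t\in I$; a geodesic is a $(1,0)$-quasi-geodesic. A Morse gauge is a function $M:[1,\infty)\times[0,\infty)\to[0,\infty)$. A quasi-geodesic $\gamma:I\to X$ is $M$-Morse if for every $[s,t]\subseteq I$, every $(k,c)$-quasi-geodesic with endpoints $\gamma(s),\gamma(t)$ is contained in the $M(k,c)$-neighborhood of $\gamma|_{[s,t]}$. An $(M;k,c)$-Morse quasi-geodesic is an $M$-Morse $(k,c)$-quasi-geodesic. For $B\ge0$, $\gamma:I\to X$ is a $(B;M;k,c)$-local Morse quasi-geodesic if $\gamma|_{[s,t]}$ is an $(M;k,c)$-Morse quasi-geodesic for every $[s,t]\subseteq I$ with $|s-t|\le B$. Morse local-to-global: $X$ is a Morse local-to-global space if for every Morse gauge $M$ and $k\ge1$, $c\ge0$ there exist $B\ge0$, a Morse gauge $M'$, and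 $k'\ge1$, $c'\ge0$ such that every $(B;M;k,c)$-local Morse quasi-geodesic is an $(M';k',c')$-Morse quasi-geodesic. A Morse local-to-global group is a finitely generated group some (equivalently, every) Cayley graph of which, with respect to a finite generating set, is a Morse local-to-global space. Morse boundary: let $X$ be a proper geodesic metric space with basepoint $e$. As a set $\partial_{*}X_e$ consists of Morse geodesic rays starting at $e$, modulo asymptotic equivalence (bounded Hausdorff distance). For a Morse gauge $M$, $\partial_{*}^{M}X_e$ is the set of classes containing an $M$-Morse geodesic ray based at $e$, with the compact-open topology; equivalently, a neighborhood system at $[\alpha]$ is given by the sets $V_n(\alpha)$, $n\in\mathbb{N}$, of (classes of) $M$-Morse geodesic rays $\gamma$ with $\gamma(0)=e$ and $d(\alpha(t),\gamma(t))<\delta_M$ for all $t<n$, where $\delta_M$ is a constant depending only on $M$. Order Morse gauges by $M\le M'$ iff $M(\lambda,\epsilon)\le M'(\lambda,\epsilon)$ for all $\lambda\ge1,\epsilon\ge0$. Then $\partial_{*}X_e=\varinjlim\partial_{*}^{M}X_e$ has the direct limit topology: $U$ is open iff $U\cap\partial_{*}^{M}X_e$ is open for all $M$. The Morse boundary $\partial_{*}G$ of a finitely generated group $G$ is the Morse boundary of a Cayley graph of $G$ with respect to a finite generating set, based at $e$ (well defined up to homeomorphism). For $g\in G$, $[e,g]_G$ denotes a geodesic from $e$ to $g$ in the Cayley graph of $G$ with respect to a fixed finite generating set (similarly $[e,h]_H$ for a finitely generated group $H$ and its own Cayley graph). For a sequence $g_n\in G$ and $x\in\partial_{*}G$, $[e,g_n]_G\to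 x$ means that $[e,g_n]_G$ converges uniformly on compact subsets to a geodesic ray representing $x$. Cannon--Thurston map: let $H$ be a finitely generated subgroup of a finitely generated group $G$. There is a Cannon--Thurston map from $\partial_{*}H$ to $\partial_{*}G$ if there exists a continuous function $\partial_\iota:\partial_{*}H\to\partial_{*}G$ such that for each $x\in\partial_{*}H$, if $[e,h_n]_H\to x$ for some sequence $\{h_n\}$ of elements of $H$, then $[e,h_n]_G\to\partial_\iota(x)$. *)

theory Defs
  imports "HOL-Analysis.Analysis" "HOL-Algebra.Generated_Groups"
begin

section \<open>Morse quasi-geodesics in a metric space\<close>

text \<open>
  A metric space is given by a carrier \<open>X\<close> and a distance \<open>d\<close>, as in the locale
  \<^locale>\<open>Metric_space\<close>. A map defined on a closed interval \<open>I\<close> is a total function of which only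
  the values on \<open>I\<close> are used.
\<close>

definition quasi_geodesic ::
  "'p set \<Rightarrow> ('p \<Rightarrow> 'p \<Rightarrow> real) \<Rightarrow> real \<Rightarrow> real \<Rightarrow> real set \<Rightarrow> (real \<Rightarrow> 'p) \<Rightarrow> bool" where
  "quasi_geodesic X d k c I \<gamma> \<longleftrightarrow>
     is_interval I \<and> closed I \<and> \<gamma> \<in> I \<rightarrow> X \<and>
     (\<forall>s\<in>I. \<forall>t\<in>I. 1 / k * \<bar>s - t\<bar> - c \<le> d (\<gamma> s) (\<gamma> t) \<and> d (\<gamma> s) (\<gamma> t) \<le> k * \<bar>s - t\<bar> + c)"

abbreviation geodesic ::
  "'p set \<Rightarrow> ('p \<Rightarrow> 'p \<Rightarrow> real) \<Rightarrow> real set \<Rightarrow> (real \<Rightarrow> 'p) \<Rightarrow> bool" where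
  "geodesic X d \<equiv> quasi_geodesic X d 1 0"

text \<open>Only the values of a gauge on \<open>[1,\<infinity>) \<times> [0,\<infinity>)\<close> matter.\<close>

definition morse_gauge :: "(real \<Rightarrow> real \<Rightarrow> real) \<Rightarrow> bool" where
  "morse_gauge M \<longleftrightarrow> (\<forall>k\<ge>1. \<forall>c\<ge>0. 0 \<le> M k c)"

text \<open>
  Neighbourhoods are closed ones, since a gauge may take the value \<open>0\<close>. The quasi-geodesics \<open>\<sigma>\<close>
  with endpoints \<open>\<gamma> s\<close>, \<open>\<gamma> t\<close> may be parametrised by any compact interval.
\<close>

definition is_morse ::
  "'p set \<Rightarrow> ('p \<Rightarrow> 'p \<Rightarrow> real) \<Rightarrow> (real \<Rightarrow> real \<Rightarrow> real) \<Rightarrow> real set \<Rightarrow> (real \<Rightarrow> 'p) \<Rightarrow> bool" where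
  "is_morse X d M I \<gamma> \<longleftrightarrow>
     (\<forall>s t. s \<le> t \<and> {s..t} \<subseteq> I \<longrightarrow>
       (\<forall>k\<ge>1. \<forall>c\<ge>0. \<forall>a b \<sigma>.
          a \<le> b \<and> quasi_geodesic X d k c {a..b} \<sigma> \<and> \<sigma> a = \<gamma> s \<and> \<sigma> b = \<gamma> t \<longrightarrow>
          (\<forall>u\<in>{a..b}. \<exists>v\<in>{s..t}. d (\<sigma> u) (\<gamma> v) \<le> M k c)))"

definition morse_quasi_geodesic ::
  "'p set \<Rightarrow> ('p \<Rightarrow> 'p \<Rightarrow> real) \<Rightarrow> (real \<Rightarrow> real \<Rightarrow> real) \<Rightarrow> real \<Rightarrow> real \<Rightarrow> real set \<Rightarrow> (real \<Rightarrow> 'p) \<Rightarrow> bool"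
  where
  "morse_quasi_geodesic X d M k c I \<gamma> \<longleftrightarrow> quasi_geodesic X d k c I \<gamma> \<and> is_morse X d M I \<gamma>"

definition local_morse_quasi_geodesic ::
  "'p set \<Rightarrow> ('p \<Rightarrow> 'p \<Rightarrow> real) \<Rightarrow> real \<Rightarrow> (real \<Rightarrow> real \<Rightarrow> real) \<Rightarrow> real \<Rightarrow> real \<Rightarrow> real set \<Rightarrow> (real \<Rightarrow> 'p) \<Rightarrow> bool"
  where
  "local_morse_quasi_geodesic X d B M k c I \<gamma> \<longleftrightarrow>
     is_interval I \<and> closed I \<and> \<gamma> \<in> I \<rightarrow> X \<and>
     (\<forall>s t. s \<le> t \<and> {s..t} \<subseteq> I \<and> \<bar>s - t\<bar> \<le> B \<longrightarrow> morse_quasi_geodesic X d M k c {s..t} \<gamma>)"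

definition morse_local_to_global_space :: "'p set \<Rightarrow> ('p \<Rightarrow> 'p \<Rightarrow> real) \<Rightarrow> bool" where
  "morse_local_to_global_space X d \<longleftrightarrow>
     (\<forall>M k c. morse_gauge M \<and> 1 \<le> k \<and> 0 \<le> c \<longrightarrow>
       (\<exists>B M' k' c'. 0 \<le> B \<and> morse_gauge M' \<and> 1 \<le> k' \<and> 0 \<le> c' \<and>
         (\<forall>I \<gamma>. local_morse_quasi_geodesic X d B M k c I \<gamma> \<longrightarrow>
                 morse_quasi_geodesic X d M' k' c' I \<gamma>)))"


section \<open>Gromov hyperbolicity\<close>

definition geodesic_between ::
  "'p set \<Rightarrow> ('p \<Rightarrow> 'p \<Rightarrow> real) \<Rightarrow> 'p \<Rightarrow> 'p \<Rightarrow> (real \<Rightarrow> 'p) \<Rightarrow> bool" where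
  "geodesic_between X d x y \<gamma> \<longleftrightarrow> geodesic X d {0..d x y} \<gamma> \<and> \<gamma> 0 = x \<and> \<gamma> (d x y) = y"

text \<open>
  Rips' slim triangle condition for a geodesic metric space. By cyclic symmetry in \<open>x\<close>, \<open>y\<close>, \<open>z\<close> it
  is enough to speak about the side from \<open>x\<close> to \<open>y\<close>.
\<close>

definition gromov_hyperbolic :: "'p set \<Rightarrow> ('p \<Rightarrow> 'p \<Rightarrow> real) \<Rightarrow> bool" where
  "gromov_hyperbolic X d \<longleftrightarrow>
     (\<exists>\<delta>\<ge>0. \<forall>x\<in>X. \<forall>y\<in>X. \<forall>z\<in>X. \<forall>\<alpha> \<beta> \<gamma>.
        geodesic_between X d x y \<alpha> \<and> geodesic_between X d y z \<beta> \<and> geodesic_between X d z x \<gamma> \<longrightarrow>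
        (\<forall>u\<in>{0..d x y}. (\<exists>v\<in>{0..d y z}. d (\<alpha> u) (\<beta> v) \<le> \<delta>) \<or>
                         (\<exists>w\<in>{0..d z x}. d (\<alpha> u) (\<gamma> w) \<le> \<delta>)))"


section \<open>Cayley graphs\<close>

definition finite_symmetric_generating_set :: "('a, 'b) monoid_scheme \<Rightarrow> 'a set \<Rightarrow> bool" where
  "finite_symmetric_generating_set G A \<longleftrightarrow>
     finite A \<and> A \<subseteq> carrier G \<and> (\<forall>a\<in>A. inv\<^bsub>G\<^esub> a \<in> A) \<and> generate G A = carrier G"

definition cayley_edge :: "('a, 'b) monoid_scheme \<Rightarrow> 'a set \<Rightarrow> 'a \<Rightarrow> 'a \<Rightarrow> bool" where
  "cayley_edge G A g h \<longleftrightarrow> g \<in> carrier G \<and> h \<in> carrier G \<and> inv\<^bsub>G\<^esub> g \<otimes>\<^bsub>G\<^esub> h \<in> A"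

text \<open>
  Points of the Cayley graph are given by barycentric coordinates, i.e. functions from group
  elements to reals: \<open>edge_point g h t\<close> is the point at distance \<open>t\<close> from \<open>g\<close> on the edge joining \<open>g\<close>
  and \<open>h\<close>. If the identity lies in \<open>A\<close>, the resulting loops are collapsed to their vertices.
\<close>

definition vertex :: "'a \<Rightarrow> 'a \<Rightarrow> real" where
  "vertex g = (\<lambda>x. if x = g then 1 else 0)"

definition edge_point :: "'a \<Rightarrow> 'a \<Rightarrow> real \<Rightarrow> 'a \<Rightarrow> real" where
  "edge_point g h t = (\<lambda>x. (1 - t) * vertex g x + t * vertex h x)"

definition cayley_graph :: "('a, 'b) monoid_scheme \<Rightarrow> 'a set \<Rightarrow> ('a \<Rightarrow> real) set" where
  "cayley_graph G A =
     vertex ` carrier G \<union> {edge_point g h t | g h t. cayley_edge G A g h \<and> t \<in> {0..1}}"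

text \<open>
  The length metric: \<open>cayley_chain G A p q l\<close> says that there is a piecewise linear path of length \<open>l\<close>
  from \<open>p\<close> to \<open>q\<close>, each piece of which runs within a single edge of length \<open>1\<close>.
\<close>

inductive cayley_chain ::
  "('a, 'b) monoid_scheme \<Rightarrow> 'a set \<Rightarrow> ('a \<Rightarrow> real) \<Rightarrow> ('a \<Rightarrow> real) \<Rightarrow> real \<Rightarrow> bool"
  for G :: "('a, 'b) monoid_scheme" and A :: "'a set" where
  refl: "p \<in> cayley_graph G A \<Longrightarrow> cayley_chain G A p p 0"
| step: "\<lbrakk>cayley_chain G A p (edge_point g h s) l; cayley_edge G A g h; s \<in> {0..1}; t \<in> {0..1}\<rbrakk> \<Longrightarrow>
         cayley_chain G A p (edge_point g h t) (l + \<bar>s - t\<bar>)"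

definition cayley_dist ::
  "('a, 'b) monoid_scheme \<Rightarrow> 'a set \<Rightarrow> ('a \<Rightarrow> real) \<Rightarrow> ('a \<Rightarrow> real) \<Rightarrow> real" where
  "cayley_dist G A p q =
     (if p \<in> cayley_graph G A \<and> q \<in> cayley_graph G A then Inf {l. cayley_chain G A p q l} else 0)"

lemma edge_point_in_cayley_graph:
  "cayley_edge G A g h \<Longrightarrow> t \<in> {0..1} \<Longrightarrow> edge_point g h t \<in> cayley_graph G A"
  by (auto simp: cayley_graph_def)

lemma cayley_chain_in:
  "cayley_chain G A p q l \<Longrightarrow> p \<in> cayley_graph G A \<and> q \<in> cayley_graph G A \<and> 0 \<le> l"
  by (induction rule: cayley_chain.induct) (auto intro: edge_point_in_cayley_graph)

lemma cayley_chain_trans: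
  "cayley_chain G A q r m \<Longrightarrow> cayley_chain G A p q l \<Longrightarrow> cayley_chain G A p r (l + m)"
proof (induction rule: cayley_chain.induct)
  case (step q g h s m t)
  then show ?case
    using cayley_chain.step[of G A p g h s "l + m" t] by (simp add: add.assoc)
qed simp

lemma cayley_chain_edge:
  assumes "cayley_edge G A g h" "s \<in> {0..1}" "t \<in> {0..1}"
  shows "cayley_chain G A (edge_point g h s) (edge_point g h t) \<bar>s - t\<bar>"
  using cayley_chain.step[OF cayley_chain.refl[OF edge_point_in_cayley_graph[OF assms(1,2)]] assms]
  by simp

lemma cayley_chain_sym: "cayley_chain G A p q l \<Longrightarrow> cayley_chain G A q p l"
proof (induction rule: cayley_chain.induct)
  case (step p g h s l t)
  then have "cayley_chain G A (edge_point g h t) (edge_point g h s) \<bar>t - s\<bar>"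
    by (intro cayley_chain_edge) auto
  with step show ?case
    using cayley_chain_trans[of G A "edge_point g h s" p l "edge_point g h t" "\<bar>t - s\<bar>"]
    by (simp add: add.commute abs_minus_commute)
qed (rule cayley_chain.refl)

lemma cayley_chain_coord: "cayley_chain G A p q l \<Longrightarrow> \<bar>p x - q x\<bar> \<le> l"
proof (induction rule: cayley_chain.induct)
  case (step p g h s l t)
  have "edge_point g h s x - edge_point g h t x = (s - t) * (vertex h x - vertex g x)"
    by (simp add: edge_point_def algebra_simps)
  moreover have "\<bar>vertex h x - vertex g x\<bar> \<le> 1"
    by (simp add: vertex_def)
  ultimately have "\<bar>edge_point g h s x - edge_point g h t x\<bar> \<le> \<bar>s - t\<bar>"
    by (simp add: abs_mult mult_left_le)
  with step show ?case by linarith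
qed simp

lemma edge_point_0 [simp]: "edge_point g h 0 = vertex g"
  and edge_point_1 [simp]: "edge_point g h 1 = vertex h"
  by (auto simp: edge_point_def)

lemma cayley_chain_exists:
  assumes G: "group G" and A: "finite_symmetric_generating_set G A"
    and p: "p \<in> cayley_graph G A" and q: "q \<in> cayley_graph G A"
  shows "\<exists>l. cayley_chain G A p q l"
proof -
  interpret group G by (rule G)
  have sub: "A \<subseteq> carrier G" and sym: "\<And>a. a \<in> A \<Longrightarrow> inv\<^bsub>G\<^esub> a \<in> A"
    and gen: "generate G A = carrier G"
    using A by (auto simp: finite_symmetric_generating_set_def)
  have edge: "\<exists>l. cayley_chain G A (vertex x) (vertex (x \<otimes>\<^bsub>G\<^esub> a)) l"
    if "a \<in> A" "x \<in> carrier G" for x a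
  proof -
    have "cayley_edge G A x (x \<otimes>\<^bsub>G\<^esub> a)"
      using that sub by (auto simp: cayley_edge_def inv_solve_left m_assoc[symmetric])
    from cayley_chain_edge[OF this, of 0 1] show ?thesis by auto
  qed
  have vert: "\<exists>l. cayley_chain G A (vertex x) (vertex (x \<otimes>\<^bsub>G\<^esub> g)) l"
    if "g \<in> generate G A" "x \<in> carrier G" for g x
    using that
  proof (induction arbitrary: x rule: generate.induct)
    case one
    then show ?case using cayley_chain.refl[of "vertex x" G A] by (auto simp: cayley_graph_def)
  next
    case (incl h)
    then show ?case using edge by blast
  next
    case (inv h)
    then show ?case using edge sym by blast
  next
    case (eng h1 h2)
    have c: "h1 \<in> carrier G" "h2 \<in> carrier G" using eng.hyps gen by auto
    have "\<exists>l. cayley_chain G A (vertex x) (vertex (x \<otimes>\<^bsub>G\<^esub> h1)) l"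
      using eng by blast
    moreover have "\<exists>l. cayley_chain G A (vertex (x \<otimes>\<^bsub>G\<^esub> h1)) (vertex (x \<otimes>\<^bsub>G\<^esub> h1 \<otimes>\<^bsub>G\<^esub> h2)) l"
      using eng c by blast
    ultimately show ?case
      using c eng.prems cayley_chain_trans by (metis m_assoc)
  qed
  have one: "\<exists>l. cayley_chain G A (vertex \<one>\<^bsub>G\<^esub>) r l" if "r \<in> cayley_graph G A" for r
  proof -
    have v: "\<exists>l. cayley_chain G A (vertex \<one>\<^bsub>G\<^esub>) (vertex g) l" if "g \<in> carrier G" for g
      using vert[of g "\<one>\<^bsub>G\<^esub>"] that gen by auto
    from that consider g where "g \<in> carrier G" "r = vertex g"
      | g h t where "cayley_edge G A g h" "t \<in> {0..1}" "r = edge_point g h t"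
      by (auto simp: cayley_graph_def)
    then show ?thesis
    proof cases
      case 2
      then have "g \<in> carrier G" by (simp add: cayley_edge_def)
      with v obtain l where "cayley_chain G A (vertex \<one>\<^bsub>G\<^esub>) (edge_point g h 0) l" by auto
      then show ?thesis using 2 cayley_chain.step[of G A _ g h 0 l t] by auto
    qed (use v in auto)
  qed
  from one[OF p] one[OF q] show ?thesis
    using cayley_chain_sym cayley_chain_trans by metis
qed

lemma Metric_space_cayley_graph:
  assumes "group G" "finite_symmetric_generating_set G A"
  shows "Metric_space (cayley_graph G A) (cayley_dist G A)"
proof -
  have bdd: "bdd_below {l. cayley_chain G A p q l}" for p q
    by (rule bdd_belowI[of _ 0]) (blast dest: cayley_chain_in)
  have ne: "{l. cayley_chain G A p q l} \<noteq> {}"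
    if "p \<in> cayley_graph G A" "q \<in> cayley_graph G A" for p q
    using cayley_chain_exists[OF assms that] by auto
  have coord: "\<bar>p x - q x\<bar> \<le> cayley_dist G A p q"
    if "p \<in> cayley_graph G A" "q \<in> cayley_graph G A" for p q x
  proof -
    have "\<bar>p x - q x\<bar> \<le> Inf {l. cayley_chain G A p q l}"
      by (intro cInf_greatest ne that) (blast intro: cayley_chain_coord)
    with that show ?thesis by (simp add: cayley_dist_def)
  qed
  show ?thesis
  proof
    fix p q
    show "0 \<le> cayley_dist G A p q"
    proof (cases "p \<in> cayley_graph G A \<and> q \<in> cayley_graph G A")
      case True
      then show ?thesis using coord[of p q undefined] by linarith
    qed (auto simp: cayley_dist_def)
    have "{l. cayley_chain G A p q l} = {l. cayley_chain G A q p l}"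
      using cayley_chain_sym by blast
    then show "cayley_dist G A p q = cayley_dist G A q p"
      by (auto simp: cayley_dist_def)
  next
    fix p q assume pq: "p \<in> cayley_graph G A" "q \<in> cayley_graph G A"
    show "cayley_dist G A p q = 0 \<longleftrightarrow> p = q"
    proof
      assume "cayley_dist G A p q = 0"
      then show "p = q" using coord[OF pq] by (auto simp: fun_eq_iff)
    next
      assume "p = q"
      then have "cayley_dist G A p q \<le> 0"
        using pq by (auto simp: cayley_dist_def intro!: cInf_lower bdd cayley_chain.refl)
      then show "cayley_dist G A p q = 0" using coord[OF pq, of undefined] by linarith
    qed
    fix r assume r: "r \<in> cayley_graph G A"
    have "cayley_dist G A p r - l \<le> cayley_dist G A q r" if l: "cayley_chain G A p q l" for l
    proof -
      have "cayley_dist G A p r - l \<le> m" if "cayley_chain G A q r m" for m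
      proof -
        have "cayley_dist G A p r \<le> l + m"
          using pq r cayley_chain_trans[OF that l]
          by (auto simp: cayley_dist_def intro!: cInf_lower bdd)
        then show ?thesis by simp
      qed
      then show ?thesis
        using pq r ne[of q r] by (auto simp: cayley_dist_def[of G A q r] intro!: cInf_greatest)
    qed
    then have "cayley_dist G A p r - cayley_dist G A q r \<le> l" if "cayley_chain G A p q l" for l
      using that by (simp add: algebra_simps)
    then have "cayley_dist G A p r - cayley_dist G A q r \<le> cayley_dist G A p q"
      using pq ne[of p q] by (auto simp: cayley_dist_def[of G A p q] intro!: cInf_greatest)
    then show "cayley_dist G A p r \<le> cayley_dist G A p q + cayley_dist G A q r" by simp
  qed
qed

definition hyperbolic_group :: "('a, 'b) monoid_scheme \<Rightarrow> bool" where
  "hyperbolic_group G \<longleftrightarrow> group G \<and>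
     (\<exists>A. finite_symmetric_generating_set G A \<and>
          gromov_hyperbolic (cayley_graph G A) (cayley_dist G A))"

definition morse_local_to_global_group :: "('a, 'b) monoid_scheme \<Rightarrow> bool" where
  "morse_local_to_global_group G \<longleftrightarrow> group G \<and>
     (\<exists>A. finite_symmetric_generating_set G A \<and>
          morse_local_to_global_space (cayley_graph G A) (cayley_dist G A))"


section \<open>The Morse boundary\<close>

definition morse_rays_of_gauge ::
  "'p set \<Rightarrow> ('p \<Rightarrow> 'p \<Rightarrow> real) \<Rightarrow> 'p \<Rightarrow> (real \<Rightarrow> real \<Rightarrow> real) \<Rightarrow> (real \<Rightarrow> 'p) set" where
  "morse_rays_of_gauge X d e M =
     {\<gamma> \<in> extensional {0..}. geodesic X d {0..} \<gamma> \<and> is_morse X d M {0..} \<gamma> \<and> \<gamma> 0 = e}"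

definition morse_rays :: "'p set \<Rightarrow> ('p \<Rightarrow> 'p \<Rightarrow> real) \<Rightarrow> 'p \<Rightarrow> (real \<Rightarrow> 'p) set" where
  "morse_rays X d e = (\<Union>M\<in>Collect morse_gauge. morse_rays_of_gauge X d e M)"

text \<open>Two rays are asymptotic if their images have finite Hausdorff distance.\<close>

definition asymptotic ::
  "'p set \<Rightarrow> ('p \<Rightarrow> 'p \<Rightarrow> real) \<Rightarrow> 'p \<Rightarrow> ((real \<Rightarrow> 'p) \<times> (real \<Rightarrow> 'p)) set" where
  "asymptotic X d e =
     {(\<alpha>, \<beta>). \<alpha> \<in> morse_rays X d e \<and> \<beta> \<in> morse_rays X d e \<and>
        (\<exists>D. (\<forall>s\<ge>0. \<exists>t\<ge>0. d (\<alpha> s) (\<beta> t) \<le> D) \<and> (\<forall>t\<ge>0. \<exists>s\<ge>0. d (\<alpha> s) (\<beta> t) \<le> D))}"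

definition morse_boundary_set :: "'p set \<Rightarrow> ('p \<Rightarrow> 'p \<Rightarrow> real) \<Rightarrow> 'p \<Rightarrow> (real \<Rightarrow> 'p) set set" where
  "morse_boundary_set X d e = morse_rays X d e // asymptotic X d e"

definition morse_stratum_set ::
  "'p set \<Rightarrow> ('p \<Rightarrow> 'p \<Rightarrow> real) \<Rightarrow> 'p \<Rightarrow> (real \<Rightarrow> real \<Rightarrow> real) \<Rightarrow> (real \<Rightarrow> 'p) set set" where
  "morse_stratum_set X d e M = (\<lambda>\<gamma>. asymptotic X d e `` {\<gamma>}) ` morse_rays_of_gauge X d e M"

definition ray_topology ::
  "'p set \<Rightarrow> ('p \<Rightarrow> 'p \<Rightarrow> real) \<Rightarrow> 'p \<Rightarrow> (real \<Rightarrow> real \<Rightarrow> real) \<Rightarrow> (real \<Rightarrow> 'p) topology" where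
  "ray_topology X d e M = topology_generated_by
     {{\<gamma> \<in> morse_rays_of_gauge X d e M. \<gamma> ` K \<subseteq> U} | K U.
        compact K \<and> K \<subseteq> {0..} \<and> openin (Metric_space.mtopology X d) U}"

text \<open>A set of classes is open if the set of its \<open>M\<close>-Morse representatives is open in the compact-open
  topology \<^const>\<open>ray_topology\<close>.\<close>

definition morse_stratum ::
  "'p set \<Rightarrow> ('p \<Rightarrow> 'p \<Rightarrow> real) \<Rightarrow> 'p \<Rightarrow> (real \<Rightarrow> real \<Rightarrow> real) \<Rightarrow> (real \<Rightarrow> 'p) set topology" where
  "morse_stratum X d e M = topology (\<lambda>U. U \<subseteq> morse_stratum_set X d e M \<and>
     openin (ray_topology X d e M)
       {\<gamma> \<in> morse_rays_of_gauge X d e M. asymptotic X d e `` {\<gamma>} \<in> U})"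

definition morse_boundary ::
  "'p set \<Rightarrow> ('p \<Rightarrow> 'p \<Rightarrow> real) \<Rightarrow> 'p \<Rightarrow> (real \<Rightarrow> 'p) set topology" where
  "morse_boundary X d e = topology (\<lambda>U. U \<subseteq> morse_boundary_set X d e \<and>
     (\<forall>M. morse_gauge M \<longrightarrow> openin (morse_stratum X d e M) (U \<inter> morse_stratum_set X d e M)))"

lemma openin_morse_stratum:
  "openin (morse_stratum X d e M) U \<longleftrightarrow> U \<subseteq> morse_stratum_set X d e M \<and>
     openin (ray_topology X d e M)
       {\<gamma> \<in> morse_rays_of_gauge X d e M. asymptotic X d e `` {\<gamma>} \<in> U}"
proof -
  let ?R = "morse_rays_of_gauge X d e M" and ?q = "\<lambda>\<gamma>. asymptotic X d e `` {\<gamma>}"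
  have "istopology (\<lambda>U. U \<subseteq> morse_stratum_set X d e M \<and>
          openin (ray_topology X d e M) {\<gamma> \<in> ?R. ?q \<gamma> \<in> U})"
    unfolding istopology_def
  proof (intro conjI allI impI; (elim conjE)?)
    fix S T
    assume "openin (ray_topology X d e M) {\<gamma> \<in> ?R. ?q \<gamma> \<in> S}"
      "openin (ray_topology X d e M) {\<gamma> \<in> ?R. ?q \<gamma> \<in> T}"
    moreover have "{\<gamma> \<in> ?R. ?q \<gamma> \<in> S \<inter> T} = {\<gamma> \<in> ?R. ?q \<gamma> \<in> S} \<inter> {\<gamma> \<in> ?R. ?q \<gamma> \<in> T}" by auto
    ultimately show "openin (ray_topology X d e M) {\<gamma> \<in> ?R. ?q \<gamma> \<in> S \<inter> T}" by auto
  next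
    fix \<K>
    assume "\<forall>K\<in>\<K>. K \<subseteq> morse_stratum_set X d e M \<and>
      openin (ray_topology X d e M) {\<gamma> \<in> ?R. ?q \<gamma> \<in> K}"
    moreover have "{\<gamma> \<in> ?R. ?q \<gamma> \<in> \<Union>\<K>} = (\<Union>K\<in>\<K>. {\<gamma> \<in> ?R. ?q \<gamma> \<in> K})" by auto
    ultimately show "openin (ray_topology X d e M) {\<gamma> \<in> ?R. ?q \<gamma> \<in> \<Union>\<K>}"
      by (auto simp del: Union_iff intro!: openin_Union)
  qed auto
  then show ?thesis by (simp add: morse_stratum_def)
qed

lemma openin_morse_boundary:
  "openin (morse_boundary X d e) U \<longleftrightarrow> U \<subseteq> morse_boundary_set X d e \<and>
     (\<forall>M. morse_gauge M \<longrightarrow> openin (morse_stratum X d e M) (U \<inter> morse_stratum_set X d e M))"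
proof -
  have "istopology (\<lambda>U. U \<subseteq> morse_boundary_set X d e \<and>
     (\<forall>M. morse_gauge M \<longrightarrow> openin (morse_stratum X d e M) (U \<inter> morse_stratum_set X d e M)))"
    unfolding istopology_def
  proof (intro conjI allI impI; (elim conjE)?)
    fix S T M
    assume "morse_gauge M"
      "\<forall>M. morse_gauge M \<longrightarrow> openin (morse_stratum X d e M) (S \<inter> morse_stratum_set X d e M)"
      "\<forall>M. morse_gauge M \<longrightarrow> openin (morse_stratum X d e M) (T \<inter> morse_stratum_set X d e M)"
    moreover have "S \<inter> T \<inter> morse_stratum_set X d e M =
        (S \<inter> morse_stratum_set X d e M) \<inter> (T \<inter> morse_stratum_set X d e M)" by auto
    ultimately show "openin (morse_stratum X d e M) (S \<inter> T \<inter> morse_stratum_set X d e M)"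
      by (metis openin_Int)
  next
    fix \<K> M
    assume "morse_gauge M" and
      "\<forall>K\<in>\<K>. K \<subseteq> morse_boundary_set X d e \<and> (\<forall>M. morse_gauge M \<longrightarrow>
        openin (morse_stratum X d e M) (K \<inter> morse_stratum_set X d e M))"
    moreover have "\<Union>\<K> \<inter> morse_stratum_set X d e M = (\<Union>K\<in>\<K>. K \<inter> morse_stratum_set X d e M)"
      by auto
    ultimately show "openin (morse_stratum X d e M) (\<Union>\<K> \<inter> morse_stratum_set X d e M)"
      by (simp only:) (blast intro: openin_Union)
  qed auto
  then show ?thesis by (simp add: morse_boundary_def)
qed

lemma topspace_ray_topology: "topspace (ray_topology X d e M) = morse_rays_of_gauge X d e M"
proof -
  have "morse_rays_of_gauge X d e M \<in> {{\<gamma> \<in> morse_rays_of_gauge X d e M. \<gamma> ` K \<subseteq> U} | K U.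
        compact K \<and> K \<subseteq> {0..} \<and> openin (Metric_space.mtopology X d) U}"
    by (rule CollectI, rule exI[of _ "{}"], rule exI[of _ "{}"]) auto
  then show ?thesis unfolding ray_topology_def topology_generated_by_topspace by auto
qed

lemma topspace_morse_stratum: "topspace (morse_stratum X d e M) = morse_stratum_set X d e M"
proof -
  have "{\<gamma> \<in> morse_rays_of_gauge X d e M. asymptotic X d e `` {\<gamma>} \<in> morse_stratum_set X d e M}
      = topspace (ray_topology X d e M)"
    by (auto simp: topspace_ray_topology morse_stratum_set_def)
  then have "openin (morse_stratum X d e M) (morse_stratum_set X d e M)"
    by (simp add: openin_morse_stratum)
  then show ?thesis
    by (meson openin_morse_stratum openin_subset openin_topspace subset_antisym)
qed

lemma topspace_morse_boundary: "topspace (morse_boundary X d e) = morse_boundary_set X d e"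
proof -
  have "morse_boundary_set X d e \<inter> morse_stratum_set X d e M = topspace (morse_stratum X d e M)"
    if "morse_gauge M" for M
    using that
    by (auto simp: topspace_morse_stratum morse_stratum_set_def morse_boundary_set_def
        morse_rays_def intro!: quotientI)
  then have "openin (morse_boundary X d e) (morse_boundary_set X d e)"
    by (simp add: openin_morse_boundary)
  then show ?thesis
    by (meson openin_morse_boundary openin_subset openin_topspace subset_antisym)
qed

definition group_morse_boundary ::
  "('a, 'b) monoid_scheme \<Rightarrow> 'a set \<Rightarrow> (real \<Rightarrow> 'a \<Rightarrow> real) set topology" where
  "group_morse_boundary G A =
     morse_boundary (cayley_graph G A) (cayley_dist G A) (vertex \<one>\<^bsub>G\<^esub>)"


section \<open>Cannon--Thurston maps\<close>

text \<open>A choice, for every group element \<open>g\<close>, of a geodesic \<open>[e,g]\<close> in the Cayley graph.\<close>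

definition geodesic_choice ::
  "('a, 'b) monoid_scheme \<Rightarrow> 'a set \<Rightarrow> ('a \<Rightarrow> real \<Rightarrow> 'a \<Rightarrow> real) \<Rightarrow> bool" where
  "geodesic_choice G A geo \<longleftrightarrow>
     (\<forall>g\<in>carrier G. geodesic_between (cayley_graph G A) (cayley_dist G A)
                      (vertex \<one>\<^bsub>G\<^esub>) (vertex g) (geo g))"

text \<open>
  The geodesics \<open>geo (g n)\<close>, defined on \<open>[0, |g n|]\<close>, converge uniformly on compact subsets to a
  geodesic ray in the class \<open>x\<close>. In particular every compact subset of \<open>[0,\<infinity>)\<close> is eventually
  contained in their domains.
\<close>

definition geodesics_converge ::
  "('a, 'b) monoid_scheme \<Rightarrow> 'a set \<Rightarrow> ('a \<Rightarrow> real \<Rightarrow> 'a \<Rightarrow> real) \<Rightarrow> (nat \<Rightarrow> 'a) \<Rightarrow>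
   (real \<Rightarrow> 'a \<Rightarrow> real) set \<Rightarrow> bool" where
  "geodesics_converge G A geo g x \<longleftrightarrow>
     (\<exists>\<gamma>\<in>x. \<forall>T\<ge>0. \<forall>\<epsilon>>0. \<forall>\<^sub>F n in sequentially.
        T \<le> cayley_dist G A (vertex \<one>\<^bsub>G\<^esub>) (vertex (g n)) \<and>
        (\<forall>t\<in>{0..T}. cayley_dist G A (geo (g n) t) (\<gamma> t) < \<epsilon>))"

definition cannon_thurston_map ::
  "('a, 'b) monoid_scheme \<Rightarrow> 'a set \<Rightarrow> ('a \<Rightarrow> real \<Rightarrow> 'a \<Rightarrow> real) \<Rightarrow>
   'a set \<Rightarrow> 'a set \<Rightarrow> ('a \<Rightarrow> real \<Rightarrow> 'a \<Rightarrow> real) \<Rightarrow>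
   ((real \<Rightarrow> 'a \<Rightarrow> real) set \<Rightarrow> (real \<Rightarrow> 'a \<Rightarrow> real) set) \<Rightarrow> bool" where
  "cannon_thurston_map G A geoG H B geoH f \<longleftrightarrow>
     continuous_map (group_morse_boundary (G\<lparr>carrier := H\<rparr>) B) (group_morse_boundary G A) f \<and>
     (\<forall>x \<in> topspace (group_morse_boundary (G\<lparr>carrier := H\<rparr>) B). \<forall>h. range h \<subseteq> H \<longrightarrow>
        geodesics_converge (G\<lparr>carrier := H\<rparr>) B geoH h x \<longrightarrow>
        geodesics_converge G A geoG h (f x))"

end

theory Submission
  imports Defs "HOL-Library.Diagonal_Subsequence"
begin

text \<open>
  A Cannon--Thurston map forces \<open>G\<close> to be hyperbolic, and this is how it is excluded.

  Every geodesic in a Cayley graph of the hyperbolic group \<open>H\<close> is Morse with one common gauge, so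
  \<open>\<partial>\<^sub>*H\<close> is sequentially compact (\<open>boundary_sequentially_compact\<close>). A sequence in \<open>\<partial>\<^sub>*G\<close> that meets
  every stratum in a finite set is closed, so the continuous image of \<open>\<partial>\<^sub>*H\<close> is uniformly Morse
  (\<open>uniform_bound_on_compact_image\<close>): for a fixed \<open>D\<close>, every limit of geodesics \<open>[e, h\<^sub>j]\<^sub>G\<close> with
  \<open>h\<^sub>j \<in> H\<close> tending to infinity is a \<open>D\<close>-Morse ray, at least after passing to a subsequence.

  Since \<open>H\<close> is normal, this can be applied to the conjugates \<open>a\<inverse> b\<^sub>j a\<close> of one sequence \<open>b\<^sub>j\<close> in \<open>H\<close>.
  Translated by \<open>a\<close>, it yields \<open>D\<close>-Morse rays from every point \<open>a\<close> of \<open>G\<close>, limits of \<open>[a, b\<^sub>j a]\<close>,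
  whose targets \<open>b\<^sub>j a\<close> stay at bounded distance from \<open>b\<^sub>j\<close>. In general two such limits need not be
  asymptotic, because only initial parts of the geodesics are known to be Morse. So the sequence
  \<open>b\<^sub>j\<close> has to be chosen with care (\<open>robust_sequence_exists\<close>): let \<open>\<gamma>\<close> be a Morse ray from \<open>e\<close>, with
  vertices \<open>g\<^sub>T\<close>, and let \<open>\<mu>\<close> be the segment of \<open>\<gamma>\<close> from \<open>g\<^sub>T\<close> back to \<open>e\<close>, translated so as to start
  at \<open>e\<close>. Either for some \<open>h \<in> H\<close> the segments \<open>\<mu>\<close> and \<open>h\<mu>\<close> never meet, and then
  \<open>b\<^sub>T = g\<^sub>T h g\<^sub>T\<inverse>\<close> is joined to \<open>e\<close> by two long Morse segments linked by a path of bounded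
  length, or for every \<open>h \<in> H\<close> they do meet for some \<open>T\<close>, and \<open>h\<close> itself is joined to \<open>e\<close> by two
  Morse segments. In both cases a geodesic between points near \<open>e\<close> and near \<open>b\<^sub>j\<close> has to follow the
  first Morse segment up to the place where the two segments first come close
  (\<open>first_meeting_fellow_travel\<close>). Hence all rays obtained from \<open>b\<^sub>j\<close> are asymptotic.

  Thus there is a point at infinity towards which every point of \<open>G\<close> sends a ray of the same Morse
  quality. Seen from a far point on these rays, Gromov products satisfy the ultrametric inequality
  up to a constant (\<open>gromov_product_ultrametric\<close>), so \<open>G\<close> satisfies the four-point condition and is
  hyperbolic.

  The geometric arguments take place in the word metric, with integer distances and paths given by
  sequences of vertices. The passage to Cayley graphs rests on the rigidity of geodesics starting at a
  vertex: they are determined by the vertices which they visit (\<open>geodesic_rigid\<close>). The input on \<open>H\<close> is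
  the Morse lemma for hyperbolic spaces (\<open>coarse_qg_stability\<close>), which also allows the generating
  set witnessing hyperbolicity to differ from the given one.
\<close>

section \<open>Stable geodesics in discrete geodesic spaces\<close>

locale discrete_geodesic_space =
  fixes X :: "'a set" and d :: "'a \<Rightarrow> 'a \<Rightarrow> nat"
  assumes d_zero: "x \<in> X \<Longrightarrow> y \<in> X \<Longrightarrow> d x y = 0 \<longleftrightarrow> x = y"
    and d_sym: "x \<in> X \<Longrightarrow> y \<in> X \<Longrightarrow> d x y = d y x"
    and d_tri: "x \<in> X \<Longrightarrow> y \<in> X \<Longrightarrow> z \<in> X \<Longrightarrow> d x z \<le> d x y + d y z"
    and discrete_geodesic_exists: "x \<in> X \<Longrightarrow> y \<in> X \<Longrightarrow>
      \<exists>p. (\<forall>i\<le>d x y. p i \<in> X) \<and> p 0 = x \<and> p (d x y) = y \<and>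
        (\<forall>i j. i \<le> j \<and> j \<le> d x y \<longrightarrow> d (p i) (p j) = j - i)"
begin

lemma d_self [simp]: "x \<in> X \<Longrightarrow> d x x = 0"
  using d_zero by blast

definition geod :: "(nat \<Rightarrow> 'a) \<Rightarrow> nat \<Rightarrow> bool" where
  "geod p n \<longleftrightarrow> (\<forall>i\<le>n. p i \<in> X) \<and> (\<forall>i j. i \<le> j \<and> j \<le> n \<longrightarrow> d (p i) (p j) = j - i)"

text \<open>
  The multiplicative constant is fixed to \<open>3\<close>: this is what the projection to a geodesic produces
  (\<open>projection_cross\<close> below), and every path in the sequel is built from such projections.
\<close>

definition qg :: "nat \<Rightarrow> (nat \<Rightarrow> 'a) \<Rightarrow> nat \<Rightarrow> bool" where
  "qg c p m \<longleftrightarrow> (\<forall>i\<le>m. p i \<in> X) \<and> (\<forall>i<m. d (p i) (p (Suc i)) \<le> 1) \<and>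
     (\<forall>i j. i \<le> j \<and> j \<le> m \<longrightarrow> j - i \<le> 3 * d (p i) (p j) + c)"

text \<open>
  The Morse property restricted to the paths \<open>qg c\<close>; only the dependence of the gauge on the
  additive constant remains.
\<close>

definition stable :: "(nat \<Rightarrow> nat) \<Rightarrow> (nat \<Rightarrow> 'a) \<Rightarrow> nat \<Rightarrow> bool" where
  "stable D \<alpha> n \<longleftrightarrow> geod \<alpha> n \<and>
     (\<forall>s t c p m. s \<le> t \<and> t \<le> n \<and> qg c p m \<and> p 0 = \<alpha> s \<and> p m = \<alpha> t \<longrightarrow>
        (\<forall>i\<le>m. \<exists>j\<in>{s..t}. d (p i) (\<alpha> j) \<le> D c))"

definition join :: "(nat \<Rightarrow> 'a) \<Rightarrow> nat \<Rightarrow> (nat \<Rightarrow> 'a) \<Rightarrow> nat \<Rightarrow> 'a" where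
  "join p m q = (\<lambda>i. if i \<le> m then p i else q (i - m))"

lemma geod_in: "geod p n \<Longrightarrow> i \<le> n \<Longrightarrow> p i \<in> X"
  by (simp add: geod_def)

lemma geod_d: "geod p n \<Longrightarrow> i \<le> j \<Longrightarrow> j \<le> n \<Longrightarrow> d (p i) (p j) = j - i"
  by (simp add: geod_def)

lemma geod_d': "geod p n \<Longrightarrow> i \<le> n \<Longrightarrow> j \<le> n \<Longrightarrow> d (p i) (p j) = (j - i) + (i - j)"
  by (metis geod_d geod_in d_sym nat_le_linear diff_is_0_eq' add.right_neutral add.left_neutral)

lemma geod_between:
  assumes "x \<in> X" "y \<in> X"
  obtains p where "geod p (d x y)" "p 0 = x" "p (d x y) = y"
  using discrete_geodesic_exists[OF assms] unfolding geod_def by blast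

lemma geod_rev: "geod p n \<Longrightarrow> geod (\<lambda>i. p (n - i)) n"
  using geod_d' unfolding geod_def by fastforce

lemma geod_sub: "geod p n \<Longrightarrow> k + l \<le> n \<Longrightarrow> geod (\<lambda>i. p (k + i)) l"
  unfolding geod_def by auto

lemma geod_prefix: "geod p n \<Longrightarrow> l \<le> n \<Longrightarrow> geod p l"
  unfolding geod_def by auto

lemma geod_qg: "geod p n \<Longrightarrow> qg c p n"
  unfolding geod_def qg_def by auto

lemma qg_in: "qg c p n \<Longrightarrow> i \<le> n \<Longrightarrow> p i \<in> X"
  by (simp add: qg_def)

lemma qg_mono: "qg c p m \<Longrightarrow> c \<le> c' \<Longrightarrow> qg c' p m"
  unfolding qg_def by (meson add_le_mono1 le_trans add_left_mono)

lemma qg_rev: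
  assumes "qg c p m"
  shows "qg c (\<lambda>i. p (m - i)) m"
proof -
  have 1: "d (p (m - i)) (p (m - Suc i)) \<le> 1" if "i < m" for i
  proof -
    have "m - i = Suc (m - Suc i)" using that by simp
    moreover have "d (p (m - Suc i)) (p (Suc (m - Suc i))) \<le> 1"
      using assms that unfolding qg_def by simp
    ultimately show ?thesis using assms that d_sym unfolding qg_def by (metis diff_le_self)
  qed
  have 2: "j - i \<le> 3 * d (p (m - i)) (p (m - j)) + c" if "i \<le> j" "j \<le> m" for i j
  proof -
    have "m - j \<le> m - i" "m - i \<le> m" using that by auto
    then have "(m - i) - (m - j) \<le> 3 * d (p (m - j)) (p (m - i)) + c"
      using assms unfolding qg_def by blast
    moreover have "(m - i) - (m - j) = j - i" using that by simp
    ultimately show ?thesis using assms that d_sym unfolding qg_def by (metis diff_le_self)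
  qed
  show ?thesis using 1 2 assms unfolding qg_def by auto
qed

lemma qg_join:
  assumes p: "qg c p m" and q: "qg c q n" and e: "p m = q 0"
    and cross: "\<And>i j. i \<le> m \<Longrightarrow> j \<le> n \<Longrightarrow> (m - i) + j \<le> 3 * d (p i) (q j) + c"
  shows "qg c (join p m q) (m + n)"
  unfolding qg_def
proof (intro conjI allI impI)
  fix i assume "i \<le> m + n"
  then show "join p m q i \<in> X" using p q unfolding qg_def join_def by auto
next
  fix i assume i: "i < m + n"
  show "d (join p m q i) (join p m q (Suc i)) \<le> 1"
  proof (cases "i < m")
    case True then show ?thesis using p unfolding qg_def join_def by auto
  next
    case False
    then have "join p m q i = q (i - m)" "join p m q (Suc i) = q (Suc (i - m))"
      using e by (auto simp: join_def Suc_diff_le)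
    then show ?thesis using q False i unfolding qg_def by auto
  qed
next
  fix i j assume ij: "i \<le> j \<and> j \<le> m + n"
  consider "j \<le> m" | "i \<le> m" "m < j" | "m < i" "m < j" using ij by linarith
  then show "j - i \<le> 3 * d (join p m q i) (join p m q j) + c"
  proof cases
    case 1 then show ?thesis using p ij unfolding qg_def join_def by auto
  next
    case 2 then show ?thesis using cross[of i "j - m"] ij unfolding join_def by auto
  next
    case 3
    have "i - m \<le> j - m" "j - m \<le> n" using ij by auto
    then have "(j - m) - (i - m) \<le> 3 * d (q (i - m)) (q (j - m)) + c"
      using q unfolding qg_def by blast
    then show ?thesis using 3 ij unfolding join_def by auto
  qed
qed

lemma join_0 [simp]: "join p m q 0 = p 0"
  by (simp add: join_def)

lemma join_end: "p m = q 0 \<Longrightarrow> join p m q (m + n) = q n"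
  by (cases n) (auto simp: join_def)

lemma join_right: "p m = q 0 \<Longrightarrow> join p m q (m + i) = q i"
  by (rule join_end)

lemma join_left: "i \<le> m \<Longrightarrow> join p m q i = p i"
  by (simp add: join_def)

text \<open>
  Bounded detours at the ends only cost an additive constant, so stability may be applied to paths
  whose endpoints are merely close to the geodesic.
\<close>

lemma qg_extend_front:
  assumes p: "qg c p m" and z: "z \<in> X" "d z (p 0) \<le> C"
  shows "\<exists>p' l. qg (c + 4 * C) p' (l + m) \<and> p' 0 = z \<and> (\<forall>i. p' (l + i) = p i)"
proof -
  have p0: "p 0 \<in> X" using p by (simp add: qg_def)
  obtain q where q: "geod q (d z (p 0))" "q 0 = z" "q (d z (p 0)) = p 0"
    using geod_between[OF z(1) p0] by blast
  let ?l = "d z (p 0)"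
  have "qg (c + 4 * C) (join q ?l p) (?l + m)"
  proof (rule qg_join)
    show "qg (c + 4 * C) q ?l" using q geod_qg by blast
    show "qg (c + 4 * C) p m" using p qg_mono by (meson le_add1)
    show "q ?l = p 0" using q by simp
    fix i j assume ij: "i \<le> ?l" "j \<le> m"
    have pj: "p j \<in> X" and qi: "q i \<in> X" using p ij q by (auto simp: qg_def geod_def)
    have "j \<le> 3 * d (p 0) (p j) + c" using p ij by (force simp: qg_def)
    moreover have "d (p 0) (p j) \<le> d (p 0) (q i) + d (q i) (p j)"
      using d_tri p0 pj qi by blast
    moreover have "d (p 0) (q i) = ?l - i"
      using geod_d[OF q(1), of i ?l] ij q(3) d_sym p0 qi by simp
    ultimately show "?l - i + j \<le> 3 * d (q i) (p j) + (c + 4 * C)" using z(2) by linarith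
  qed
  moreover have "join q ?l p 0 = z" using q by simp
  moreover have "\<forall>i. join q ?l p (?l + i) = p i" using join_right q(3) by metis
  ultimately show ?thesis by blast
qed

lemma qg_extend:
  assumes p: "qg c p m" and z: "z \<in> X" "d z (p 0) \<le> C" and z': "z' \<in> X" "d z' (p m) \<le> C'"
  obtains p' m' where "qg (c + 4 * C + 4 * C') p' m'" "p' 0 = z" "p' m' = z'"
    "\<And>i. i \<le> m \<Longrightarrow> \<exists>i'\<le>m'. p' i' = p i"
proof -
  obtain p1 l1 where 1: "qg (c + 4 * C) p1 (l1 + m)" "p1 0 = z" "\<forall>i. p1 (l1 + i) = p i"
    using qg_extend_front[OF p z] by blast
  let ?r = "\<lambda>i. p1 (l1 + m - i)"
  have r: "qg (c + 4 * C) ?r (l1 + m)" using qg_rev[OF 1(1)] .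
  have "d z' (?r 0) \<le> C'" using z' 1 by simp
  then obtain p2 l2 where 2: "qg (c + 4 * C + 4 * C') p2 (l2 + (l1 + m))" "p2 0 = z'" "\<forall>i. p2 (l2 + i) = ?r i"
    using qg_extend_front[OF r z'(1)] by blast
  let ?m = "l2 + (l1 + m)" and ?p = "\<lambda>i. p2 (l2 + (l1 + m) - i)"
  show thesis
  proof
    show "qg (c + 4 * C + 4 * C') ?p ?m" using qg_rev[OF 2(1)] .
    show "?p 0 = z" using 2(3)[rule_format, of "l1 + m"] 1 by simp
    show "?p ?m = z'" using 2 by simp
    fix i assume i: "i \<le> m"
    have "?p (l1 + i) = p2 (l2 + (m - i))" using i by (auto intro!: arg_cong[of _ _ p2])
    also have "\<dots> = p1 (l1 + m - (m - i))" using 2(3) by simp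
    also have "\<dots> = p1 (l1 + i)" using i by simp
    finally have "?p (l1 + i) = p i" using 1(3) by simp
    then show "\<exists>i'\<le>?m. ?p i' = p i" using i by (metis add.commute add_le_mono le_add1 le_add2 le_trans add_left_mono)
  qed
qed

lemma stableD:
  assumes "stable D \<alpha> n" "s \<le> t" "t \<le> n" "qg c p m" "p 0 = \<alpha> s" "p m = \<alpha> t" "i \<le> m"
  shows "\<exists>j. s \<le> j \<and> j \<le> t \<and> d (p i) (\<alpha> j) \<le> D c"
proof -
  have "\<exists>j\<in>{s..t}. d (p i) (\<alpha> j) \<le> D c"
    using assms(1)[unfolded stable_def, THEN conjunct2, rule_format, of s t c p m i] assms(2-) by blast
  then show ?thesis by auto
qed

lemma stable_geod: "stable D \<alpha> n \<Longrightarrow> geod \<alpha> n"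
  by (simp add: stable_def)

lemma stable_rev:
  assumes st: "stable D \<alpha> n"
  shows "stable D (\<lambda>i. \<alpha> (n - i)) n"
  unfolding stable_def
proof (intro conjI allI impI)
  show "geod (\<lambda>i. \<alpha> (n - i)) n" using geod_rev[OF stable_geod[OF st]] .
  fix s t c p m i
  assume a: "s \<le> t \<and> t \<le> n \<and> qg c p m \<and> p 0 = \<alpha> (n - s) \<and> p m = \<alpha> (n - t)" and i: "i \<le> m"
  have "qg c (\<lambda>i. p (m - i)) m" using qg_rev[of c p m] a by simp
  then have "\<exists>j. n - t \<le> j \<and> j \<le> n - s \<and> d (p (m - (m - i))) (\<alpha> j) \<le> D c"
    using stableD[OF st, of "n - t" "n - s" c "\<lambda>i. p (m - i)" m "m - i"] a diff_le_mono2[of s t n] by simp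
  then obtain j where j: "n - t \<le> j" "j \<le> n - s" "d (p i) (\<alpha> j) \<le> D c" using i by auto
  have ts: "s \<le> t" "t \<le> n" using a by auto
  have "n - j \<in> {s..t}" using j(1,2) ts by auto
  moreover have "d (p i) (\<alpha> (n - (n - j))) \<le> D c" using j ts by simp
  ultimately show "\<exists>j\<in>{s..t}. d (p i) (\<alpha> (n - j)) \<le> D c" by blast
qed

lemma stable_sub:
  assumes st: "stable D \<alpha> n" and kl: "k + l \<le> n"
  shows "stable D (\<lambda>i. \<alpha> (k + i)) l"
  unfolding stable_def
proof (intro conjI allI impI)
  show "geod (\<lambda>i. \<alpha> (k + i)) l" using geod_sub[OF stable_geod[OF st] kl] .
  fix s t c p m i
  assume a: "s \<le> t \<and> t \<le> l \<and> qg c p m \<and> p 0 = \<alpha> (k + s) \<and> p m = \<alpha> (k + t)" and i: "i \<le> m"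
  have "\<exists>j. k + s \<le> j \<and> j \<le> k + t \<and> d (p i) (\<alpha> j) \<le> D c"
    by (rule stableD[OF st, of "k + s" "k + t"]) (use a i kl in simp_all)
  then obtain j where j: "k + s \<le> j" "j \<le> k + t" "d (p i) (\<alpha> j) \<le> D c" by blast
  then have "k + (j - k) = j" "j - k \<in> {s..t}" by auto
  then show "\<exists>j\<in>{s..t}. d (p i) (\<alpha> (k + j)) \<le> D c" using j by metis
qed

lemma stable_prefix: "stable D \<alpha> n \<Longrightarrow> l \<le> n \<Longrightarrow> stable D \<alpha> l"
  using stable_sub[of D \<alpha> n 0 l] by simp

lemma stable_near:
  assumes st: "stable D \<alpha> n" and p: "qg c p m" and s: "s \<le> n" and t: "t \<le> n"
    and C: "d (p 0) (\<alpha> s) \<le> C" and C': "d (p m) (\<alpha> t) \<le> C'" and i: "i \<le> m"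
  shows "\<exists>j. min s t \<le> j \<and> j \<le> max s t \<and> d (p i) (\<alpha> j) \<le> D (c + 4 * C + 4 * C')"
proof -
  have aX: "\<alpha> s \<in> X" "\<alpha> t \<in> X" using st s t by (auto simp: stable_def geod_def)
  have pX: "p 0 \<in> X" "p m \<in> X" using p by (auto simp: qg_def)
  obtain p' m' where p': "qg (c + 4 * C + 4 * C') p' m'" "p' 0 = \<alpha> s" "p' m' = \<alpha> t"
    "\<And>i. i \<le> m \<Longrightarrow> \<exists>i'\<le>m'. p' i' = p i"
    using qg_extend[OF p aX(1) _ aX(2), of C C'] C C' d_sym aX pX by metis
  obtain i' where i': "i' \<le> m'" "p' i' = p i" using p'(4)[OF i] by blast
  show ?thesis
  proof (cases "s \<le> t")
    case True
    then show ?thesis using stableD[OF st True t p'(1-3) i'(1)] i' by auto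
  next
    case False
    have "\<exists>j. t \<le> j \<and> j \<le> s \<and> d (p' (m' - (m' - i'))) (\<alpha> j) \<le> D (c + 4 * C + 4 * C')"
      using stableD[OF st _ s qg_rev[OF p'(1)], of t "m' - i'"] False p'(2,3) by simp
    then show ?thesis using False i' by auto
  qed
qed

lemma closest_exists:
  fixes n :: nat
  obtains k where "k \<le> n" "\<And>i. i \<le> n \<Longrightarrow> d q (\<eta> k) \<le> d q (\<eta> i)"
proof -
  have "\<exists>k\<le>n. \<forall>i\<le>n. d q (\<eta> k) \<le> d q (\<eta> i)"
  proof (induction n)
    case 0 then show ?case by auto
  next
    case (Suc n)
    then obtain k where k: "k \<le> n" "\<forall>i\<le>n. d q (\<eta> k) \<le> d q (\<eta> i)" by blast
    show ?case
    proof (cases "d q (\<eta> k) \<le> d q (\<eta> (Suc n))")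
      case True then show ?thesis using k by (metis le_SucI le_Suc_eq)
    next
      case False then show ?thesis using k by (metis le_Suc_eq le_trans nat_le_linear)
    qed
  qed
  then show thesis using that by blast
qed

text \<open>
  If \<open>\<eta> k\<close> is a point of \<open>\<eta>\<close> closest to \<open>q\<close>, then it is also closest to every point \<open>u i\<close> of a
  geodesic from \<open>q\<close> to \<open>\<eta> k\<close>. So the way from \<open>u i\<close> to \<open>\<eta> k\<close> is at most \<open>d (u i) (\<eta> j)\<close>, and the
  remaining way along \<open>\<eta>\<close> at most twice this distance.
\<close>

lemma projection_cross:
  assumes u: "geod u l" "u 0 = q" "u l = \<eta> k" and \<eta>: "geod \<eta> n" and k: "k \<le> n"
    and cl: "\<And>i. i \<le> n \<Longrightarrow> d q (\<eta> k) \<le> d q (\<eta> i)" and i: "i \<le> l" and j: "j \<le> n"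
  shows "(l - i) + ((j - k) + (k - j)) \<le> 3 * d (u i) (\<eta> j)"
proof -
  have X: "u i \<in> X" "\<eta> j \<in> X" "\<eta> k \<in> X" "q \<in> X" using u \<eta> i j k by (auto simp: geod_def)
  have "d q (u i) = i" using geod_d[OF u(1), of 0 i] i u by simp
  moreover have ukl: "d (u i) (\<eta> k) = l - i" using geod_d[OF u(1), of i l] i u by simp
  moreover have "d q (\<eta> k) = l" using geod_d[OF u(1), of 0 l] u by simp
  moreover have "d q (\<eta> j) \<le> d q (u i) + d (u i) (\<eta> j)" using d_tri X by blast
  ultimately have 1: "l - i \<le> d (u i) (\<eta> j)" using cl[OF j] by linarith
  have "d (\<eta> k) (\<eta> j) \<le> d (\<eta> k) (u i) + d (u i) (\<eta> j)" using d_tri X by blast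
  then have "(j - k) + (k - j) \<le> (l - i) + d (u i) (\<eta> j)"
    using geod_d'[OF \<eta> k j] ukl d_sym X by simp
  then show ?thesis using 1 by linarith
qed

lemma qg_project:
  assumes \<eta>: "geod \<eta> n" and q: "q \<in> X" and k: "k \<le> n"
    and cl: "\<And>i. i \<le> n \<Longrightarrow> d q (\<eta> k) \<le> d q (\<eta> i)"
  obtains p m where "qg 0 p m" "p 0 = q" "p m = \<eta> 0" "\<And>i. i \<le> k \<Longrightarrow> \<exists>j\<le>m. p j = \<eta> i"
proof -
  let ?l = "d q (\<eta> k)"
  have kX: "\<eta> k \<in> X" using \<eta> k by (simp add: geod_def)
  obtain u where u: "geod u ?l" "u 0 = q" "u ?l = \<eta> k" using geod_between[OF q kX] by blast
  let ?v = "\<lambda>i. \<eta> (k - i)"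
  have v: "geod ?v k" using geod_rev[OF geod_prefix[OF \<eta> k]] .
  have e: "u ?l = ?v 0" using u by simp
  show thesis
  proof
    show "qg 0 (join u ?l ?v) (?l + k)"
    proof (rule qg_join)
      show "qg 0 u ?l" "qg 0 ?v k" using u v geod_qg by auto
      fix i j assume ij: "i \<le> ?l" "j \<le> k"
      show "?l - i + j \<le> 3 * d (u i) (\<eta> (k - j)) + 0"
        using projection_cross[OF u \<eta> k cl ij(1), of "k - j"] ij k by auto
    qed (use e in simp)
    show "join u ?l ?v 0 = q" using u by simp
    show "join u ?l ?v (?l + k) = \<eta> 0" using join_end[of u ?l ?v k] e by simp
    fix i assume i: "i \<le> k"
    then have "join u ?l ?v (?l + (k - i)) = \<eta> i" using join_end[of u ?l ?v "k - i"] e by simp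
    then show "\<exists>j\<le>?l + k. join u ?l ?v j = \<eta> i" by (metis add_left_mono diff_le_self)
  qed
qed

text \<open>
  This is the way in which stability is exploited: a geodesic need not end near \<open>\<alpha>\<close> in order to
  follow \<open>\<alpha>\<close>, it does so up to its projection of the end of \<open>\<alpha>\<close>.
\<close>

lemma project_near:
  assumes \<alpha>: "stable D \<alpha> m" and \<eta>: "geod \<eta> n" and q: "q \<in> X" and k: "k \<le> n"
    and cl: "\<And>i. i \<le> n \<Longrightarrow> d q (\<eta> k) \<le> d q (\<eta> i)"
    and C: "d (\<eta> 0) (\<alpha> 0) \<le> C" and C': "d q (\<alpha> m) \<le> C'" and i: "i \<le> k"
  shows "\<exists>j\<le>m. d (\<eta> i) (\<alpha> j) \<le> D (4 * C + 4 * C')"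
proof -
  obtain p l where p: "qg 0 p l" "p 0 = q" "p l = \<eta> 0" "\<And>i. i \<le> k \<Longrightarrow> \<exists>j\<le>l. p j = \<eta> i"
    using qg_project[OF \<eta> q k cl] by blast
  obtain j where j: "j \<le> l" "p j = \<eta> i" using p(4)[OF i] by blast
  have "d (p 0) (\<alpha> m) \<le> C'" "d (p l) (\<alpha> 0) \<le> C" using p(2,3) C C' by simp_all
  then have "\<exists>j'. min m 0 \<le> j' \<and> j' \<le> max m 0 \<and> d (p j) (\<alpha> j') \<le> D (0 + 4 * C' + 4 * C)"
    using stable_near[OF \<alpha> p(1) le_refl le0 _ _ j(1)] by blast
  then obtain j' where "j' \<le> m" "d (\<eta> i) (\<alpha> j') \<le> D (4 * C' + 4 * C)" unfolding j(2) by auto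
  then show ?thesis by (metis add.commute)
qed

lemma project_near_both:
  assumes \<alpha>: "stable D \<alpha> m" and \<beta>: "stable D \<beta> r" and \<eta>: "geod \<eta> n" and q: "q \<in> X"
    and C: "d (\<eta> 0) (\<alpha> 0) \<le> C" and C': "d q (\<alpha> m) \<le> C'"
    and E: "d (\<eta> n) (\<beta> 0) \<le> E" and E': "d q (\<beta> r) \<le> E'"
  obtains k where "k \<le> n"
    "\<And>i. i \<le> k \<Longrightarrow> \<exists>j\<le>m. d (\<eta> i) (\<alpha> j) \<le> D (4 * C + 4 * C')"
    "\<And>i. k \<le> i \<Longrightarrow> i \<le> n \<Longrightarrow> \<exists>j\<le>r. d (\<eta> i) (\<beta> j) \<le> D (4 * E + 4 * E')"
proof -
  obtain k where k: "k \<le> n" "\<And>i. i \<le> n \<Longrightarrow> d q (\<eta> k) \<le> d q (\<eta> i)" using closest_exists by blast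
  show thesis
  proof
    show "k \<le> n" by fact
    show "\<exists>j\<le>m. d (\<eta> i) (\<alpha> j) \<le> D (4 * C + 4 * C')" if "i \<le> k" for i
      by (rule project_near[OF \<alpha> \<eta> q k(1) k(2) C C' that])
    fix i assume i: "k \<le> i" "i \<le> n"
    have "\<exists>j\<le>r. d (\<eta> (n - (n - i))) (\<beta> j) \<le> D (4 * E + 4 * E')"
      using project_near[OF \<beta> geod_rev[OF \<eta>] q, of "n - k" E E' "n - i"] k i E E' by simp
    then show "\<exists>j\<le>r. d (\<eta> i) (\<beta> j) \<le> D (4 * E + 4 * E')" using i by simp
  qed
qed

text \<open>
  The bound \<open>D 0\<close> does not depend on \<open>E\<close>: away from their ends, a geodesic is as close to a stable
  one as if they had common endpoints. The path that goes from one end of \<open>\<alpha>\<close> to its projection on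
  \<open>\<beta>\<close>, follows \<open>\<beta>\<close>, and returns to the other end of \<open>\<alpha>\<close> is a quasi-geodesic without additive
  constant as soon as the detours are short compared with the middle part.
\<close>

lemma fellow_travel_close:
  assumes \<alpha>: "stable D \<alpha> T" and \<beta>: "geod \<beta> T'"
    and E0: "d (\<alpha> 0) (\<beta> 0) \<le> E" and E1: "d (\<alpha> T) (\<beta> T') \<le> E"
    and T: "8 * E \<le> T" and r: "2 * E \<le> r" "r + 2 * E \<le> T'"
  shows "\<exists>s\<le>T. d (\<alpha> s) (\<beta> r) \<le> D 0"
proof -
  have \<alpha>g: "geod \<alpha> T" using \<alpha> by (simp add: stable_def)
  obtain r1 where r1: "r1 \<le> T'" "\<And>i. i \<le> T' \<Longrightarrow> d (\<alpha> 0) (\<beta> r1) \<le> d (\<alpha> 0) (\<beta> i)"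
    using closest_exists by blast
  obtain r2 where r2: "r2 \<le> T'" "\<And>i. i \<le> T' \<Longrightarrow> d (\<alpha> T) (\<beta> r2) \<le> d (\<alpha> T) (\<beta> i)"
    using closest_exists by blast
  have X: "\<alpha> 0 \<in> X" "\<alpha> T \<in> X" "\<beta> 0 \<in> X" "\<beta> T' \<in> X" "\<beta> r1 \<in> X" "\<beta> r2 \<in> X"
    using \<alpha>g \<beta> r1 r2 by (auto simp: geod_def)
  define l1 l2 where "l1 = d (\<alpha> 0) (\<beta> r1)" and "l2 = d (\<alpha> T) (\<beta> r2)"
  have l1: "l1 \<le> E" using r1(2)[of 0] E0 by (simp add: l1_def)
  have l2: "l2 \<le> E" using r2(2)[of T'] E1 by (simp add: l2_def)
  have r1E: "r1 \<le> 2 * E"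
  proof -
    have "d (\<beta> 0) (\<beta> r1) \<le> d (\<beta> 0) (\<alpha> 0) + d (\<alpha> 0) (\<beta> r1)" using d_tri X by blast
    then show ?thesis using geod_d[OF \<beta>, of 0 r1] r1(1) d_sym X E0 l1 by (simp add: l1_def)
  qed
  have r2E: "T' \<le> r2 + 2 * E"
  proof -
    have "d (\<beta> r2) (\<beta> T') \<le> d (\<beta> r2) (\<alpha> T) + d (\<alpha> T) (\<beta> T')" using d_tri X by blast
    then show ?thesis using geod_d[OF \<beta>, of r2 T'] r2(1) d_sym X E1 l2 by (simp add: l2_def)
  qed
  have r12: "r1 \<le> r" "r \<le> r2" using r1E r2E r by auto
  have len: "6 * E \<le> r2 - r1"
  proof -
    have "d (\<alpha> 0) (\<alpha> T) \<le> d (\<alpha> 0) (\<beta> r1) + d (\<beta> r1) (\<alpha> T)"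
      "d (\<beta> r1) (\<alpha> T) \<le> d (\<beta> r1) (\<beta> r2) + d (\<beta> r2) (\<alpha> T)" using d_tri X by blast+
    then show ?thesis
      using geod_d[OF \<beta>, of r1 r2] geod_d[OF \<alpha>g, of 0 T] r12 r2(1) d_sym X l1 l2 T
      by (simp add: l1_def l2_def)
  qed
  obtain u where u: "geod u l1" "u 0 = \<alpha> 0" "u l1 = \<beta> r1"
    using geod_between[of "\<alpha> 0" "\<beta> r1"] X by (auto simp: l1_def)
  obtain w where w: "geod w l2" "w 0 = \<alpha> T" "w l2 = \<beta> r2"
    using geod_between[of "\<alpha> T" "\<beta> r2"] X by (auto simp: l2_def)
  let ?v = "\<lambda>i. \<beta> (r1 + i)" and ?w = "\<lambda>i. w (l2 - i)"
  have v: "geod ?v (r2 - r1)" using geod_sub[OF \<beta>, of r1 "r2 - r1"] r12 r2(1) by simp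
  have e1: "u l1 = ?v 0" using u by simp
  let ?uv = "join u l1 ?v"
  have uv: "qg 0 ?uv (l1 + (r2 - r1))"
  proof (rule qg_join)
    fix i j assume ij: "i \<le> l1" "j \<le> r2 - r1"
    show "l1 - i + j \<le> 3 * d (u i) (\<beta> (r1 + j)) + 0"
      using projection_cross[OF u \<beta> r1(1) r1(2) ij(1), of "r1 + j"] ij r12 r2(1) by auto
  qed (use u v e1 geod_qg in auto)
  have e2: "?uv (l1 + (r2 - r1)) = ?w 0"
    using join_end[of u l1 ?v "r2 - r1"] e1 w r12 by simp
  have uvw: "qg 0 (join ?uv (l1 + (r2 - r1)) ?w) (l1 + (r2 - r1) + l2)"
  proof (rule qg_join)
    show "qg 0 ?w l2" using geod_qg[OF geod_rev[OF w(1)]] .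
    fix i j assume ij: "i \<le> l1 + (r2 - r1)" "j \<le> l2"
    show "l1 + (r2 - r1) - i + j \<le> 3 * d (?uv i) (w (l2 - j)) + 0"
    proof (cases "l1 < i")
      case True
      then have "?uv i = \<beta> (r1 + (i - l1))" by (simp add: join_def)
      moreover have "l2 - (l2 - j) + ((r1 + (i - l1) - r2) + (r2 - (r1 + (i - l1))))
          \<le> 3 * d (w (l2 - j)) (\<beta> (r1 + (i - l1)))"
        by (rule projection_cross[OF w \<beta> r2(1) r2(2)]) (use ij r12 r2(1) in auto)
      moreover have "w (l2 - j) \<in> X" "\<beta> (r1 + (i - l1)) \<in> X"
        using w(1) \<beta> ij r2(1) r12 by (auto simp: geod_def)
      ultimately show ?thesis using d_sym ij True by simp
    next
      case False
      then have uv_i: "?uv i = u i" by (simp add: join_def)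
      have Y: "u i \<in> X" "w (l2 - j) \<in> X" using u(1) w(1) False by (auto simp: geod_def)
      have "d (u i) (\<beta> r1) = l1 - i" using geod_d[OF u(1), of i l1] False u by simp
      moreover have "d (w (l2 - j)) (\<beta> r2) = j" using geod_d[OF w(1), of "l2 - j" l2] ij w by simp
      moreover have "d (\<beta> r1) (\<beta> r2) \<le> d (\<beta> r1) (u i) + d (u i) (\<beta> r2)"
        "d (u i) (\<beta> r2) \<le> d (u i) (w (l2 - j)) + d (w (l2 - j)) (\<beta> r2)" using d_tri X Y by blast+
      moreover have "d (\<beta> r1) (\<beta> r2) = r2 - r1" using geod_d[OF \<beta>] r12 r2(1) by simp
      ultimately have "r2 - r1 \<le> (l1 - i) + d (u i) (w (l2 - j)) + j" using d_sym X Y by simp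
      then show ?thesis unfolding uv_i using len l1 l2 ij by linarith
    qed
  qed (use uv e2 in auto)
  let ?p = "join ?uv (l1 + (r2 - r1)) ?w"
  have "?p (l1 + (r - r1)) = ?uv (l1 + (r - r1))" using r12 by (intro join_left) simp
  also have "\<dots> = \<beta> r" using join_right[of u l1 ?v "r - r1"] e1 r12 by simp
  finally have pr: "?p (l1 + (r - r1)) = \<beta> r" .
  have "\<exists>j. 0 \<le> j \<and> j \<le> T \<and> d (?p (l1 + (r - r1))) (\<alpha> j) \<le> D 0"
  proof -
    have "?p 0 = \<alpha> 0" using u by simp
    moreover have "?p (l1 + (r2 - r1) + l2) = \<alpha> T"
      using join_end[of ?uv "l1 + (r2 - r1)" ?w l2] e2 w by simp
    moreover have "l1 + (r - r1) \<le> l1 + (r2 - r1) + l2" using r12 by simp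
    ultimately show ?thesis using stableD[OF \<alpha> _ _ uvw, of 0 T "l1 + (r - r1)"] by blast
  qed
  then obtain j where j: "j \<le> T" "d (\<beta> r) (\<alpha> j) \<le> D 0" using pr by auto
  have "\<beta> r \<in> X" "\<alpha> j \<in> X" using \<beta> \<alpha>g j r by (auto simp: geod_def)
  then show ?thesis using j d_sym by metis
qed

end

section \<open>The four-point condition from asymptotic stable rays\<close>

context discrete_geodesic_space
begin

lemma geod_close_index:
  assumes \<eta>: "geod \<eta> n" and \<alpha>: "geod \<alpha> m" and i: "i \<le> n" and j: "j \<le> m"
    and C: "d (\<eta> 0) (\<alpha> 0) \<le> C" and K: "d (\<eta> i) (\<alpha> j) \<le> K"
  shows "i \<le> j + K + C" "j \<le> i + K + C"
proof -
  have X: "\<eta> 0 \<in> X" "\<alpha> 0 \<in> X" "\<eta> i \<in> X" "\<alpha> j \<in> X" using \<eta> \<alpha> i j by (auto simp: geod_def)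
  have "d (\<eta> 0) (\<eta> i) = i" "d (\<alpha> 0) (\<alpha> j) = j" using geod_d[OF \<eta>, of 0 i] geod_d[OF \<alpha>, of 0 j] i j by auto
  moreover have "d (\<eta> 0) (\<eta> i) \<le> d (\<eta> 0) (\<alpha> 0) + d (\<alpha> 0) (\<eta> i)"
    "d (\<alpha> 0) (\<eta> i) \<le> d (\<alpha> 0) (\<alpha> j) + d (\<alpha> j) (\<eta> i)"
    "d (\<alpha> 0) (\<alpha> j) \<le> d (\<alpha> 0) (\<eta> 0) + d (\<eta> 0) (\<alpha> j)"
    "d (\<eta> 0) (\<alpha> j) \<le> d (\<eta> 0) (\<eta> i) + d (\<eta> i) (\<alpha> j)" using d_tri X by blast+
  ultimately show "i \<le> j + K + C" "j \<le> i + K + C" using C K d_sym X by simp_all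
qed

text \<open>
  Let \<open>\<alpha>\<close> and \<open>\<beta>\<close> start at the two ends of \<open>\<eta>\<close>, up to \<open>C\<close>, and come \<open>E1\<close>-close at their other ends,
  and suppose that there is no earlier point at which they are \<open>D 0\<close>-close. The point of \<open>\<eta>\<close> closest
  to \<open>\<alpha> s\<close> is near both \<open>\<alpha> s0\<close> and \<open>\<beta> r0\<close>. If \<open>s0\<close> were much smaller than \<open>s\<close>, then
  \<open>fellow_travel_close\<close>, applied to the parts of \<open>\<alpha>\<close> and \<open>\<beta>\<close> after this point, would produce an
  earlier \<open>D 0\<close>-close pair. So \<open>\<eta>\<close> follows \<open>\<alpha>\<close> nearly up to \<open>s\<close>, with a constant independent of \<open>s\<close>.
\<close>

lemma first_meeting_fellow_travel:
  assumes \<alpha>: "stable D \<alpha> s" and \<beta>: "stable D \<beta> r" and E1: "d (\<alpha> s) (\<beta> r) \<le> E1"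
    and minimal: "\<And>s' r'. s' \<le> s \<Longrightarrow> r' \<le> r \<Longrightarrow> d (\<alpha> s') (\<beta> r') \<le> D 0 \<Longrightarrow> s + r \<le> s' + r'"
    and \<eta>: "geod \<eta> n" and C: "d (\<eta> 0) (\<alpha> 0) \<le> C" "d (\<eta> n) (\<beta> 0) \<le> C"
    and K1: "K1 = D (4 * C)" and E: "E = K1 + D (4 * C + 4 * E1) + E1"
    and F: "F = 8 * E + D 0" and K: "K = 2 * F + 3 * K1 + 2 * C"
  shows "\<And>i. i \<le> s \<Longrightarrow> i \<le> n \<Longrightarrow> d (\<eta> i) (\<alpha> i) \<le> K" and "s \<le> n + K"
proof -
  have \<alpha>g: "geod \<alpha> s" and \<beta>g: "geod \<beta> r" using \<alpha> \<beta> by (auto simp: stable_def)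
  have qX: "\<alpha> s \<in> X" using \<alpha>g by (simp add: geod_def)
  obtain k where k: "k \<le> n"
    and near\<alpha>: "\<And>i. i \<le> k \<Longrightarrow> \<exists>j\<le>s. d (\<eta> i) (\<alpha> j) \<le> D (4 * C + 4 * 0)"
    and near\<beta>: "\<And>i. k \<le> i \<Longrightarrow> i \<le> n \<Longrightarrow> \<exists>j\<le>r. d (\<eta> i) (\<beta> j) \<le> D (4 * C + 4 * E1)"
    using project_near_both[OF \<alpha> \<beta> \<eta> qX C(1) _ C(2) E1, of 0] qX by auto
  obtain s0 where s0: "s0 \<le> s" "d (\<eta> k) (\<alpha> s0) \<le> K1" using near\<alpha>[of k] K1 by auto
  obtain r0 where r0: "r0 \<le> r" "d (\<eta> k) (\<beta> r0) \<le> D (4 * C + 4 * E1)" using near\<beta>[of k] k by auto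
  have X: "\<eta> k \<in> X" "\<alpha> s0 \<in> X" "\<beta> r0 \<in> X" "\<beta> r \<in> X"
    using \<eta> \<alpha>g \<beta>g s0 r0 k by (auto simp: geod_def)
  have k0: "k \<le> s0 + K1 + C" "s0 \<le> k + K1 + C" using geod_close_index[OF \<eta> \<alpha>g k s0(1) C(1) s0(2)] .
  have meet: "d (\<alpha> s0) (\<beta> r0) \<le> E"
    using d_tri[of "\<alpha> s0" "\<eta> k" "\<beta> r0"] X s0 r0 d_sym E by fastforce
  have sF: "s \<le> s0 + F"
  proof (rule ccontr)
    assume "\<not> s \<le> s0 + F"
    then have big: "8 * E + D 0 < s - s0" using F by linarith
    let ?\<alpha> = "\<lambda>i. \<alpha> (s0 + i)" and ?\<beta> = "\<lambda>i. \<beta> (r0 + i)"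
    have \<alpha>': "stable D ?\<alpha> (s - s0)" using stable_sub[OF \<alpha>, of s0 "s - s0"] s0 by simp
    have \<beta>': "geod ?\<beta> (r - r0)" using geod_sub[OF \<beta>g, of r0 "r - r0"] r0 by simp
    have "d (\<alpha> s0) (\<alpha> s) \<le> d (\<alpha> s0) (\<beta> r0) + d (\<beta> r0) (\<alpha> s)"
      "d (\<beta> r0) (\<alpha> s) \<le> d (\<beta> r0) (\<beta> r) + d (\<beta> r) (\<alpha> s)" using d_tri X qX by blast+
    then have len: "s - s0 \<le> (r - r0) + 2 * E"
      using geod_d[OF \<alpha>g s0(1)] geod_d[OF \<beta>g r0(1)] meet E1 E d_sym X qX by simp
    have "\<exists>s'\<le>s - s0. d (?\<alpha> s') (?\<beta> (2 * E)) \<le> D 0"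
      using fellow_travel_close[OF \<alpha>' \<beta>', of E "2 * E"] meet E1 s0 r0 E big len by simp
    then obtain s' where s': "s' \<le> s - s0" "d (?\<alpha> s') (?\<beta> (2 * E)) \<le> D 0" by blast
    have rE: "r0 + 2 * E \<le> r" using len big by linarith
    have "s + r \<le> (s0 + s') + (r0 + 2 * E)"
      using minimal[of "s0 + s'" "r0 + 2 * E"] s' rE s0 by simp
    moreover have "s' \<le> 0 + D 0 + E + 2 * E"
    proof -
      have Y: "\<alpha> (s0 + s') \<in> X" "\<beta> (r0 + 2 * E) \<in> X" using \<alpha>g \<beta>g s' s0 rE by (auto simp: geod_def)
      have "d (\<alpha> s0) (\<alpha> (s0 + s')) \<le> d (\<alpha> s0) (\<beta> r0) + d (\<beta> r0) (\<alpha> (s0 + s'))"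
        "d (\<beta> r0) (\<alpha> (s0 + s')) \<le> d (\<beta> r0) (\<beta> (r0 + 2 * E)) + d (\<beta> (r0 + 2 * E)) (\<alpha> (s0 + s'))"
        using d_tri X Y by blast+
      moreover have "d (\<alpha> s0) (\<alpha> (s0 + s')) = s'" using geod_d[OF \<alpha>g, of s0 "s0 + s'"] s' s0 by simp
      moreover have "d (\<beta> r0) (\<beta> (r0 + 2 * E)) = 2 * E" using geod_d[OF \<beta>g, of r0 "r0 + 2 * E"] rE by simp
      ultimately show ?thesis using s'(2) meet d_sym Y by simp
    qed
    ultimately show False using len big s0 r0 by linarith
  qed
  show "s \<le> n + K" using sF k0 k K by linarith
  fix i assume i: "i \<le> s" "i \<le> n"
  have Xi: "\<eta> i \<in> X" "\<alpha> i \<in> X" using \<eta> \<alpha>g i by (auto simp: geod_def)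
  show "d (\<eta> i) (\<alpha> i) \<le> K"
  proof (cases "i \<le> k")
    case True
    then obtain j where j: "j \<le> s" "d (\<eta> i) (\<alpha> j) \<le> K1" using near\<alpha> K1 by auto
    have ij: "i \<le> j + K1 + C" "j \<le> i + K1 + C" using geod_close_index[OF \<eta> \<alpha>g i(2) j(1) C(1) j(2)] .
    have "\<alpha> j \<in> X" using \<alpha>g j by (simp add: geod_def)
    then have "d (\<eta> i) (\<alpha> i) \<le> d (\<eta> i) (\<alpha> j) + d (\<alpha> j) (\<alpha> i)" using d_tri Xi by blast
    then show ?thesis using geod_d'[OF \<alpha>g j(1) i(1)] ij j(2) K by linarith
  next
    case False
    have "d (\<eta> i) (\<alpha> i) \<le> d (\<eta> i) (\<eta> k) + d (\<eta> k) (\<alpha> i)"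
      "d (\<eta> k) (\<alpha> i) \<le> d (\<eta> k) (\<alpha> s0) + d (\<alpha> s0) (\<alpha> i)" using d_tri X Xi by blast+
    then show ?thesis
      using geod_d'[OF \<eta> i(2) k] geod_d'[OF \<alpha>g s0(1) i(1)] False sF k0 s0(2) i K by linarith
  qed
qed

definition reaches :: "(nat \<Rightarrow> nat) \<Rightarrow> nat \<Rightarrow> 'a \<Rightarrow> 'a \<Rightarrow> bool" where
  "reaches D C p x \<longleftrightarrow> (\<exists>\<alpha> m. stable D \<alpha> m \<and> \<alpha> 0 = x \<and> d p (\<alpha> m) \<le> C)"

text \<open>
  Both \<open>\<alpha>\<close> and \<open>\<beta>\<close> run to \<open>p\<close>. A geodesic between their starting points follows \<open>\<alpha>\<close> up to the point
  closest to \<open>p\<close>, and \<open>\<beta>\<close> from there on; hence \<open>\<alpha>\<close> and \<open>\<beta>\<close> are close at this point and,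
  being stable, from there up to \<open>p\<close>. The bound on \<open>s\<close> says that \<open>2s\<close> is, up to a constant, at most
  twice the Gromov product at \<open>p\<close>.
\<close>

lemma tripod:
  assumes \<alpha>: "stable D \<alpha> m" and \<beta>: "stable D \<beta> l" and p: "p \<in> X" "d p (\<alpha> m) \<le> C" "d p (\<beta> l) \<le> C"
    and K1: "K1 = D (4 * C)" and K2: "K2 = D (8 * K1 + 8 * C)"
    and s: "2 * s + 4 * K1 + 4 * C + d (\<alpha> 0) (\<beta> 0) \<le> d (\<alpha> 0) p + d (\<beta> 0) p"
  shows "s \<le> m \<and> d (\<alpha> (m - s)) (\<beta> (l - s)) \<le> 2 * K2 + 2 * C"
proof -
  have \<alpha>g: "geod \<alpha> m" and \<beta>g: "geod \<beta> l" using \<alpha> \<beta> by (auto simp: stable_def)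
  have X0: "\<alpha> 0 \<in> X" "\<beta> 0 \<in> X" "\<alpha> m \<in> X" "\<beta> l \<in> X" using \<alpha>g \<beta>g by (auto simp: geod_def)
  define n where "n = d (\<alpha> 0) (\<beta> 0)"
  obtain \<eta> where \<eta>: "geod \<eta> n" "\<eta> 0 = \<alpha> 0" "\<eta> n = \<beta> 0" using geod_between[OF X0(1,2)] n_def by blast
  obtain k where k: "k \<le> n"
    and near\<alpha>: "\<And>i. i \<le> k \<Longrightarrow> \<exists>j\<le>m. d (\<eta> i) (\<alpha> j) \<le> D (4 * 0 + 4 * C)"
    and near\<beta>: "\<And>i. k \<le> i \<Longrightarrow> i \<le> n \<Longrightarrow> \<exists>j\<le>l. d (\<eta> i) (\<beta> j) \<le> D (4 * 0 + 4 * C)"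
    using project_near_both[OF \<alpha> \<beta> \<eta>(1) p(1) _ p(2) _ p(3), of 0 0] X0 \<eta> by auto
  obtain j where j: "j \<le> m" "d (\<eta> k) (\<alpha> j) \<le> K1" using near\<alpha>[of k] K1 by auto
  obtain j' where j': "j' \<le> l" "d (\<eta> k) (\<beta> j') \<le> K1" using near\<beta>[of k] k K1 by auto
  have X: "\<eta> k \<in> X" "\<alpha> j \<in> X" "\<beta> j' \<in> X" using \<eta> \<alpha>g \<beta>g j j' k by (auto simp: geod_def)
  have "d (\<alpha> 0) (\<eta> k) = k" using geod_d[OF \<eta>(1), of 0 k] \<eta> k by simp
  have "d (\<eta> k) (\<beta> 0) = n - k" using geod_d[OF \<eta>(1), of k n] \<eta> k by simp
  have jm: "d (\<alpha> j) (\<alpha> m) = m - j" using geod_d[OF \<alpha>g, of j m] j by simp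
  have "d (\<alpha> 0) p \<le> d (\<alpha> 0) (\<eta> k) + d (\<eta> k) p" "d (\<beta> 0) p \<le> d (\<beta> 0) (\<eta> k) + d (\<eta> k) p"
    "d (\<eta> k) p \<le> d (\<eta> k) (\<alpha> j) + d (\<alpha> j) p" "d (\<alpha> j) p \<le> d (\<alpha> j) (\<alpha> m) + d (\<alpha> m) p"
    using d_tri X X0 p by blast+
  then have sj: "s \<le> m - j"
    using s \<open>d (\<alpha> 0) (\<eta> k) = k\<close> \<open>d (\<eta> k) (\<beta> 0) = n - k\<close> jm j(2) p d_sym X X0 n_def k by simp
  then have sm: "s \<le> m" by simp
  let ?\<gamma> = "\<lambda>i. \<alpha> (j + i)"
  have \<gamma>: "geod ?\<gamma> (m - j)" using geod_sub[OF \<alpha>g, of j "m - j"] j by simp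
  have "d (\<alpha> j) (\<beta> j') \<le> d (\<alpha> j) (\<eta> k) + d (\<eta> k) (\<beta> j')" "d (\<alpha> m) (\<beta> l) \<le> d (\<alpha> m) p + d p (\<beta> l)"
    using d_tri X X0 p by blast+
  then have e: "d (?\<gamma> 0) (\<beta> j') \<le> 2 * K1" "d (?\<gamma> (m - j)) (\<beta> l) \<le> 2 * C"
    using j j' p d_sym X X0 by simp_all
  have "\<exists>i. min j' l \<le> i \<and> i \<le> max j' l \<and> d (?\<gamma> (m - j - s)) (\<beta> i) \<le> D (0 + 4 * (2 * K1) + 4 * (2 * C))"
    by (rule stable_near[OF \<beta> geod_qg[OF \<gamma>] j'(1) le_refl e diff_le_self])
  then obtain i where i: "i \<le> l" "d (\<alpha> (m - s)) (\<beta> i) \<le> K2" using K2 j'(1) sj j(1) by auto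
  have Y: "\<alpha> (m - s) \<in> X" "\<beta> i \<in> X" "\<beta> (l - s) \<in> X" using \<alpha>g \<beta>g i by (auto simp: geod_def)
  have "d (\<alpha> (m - s)) (\<alpha> m) \<le> d (\<alpha> (m - s)) (\<beta> i) + d (\<beta> i) (\<alpha> m)"
    "d (\<beta> i) (\<alpha> m) \<le> d (\<beta> i) (\<beta> l) + d (\<beta> l) (\<alpha> m)"
    "d (\<beta> i) (\<beta> l) \<le> d (\<beta> i) (\<alpha> (m - s)) + d (\<alpha> (m - s)) (\<beta> l)"
    "d (\<alpha> (m - s)) (\<beta> l) \<le> d (\<alpha> (m - s)) (\<alpha> m) + d (\<alpha> m) (\<beta> l)"
    "d (\<alpha> (m - s)) (\<beta> (l - s)) \<le> d (\<alpha> (m - s)) (\<beta> i) + d (\<beta> i) (\<beta> (l - s))" using d_tri X0 Y by blast+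
  moreover have "d (\<alpha> (m - s)) (\<alpha> m) = s" using geod_d[OF \<alpha>g, of "m - s" m] sm by simp
  moreover have "d (\<beta> i) (\<beta> l) = l - i" using geod_d[OF \<beta>g i(1)] by simp
  moreover have "d (\<beta> i) (\<beta> (l - s)) = (l - s - i) + (i - (l - s))" using geod_d'[OF \<beta>g i(1)] by simp
  moreover have "d (\<beta> l) (\<alpha> m) \<le> 2 * C" using e(2) d_sym X0 j(1) by simp
  moreover have "d (\<beta> i) (\<alpha> (m - s)) \<le> K2" using i(2) d_sym Y by simp
  moreover have "d (\<alpha> m) (\<beta> l) \<le> 2 * C" using e(2) j(1) by simp
  ultimately have "d (\<alpha> (m - s)) (\<beta> (l - s)) \<le> 2 * K2 + 2 * C" using i(1,2) by linarith
  then show ?thesis using sm by blast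
qed

text \<open>
  The quantities compared are twice the Gromov products at \<open>p\<close>. At distance \<open>s\<close> from \<open>p\<close> the
  three geodesics are pairwise close by \<open>tripod\<close>, and passing through these points bounds \<open>d x y\<close>.
\<close>

lemma gromov_product_ultrametric:
  assumes p: "p \<in> X" and x: "reaches D C p x" and y: "reaches D C p y" and z: "reaches D C p z"
    and K1: "K1 = D (4 * C)" and K2: "K2 = D (8 * K1 + 8 * C)"
    and K: "K = 4 * K2 + 4 * K1 + 10 * C + 2"
  shows "min (int (d x p + d z p) - int (d x z)) (int (d z p + d y p) - int (d z y))
    \<le> int (d x p + d y p) - int (d x y) + int K"
proof -
  obtain \<alpha> m where \<alpha>: "stable D \<alpha> m" "\<alpha> 0 = x" "d p (\<alpha> m) \<le> C" using x unfolding reaches_def by blast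
  obtain \<beta> l where \<beta>: "stable D \<beta> l" "\<beta> 0 = y" "d p (\<beta> l) \<le> C" using y unfolding reaches_def by blast
  obtain \<gamma> h where \<gamma>: "stable D \<gamma> h" "\<gamma> 0 = z" "d p (\<gamma> h) \<le> C" using z unfolding reaches_def by blast
  have g: "geod \<alpha> m" "geod \<beta> l" "geod \<gamma> h" using \<alpha> \<beta> \<gamma> by (auto simp: stable_def)
  have X: "x \<in> X" "y \<in> X" "z \<in> X" "\<alpha> m \<in> X" "\<beta> l \<in> X" using g \<alpha>(2) \<beta>(2) \<gamma>(2) by (auto simp: geod_def)
  define t where "t = min (int (d x p + d z p) - int (d x z)) (int (d z p + d y p) - int (d z y)) - int (4 * K1 + 4 * C)"
  define s where "s = nat (t div 2)"
  have xy: "d x y \<le> d x p + d y p" using d_tri[of x p y] d_sym X p by simp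
  show ?thesis
  proof (cases "0 \<le> t")
    case False
    then show ?thesis using xy K unfolding t_def by linarith
  next
    case True
    then have s: "2 * int s \<le> t" "t \<le> 2 * int s + 1" unfolding s_def by auto
    have "2 * s + 4 * K1 + 4 * C + d (\<alpha> 0) (\<gamma> 0) \<le> d (\<alpha> 0) p + d (\<gamma> 0) p"
      using s(1) unfolding t_def \<alpha>(2) \<gamma>(2) by linarith
    from tripod[OF \<alpha>(1) \<gamma>(1) p \<alpha>(3) \<gamma>(3) K1 K2 this]
    have 1: "s \<le> m" "d (\<alpha> (m - s)) (\<gamma> (h - s)) \<le> 2 * K2 + 2 * C" by auto
    have "2 * s + 4 * K1 + 4 * C + d (\<beta> 0) (\<gamma> 0) \<le> d (\<beta> 0) p + d (\<gamma> 0) p"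
      using s(1) d_sym[OF X(2,3)] unfolding t_def \<beta>(2) \<gamma>(2) by linarith
    from tripod[OF \<beta>(1) \<gamma>(1) p \<beta>(3) \<gamma>(3) K1 K2 this]
    have 2: "s \<le> l" "d (\<beta> (l - s)) (\<gamma> (h - s)) \<le> 2 * K2 + 2 * C" by auto
    have Y: "\<alpha> (m - s) \<in> X" "\<beta> (l - s) \<in> X" "\<gamma> (h - s) \<in> X" using g by (auto simp: geod_def)
    have "d x (\<alpha> (m - s)) = m - s" "d x (\<alpha> m) = m" using geod_d[OF g(1), of 0] \<alpha>(2) by auto
    moreover have "d y (\<beta> (l - s)) = l - s" "d y (\<beta> l) = l" using geod_d[OF g(2), of 0] \<beta>(2) by auto
    moreover have "d x y \<le> d x (\<alpha> (m - s)) + d (\<alpha> (m - s)) y"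
       "d (\<alpha> (m - s)) y \<le> d (\<alpha> (m - s)) (\<beta> (l - s)) + d (\<beta> (l - s)) y"
       "d (\<alpha> (m - s)) (\<beta> (l - s)) \<le> d (\<alpha> (m - s)) (\<gamma> (h - s)) + d (\<gamma> (h - s)) (\<beta> (l - s))"
       "d x (\<alpha> m) \<le> d x p + d p (\<alpha> m)" "d y (\<beta> l) \<le> d y p + d p (\<beta> l)"
      using d_tri X Y p by blast+
    moreover have "d (\<beta> (l - s)) y = d y (\<beta> (l - s))" "d (\<gamma> (h - s)) (\<beta> (l - s)) = d (\<beta> (l - s)) (\<gamma> (h - s))"
      using d_sym Y X by auto
    ultimately have "int (d x y) \<le> int (d x p) + int (d y p) + 2 * int C - 2 * int s + 4 * int K2 + 4 * int C"
      using 1 2 \<alpha>(3) \<beta>(3) by linarith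
    then show ?thesis using s(2) K unfolding t_def by linarith
  qed
qed

definition four_point :: bool where
  "four_point \<longleftrightarrow> (\<exists>\<delta>. \<forall>w\<in>X. \<forall>x\<in>X. \<forall>y\<in>X. \<forall>z\<in>X.
     d x y + d z w \<le> max (d x z + d y w) (d y z + d x w) + \<delta>)"

text \<open>
  The base point \<open>p\<close> may depend on the four points. Four instances of the ultrametric inequality at \<open>p\<close>,
  two with the product of \<open>x\<close> and \<open>y\<close> and two with that of \<open>z\<close> and \<open>w\<close> on the larger side, suffice.
\<close>

lemma four_point_of_reaches:
  assumes common: "\<And>w x y z. w \<in> X \<Longrightarrow> x \<in> X \<Longrightarrow> y \<in> X \<Longrightarrow> z \<in> X \<Longrightarrow>
    \<exists>p\<in>X. reaches D C p w \<and> reaches D C p x \<and> reaches D C p y \<and> reaches D C p z"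
  shows four_point
proof -
  define K1 where "K1 = D (4 * C)"
  define K2 where "K2 = D (8 * K1 + 8 * C)"
  define K where "K = 4 * K2 + 4 * K1 + 10 * C + 2"
  have "d x y + d z w \<le> max (d x z + d y w) (d y z + d x w) + 2 * K"
    if X: "w \<in> X" "x \<in> X" "y \<in> X" "z \<in> X" for w x y z
  proof -
    obtain p where p: "p \<in> X" "reaches D C p w" "reaches D C p x" "reaches D C p y" "reaches D C p z"
      using common[OF X] by blast
    note U = gromov_product_ultrametric[OF p(1) _ _ _ K1_def K2_def K_def]
    have sy: "d y x = d x y" "d z x = d x z" "d w x = d x w" "d z y = d y z" "d w y = d y w" "d w z = d z w"
      using d_sym X by auto
    define xy xz xw yz yw zw where "xy = int (d x p + d y p) - int (d x y)"
      and "xz = int (d x p + d z p) - int (d x z)" and "xw = int (d x p + d w p) - int (d x w)"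
      and "yz = int (d y p + d z p) - int (d y z)" and "yw = int (d y p + d w p) - int (d y w)"
      and "zw = int (d z p + d w p) - int (d z w)"
    note defs = xy_def xz_def xw_def yz_def yw_def zw_def
    have 1: "min xz yz \<le> xy + int K" using U[OF p(3,4,5)] by (simp add: defs sy add.commute)
    have 2: "min xw yw \<le> xy + int K" using U[OF p(3,4,2)] by (simp add: defs sy add.commute)
    have 3: "min xz xw \<le> zw + int K" using U[OF p(5,2,3)] by (simp add: defs sy add.commute)
    have 4: "min yz yw \<le> zw + int K" using U[OF p(5,2,4)] by (simp add: defs sy add.commute)
    have "min (xz + yw) (yz + xw) \<le> xy + zw + 2 * int K" using 1 2 3 4 by linarith
    then have "int (d x y + d z w) \<le> max (int (d x z + d y w)) (int (d y z + d x w)) + 2 * int K"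
      unfolding defs by linarith
    then show ?thesis by linarith
  qed
  then show ?thesis unfolding four_point_def by blast
qed

text \<open>
  A far point of the ray \<open>\<rho> base\<close> serves as \<open>p\<close>: by \<open>fellow_travel_close\<close> all the rays pass near
  it, with a constant that no longer depends on their starting points.
\<close>

lemma four_point_of_asymptotic_stable_rays:
  assumes base: "base \<in> X" and st: "\<And>a n. a \<in> X \<Longrightarrow> stable D (\<rho> a) n" and start: "\<And>a. a \<in> X \<Longrightarrow> \<rho> a 0 = a"
    and asym: "\<And>a. a \<in> X \<Longrightarrow> \<exists>K. \<forall>t. d (\<rho> a t) (\<rho> base t) \<le> K"
  shows four_point
proof (rule four_point_of_reaches)
  obtain K where K: "\<And>a t. a \<in> X \<Longrightarrow> d (\<rho> a t) (\<rho> base t) \<le> K a" using asym by metis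
  have og: "geod (\<rho> base) n" for n using st[OF base] by (auto simp: stable_def)
  have reach: "reaches D (D 0) (\<rho> base T) a" if a: "a \<in> X" and T: "2 * K a \<le> T" for a T
  proof -
    have "\<exists>s\<le>T + 8 * K a. d (\<rho> a s) (\<rho> base T) \<le> D 0"
      by (rule fellow_travel_close[OF st[OF a] og[of "T + 8 * K a"], of "K a"])
        (use K[OF a] T in auto)
    then obtain s where s: "d (\<rho> a s) (\<rho> base T) \<le> D 0" by blast
    have "\<rho> a s \<in> X" "\<rho> base T \<in> X" using st[OF a, of s] og[of T] by (auto simp: stable_def geod_def)
    then show ?thesis unfolding reaches_def using st[OF a] start[OF a] s d_sym by metis
  qed
  fix w x y z assume X: "w \<in> X" "x \<in> X" "y \<in> X" "z \<in> X"
  let ?T = "2 * (K w + K x + K y + K z)"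
  have "\<rho> base ?T \<in> X" using og[of ?T] by (auto simp: geod_def)
  then show "\<exists>p\<in>X. reaches D (D 0) p w \<and> reaches D (D 0) p x \<and> reaches D (D 0) p y \<and> reaches D (D 0) p z"
    using reach[of _ ?T] X by (intro bexI[of _ "\<rho> base ?T"]) auto
qed

end

section \<open>Groups with a normal subgroup all of whose geodesics have stable limits\<close>

locale discrete_geodesic_group = group G + discrete_geodesic_space "carrier G" d
  for G (structure) and d +
  assumes d_translate: "\<lbrakk>g \<in> carrier G; x \<in> carrier G; y \<in> carrier G\<rbrakk> \<Longrightarrow> d (g \<otimes> x) (g \<otimes> y) = d x y"
    and finite_ball: "finite {x \<in> carrier G. d \<one> x \<le> n}"
begin

lemma d_one_inv: "x \<in> carrier G \<Longrightarrow> d \<one> (inv x) = d \<one> x"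
  using d_translate[of x \<one> "inv x"] d_sym[of x \<one>] by simp

lemma geod_translate: "geod p n \<Longrightarrow> g \<in> carrier G \<Longrightarrow> geod (\<lambda>i. g \<otimes> p i) n"
  unfolding geod_def using d_translate by simp

lemma qg_translate: "qg c p n \<Longrightarrow> g \<in> carrier G \<Longrightarrow> qg c (\<lambda>i. g \<otimes> p i) n"
  unfolding qg_def using d_translate by simp

lemma stable_translate:
  assumes st: "stable D \<alpha> n" and g: "g \<in> carrier G"
  shows "stable D (\<lambda>i. g \<otimes> \<alpha> i) n"
  unfolding stable_def
proof (intro conjI allI impI)
  have \<alpha>g: "geod \<alpha> n" using stable_geod[OF st] .
  then show "geod (\<lambda>i. g \<otimes> \<alpha> i) n" using geod_translate g by blast
  fix s t c p m i
  assume a: "s \<le> t \<and> t \<le> n \<and> qg c p m \<and> p 0 = g \<otimes> \<alpha> s \<and> p m = g \<otimes> \<alpha> t" and i: "i \<le> m"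
  have X: "\<alpha> j \<in> carrier G" if "j \<le> t" for j using \<alpha>g a that by (auto simp: geod_def)
  have q: "qg c (\<lambda>i. inv g \<otimes> p i) m" using qg_translate[of c p m "inv g"] a g by simp
  have 0: "inv g \<otimes> p 0 = \<alpha> s" "inv g \<otimes> p m = \<alpha> t" using a X g by (auto simp: m_assoc[symmetric])
  obtain j where j: "s \<le> j" "j \<le> t" "d (inv g \<otimes> p i) (\<alpha> j) \<le> D c"
    using stableD[OF st _ _ q, of s t i] 0 a i by auto
  have pX: "p i \<in> carrier G" using a i by (auto simp: qg_def)
  have "d (p i) (g \<otimes> \<alpha> j) = d (inv g \<otimes> p i) (\<alpha> j)"
    using d_translate[of g "inv g \<otimes> p i" "\<alpha> j"] X[OF j(2)] pX g by (simp add: m_assoc[symmetric])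
  then show "\<exists>j\<in>{s..t}. d (p i) (g \<otimes> \<alpha> j) \<le> D c" using j by (intro bexI[of _ j]) simp_all
qed

lemma far_element:
  assumes "infinite H" "H \<subseteq> carrier G"
  obtains h where "h \<in> H" "n \<le> d \<one> h"
proof -
  have "\<not> H \<subseteq> {x \<in> carrier G. d \<one> x \<le> n}" using assms finite_ball finite_subset by blast
  then show thesis using that assms by force
qed

text \<open>
  Going from \<open>\<one>\<close> along \<open>\<alpha>\<close> and then backwards along a stable geodesic \<open>\<beta>\<close> leads to \<open>b\<close>, and the
  switch happens at the first possible place, up to \<open>E\<close>.
\<close>

definition meeting :: "(nat \<Rightarrow> nat) \<Rightarrow> nat \<Rightarrow> 'a \<Rightarrow> (nat \<Rightarrow> 'a) \<Rightarrow> nat \<Rightarrow> bool" where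
  "meeting D E b \<alpha> s \<longleftrightarrow> stable D \<alpha> s \<and> \<alpha> 0 = \<one> \<and>
     (\<exists>\<beta> r. stable D \<beta> r \<and> \<beta> 0 = b \<and> d (\<alpha> s) (\<beta> r) \<le> E \<and>
        (\<forall>s'\<le>s. \<forall>r'\<le>r. d (\<alpha> s') (\<beta> r') \<le> D 0 \<longrightarrow> s + r \<le> s' + r'))"

lemma meeting_fellow_travel:
  "\<exists>K. \<forall>b \<alpha> s \<eta> n. meeting D E b \<alpha> s \<and> geod \<eta> n \<and> d (\<eta> 0) \<one> \<le> C \<and> d (\<eta> n) b \<le> C \<longrightarrow>
     s \<le> n + K \<and> (\<forall>i\<le>s. i \<le> n \<longrightarrow> d (\<eta> i) (\<alpha> i) \<le> K)"
proof (intro exI allI impI)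
  fix b \<alpha> s \<eta> n
  assume a: "meeting D E b \<alpha> s \<and> geod \<eta> n \<and> d (\<eta> 0) \<one> \<le> C \<and> d (\<eta> n) b \<le> C"
  then obtain \<beta> r where m: "stable D \<alpha> s" "stable D \<beta> r" "d (\<alpha> s) (\<beta> r) \<le> E"
    and min: "\<And>s' r'. s' \<le> s \<Longrightarrow> r' \<le> r \<Longrightarrow> d (\<alpha> s') (\<beta> r') \<le> D 0 \<Longrightarrow> s + r \<le> s' + r'"
    and 0: "\<beta> 0 = b" "\<alpha> 0 = \<one>" unfolding meeting_def by blast
  have \<eta>: "geod \<eta> n" "d (\<eta> 0) (\<alpha> 0) \<le> C" "d (\<eta> n) (\<beta> 0) \<le> C" using a 0 by auto
  note ft = first_meeting_fellow_travel[OF m min \<eta> HOL.refl HOL.refl HOL.refl HOL.refl]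
  show "s \<le> n + (2 * (8 * (D (4 * C) + D (4 * C + 4 * E) + E) + D 0) + 3 * D (4 * C) + 2 * C) \<and>
     (\<forall>i\<le>s. i \<le> n \<longrightarrow> d (\<eta> i) (\<alpha> i) \<le> 2 * (8 * (D (4 * C) + D (4 * C + 4 * E) + E) + D 0) + 3 * D (4 * C) + 2 * C)"
    using ft by blast
qed

text \<open>
  The segment \<open>\<mu>\<close> runs backwards along \<open>\<gamma>\<close> and is translated to start at \<open>\<one>\<close>. If \<open>\<mu>\<close> and \<open>h\<mu>\<close> are
  never \<open>D 0\<close>-close, whatever \<open>T\<close> is, then the conjugates \<open>\<gamma> T \<otimes> h \<otimes> inv \<gamma> T\<close>, which lie in \<open>H\<close> by
  normality, have the required property. Otherwise every \<open>h \<in> H\<close> is reached along \<open>\<mu>\<close> and \<open>h\<mu>\<close>, and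
  the longer one of the two segments becomes \<open>\<alpha>\<close>, after replacing \<open>h\<close> by its inverse if need be.
\<close>

lemma robust_sequence_exists:
  assumes H: "H \<lhd> G" "infinite H" and \<gamma>: "\<And>n. stable D \<gamma> n" "\<gamma> 0 = \<one>"
  shows "\<exists>E. \<forall>j. \<exists>b \<alpha> s. b \<in> H \<and> meeting D E b \<alpha> s \<and> j \<le> s \<and> j \<le> d \<one> b"
proof -
  interpret H: normal H G by (rule H)
  have Hc: "H \<subseteq> carrier G" using H.subset .
  have \<gamma>c: "\<gamma> i \<in> carrier G" for i using \<gamma>(1)[of i] by (auto simp: stable_def geod_def)
  define conj where "conj T h = \<gamma> T \<otimes> h \<otimes> inv \<gamma> T" for T h
  have conjH: "conj T h \<in> H" if "h \<in> H" for T h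
    using H.inv_op_closed2[of "\<gamma> T" h] that \<gamma>c by (simp add: conj_def)
  have conj_mult: "inv \<gamma> T \<otimes> (conj T h \<otimes> x) = h \<otimes> (inv \<gamma> T \<otimes> x)" if "h \<in> H" "x \<in> carrier G" for T h x
  proof -
    have hc: "h \<in> carrier G" using that Hc by blast
    show ?thesis using \<gamma>c[of T] hc that(2)
      by (simp add: conj_def m_assoc) (simp add: m_assoc[symmetric])
  qed
  show ?thesis
  proof (cases "\<exists>h\<in>H. \<forall>T. \<forall>s\<le>T. \<forall>r\<le>T. D 0 < d (\<gamma> s) (conj T h \<otimes> \<gamma> r)")
    case True
    then obtain h where h: "h \<in> H" "\<And>T s r. s \<le> T \<Longrightarrow> r \<le> T \<Longrightarrow> D 0 < d (\<gamma> s) (conj T h \<otimes> \<gamma> r)" by blast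
    have hc: "h \<in> carrier G" using h Hc by blast
    have cc: "conj T h \<in> carrier G" for T using conjH[OF h(1)] Hc by blast
    have meet: "meeting D (d \<one> h) (conj T h) \<gamma> T" for T
    proof -
      have "stable D (\<lambda>i. conj T h \<otimes> \<gamma> i) T" using stable_translate[OF \<gamma>(1) cc] .
      moreover have "conj T h \<otimes> \<gamma> T = \<gamma> T \<otimes> h" using \<gamma>c[of T] hc by (simp add: conj_def m_assoc)
      moreover have "d (\<gamma> T) (\<gamma> T \<otimes> h) = d \<one> h" using d_translate[of "\<gamma> T" \<one> h] \<gamma>c[of T] hc by simp
      moreover have "\<not> d (\<gamma> s') (conj T h \<otimes> \<gamma> r') \<le> D 0" if "s' \<le> T" "r' \<le> T" for s' r'
        using h(2)[OF that] by simp
      ultimately show ?thesis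
        unfolding meeting_def using \<gamma> cc[of T]
        by (intro conjI exI[of _ "\<lambda>i. conj T h \<otimes> \<gamma> i"] exI[of _ T]) auto
    qed
    obtain K where K: "\<And>b \<alpha> s \<eta> n. meeting D (d \<one> h) b \<alpha> s \<and> geod \<eta> n \<and> d (\<eta> 0) \<one> \<le> 0 \<and> d (\<eta> n) b \<le> 0
        \<Longrightarrow> s \<le> n + K" using meeting_fellow_travel[of D "d \<one> h" 0] by blast
    have len: "T \<le> d \<one> (conj T h) + K" for T
    proof -
      obtain \<eta> where \<eta>: "geod \<eta> (d \<one> (conj T h))" "\<eta> 0 = \<one>" "\<eta> (d \<one> (conj T h)) = conj T h"
        using geod_between[OF one_closed cc] by blast
      show ?thesis using K[of "conj T h" \<gamma> T \<eta> "d \<one> (conj T h)"] \<eta> meet[of T] cc[of T] by simp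
    qed
    have "conj (j + K) h \<in> H \<and> meeting D (d \<one> h) (conj (j + K) h) \<gamma> (j + K)
        \<and> j \<le> j + K \<and> j \<le> d \<one> (conj (j + K) h)" for j
      using conjH[OF h(1)] meet len[of "j + K"] by simp
    then show ?thesis by blast
  next
    case False
    have "\<exists>b \<alpha> s. b \<in> H \<and> meeting D (D 0) b \<alpha> s \<and> j \<le> s \<and> j \<le> d \<one> b" for j
    proof -
      obtain h where h: "h \<in> H" "2 * j + D 0 \<le> d \<one> h" using far_element[OF H(2) Hc] by blast
      have hc: "h \<in> carrier G" using h Hc by blast
      obtain T s0 r0 where T: "s0 \<le> T" "r0 \<le> T" "d (\<gamma> s0) (conj T h \<otimes> \<gamma> r0) \<le> D 0"
        using False h(1) by (meson not_less)
      define \<mu> where "\<mu> i = inv \<gamma> T \<otimes> \<gamma> (T - i)" for i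
      have lc: "\<mu> i \<in> carrier G" for i using \<gamma>c by (simp add: \<mu>_def)
      have l0: "\<mu> 0 = \<one>" using \<gamma>c by (simp add: \<mu>_def)
      have stl: "stable D \<mu> s" if "s \<le> T" for s
        unfolding \<mu>_def using stable_prefix[OF stable_translate[OF stable_rev[OF \<gamma>(1)[of T]], of "inv \<gamma> T"] that] \<gamma>c[of T]
        by simp
      define P where "P = (\<lambda>(s, r). s \<le> T \<and> r \<le> T \<and> d (\<mu> s) (h \<otimes> \<mu> r) \<le> D 0)"
      have "P (T - s0, T - r0)"
      proof -
        have c: "conj T h \<in> carrier G" using conjH[OF h(1)] Hc by blast
        have "h \<otimes> \<mu> (T - r0) = inv \<gamma> T \<otimes> (conj T h \<otimes> \<gamma> r0)"
          using conj_mult[OF h(1) \<gamma>c[of r0], of T] T by (simp add: \<mu>_def)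
        then show ?thesis using T d_translate[of "inv \<gamma> T" "\<gamma> s0" "conj T h \<otimes> \<gamma> r0"] \<gamma>c c
          by (simp add: P_def \<mu>_def)
      qed
      then obtain sr where sr: "P sr" "\<And>y. P y \<Longrightarrow> fst sr + snd sr \<le> fst y + snd y"
        using ex_has_least_nat[of P _ "\<lambda>x. fst x + snd x"] by blast
      obtain s r where sr_eq: "sr = (s, r)" by (cases sr)
      have s: "s \<le> T" "r \<le> T" "d (\<mu> s) (h \<otimes> \<mu> r) \<le> D 0" using sr(1) by (auto simp: P_def sr_eq)
      have min: "s + r \<le> s' + r'" if "s' \<le> T" "r' \<le> T" "d (\<mu> s') (h \<otimes> \<mu> r') \<le> D 0" for s' r'
        using sr(2)[of "(s', r')"] that by (auto simp: P_def sr_eq)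
      have len: "d \<one> h \<le> s + D 0 + r"
      proof -
        have g: "geod \<mu> T" using stl[of T] by (simp add: stable_def)
        have "d \<one> (\<mu> s) = s" using geod_d[OF g, of 0 s] s l0 by simp
        moreover have "d (h \<otimes> \<mu> r) h = r"
          using geod_d[OF g, of 0 r] s l0 d_translate[of h "\<mu> r" \<one>] hc lc[of r] d_sym[of \<one> "\<mu> r"] by simp
        moreover have "d \<one> h \<le> d \<one> (\<mu> s) + d (\<mu> s) h" "d (\<mu> s) h \<le> d (\<mu> s) (h \<otimes> \<mu> r) + d (h \<otimes> \<mu> r) h"
          using d_tri lc hc by auto
        ultimately show ?thesis using s(3) by linarith
      qed
      show ?thesis
      proof (cases "j \<le> s")
        case True
        have "meeting D (D 0) h \<mu> s"
          unfolding meeting_def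
        proof (intro conjI exI[of _ "\<lambda>i. h \<otimes> \<mu> i"] exI[of _ r])
          show "stable D (\<lambda>i. h \<otimes> \<mu> i) r" using stable_translate[OF stl[OF s(2)] hc] .
          show "\<forall>s'\<le>s. \<forall>r'\<le>r. d (\<mu> s') (h \<otimes> \<mu> r') \<le> D 0 \<longrightarrow> s + r \<le> s' + r'"
            using min s by (meson le_trans)
        qed (use stl s l0 hc in auto)
        then show ?thesis using True h by (intro exI[of _ h] exI[of _ \<mu>] exI[of _ s]) simp
      next
        case False
        then have jr: "j \<le> r" using len h(2) by linarith
        have swap: "d (\<mu> r') (inv h \<otimes> \<mu> s') = d (\<mu> s') (h \<otimes> \<mu> r')" for r' s'
          using d_translate[of h "\<mu> r'" "inv h \<otimes> \<mu> s'"] hc lc d_sym[of "\<mu> s'" "h \<otimes> \<mu> r'"]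
          by (simp add: m_assoc[symmetric])
        have "meeting D (D 0) (inv h) \<mu> r"
          unfolding meeting_def
        proof (intro conjI exI[of _ "\<lambda>i. inv h \<otimes> \<mu> i"] exI[of _ s])
          show "stable D (\<lambda>i. inv h \<otimes> \<mu> i) s" using stable_translate[OF stl[OF s(1)]] hc by blast
          show "d (\<mu> r) (inv h \<otimes> \<mu> s) \<le> D 0" using swap s by simp
          show "\<forall>s'\<le>r. \<forall>r'\<le>s. d (\<mu> s') (inv h \<otimes> \<mu> r') \<le> D 0 \<longrightarrow> r + s \<le> s' + r'"
            using min s swap by (metis add.commute le_trans)
        qed (use stl s l0 hc in auto)
        then show ?thesis using jr h H.m_inv_closed d_one_inv[OF hc]
          by (intro exI[of _ "inv h"] exI[of _ \<mu>] exI[of _ r]) simp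
      qed
    qed
    then show ?thesis by blast
  qed
qed

text \<open>
  The approximating geodesics \<open>\<eta> j\<close> agree with \<open>\<rho>\<close> on longer and longer initial segments; nothing is
  required of their remaining parts.
\<close>

definition limit_ray :: "(nat \<Rightarrow> nat) \<Rightarrow> (nat \<Rightarrow> 'a) \<Rightarrow> (nat \<Rightarrow> 'a) \<Rightarrow> bool" where
  "limit_ray D h \<rho> \<longleftrightarrow> (\<forall>n. stable D \<rho> n) \<and> \<rho> 0 = \<one> \<and>
     (\<exists>\<eta> l. (\<forall>j. geod (\<eta> j) (l j) \<and> \<eta> j 0 = \<one> \<and> \<eta> j (l j) = h j) \<and>
        (\<forall>T. \<exists>J. \<forall>j\<ge>J. T \<le> l j \<and> (\<forall>i\<le>T. \<eta> j i = \<rho> i)))"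

text \<open>
  Translated by \<open>a\<close>, the geodesics that define \<open>\<sigma>\<close> run from \<open>a\<close> to \<open>b (r j) \<otimes> a\<close>, so both they and
  those defining \<open>\<rho>\<close> follow the same segment \<open>\<alpha> (r j)\<close>.
\<close>

lemma limit_rays_fellow_travel:
  assumes \<rho>: "limit_ray D h \<rho>" and \<sigma>: "limit_ray D h' \<sigma>"
    and r: "strict_mono (r :: nat \<Rightarrow> nat)" and a: "a \<in> carrier G"
    and h: "\<And>j. h j = b j" "\<And>j. h' j = inv a \<otimes> b (r j) \<otimes> a" and b: "\<And>j. b j \<in> carrier G"
    and fellow: "\<And>C. \<exists>K. \<forall>j \<eta> n. geod \<eta> n \<and> d (\<eta> 0) \<one> \<le> C \<and> d (\<eta> n) (b j) \<le> C \<longrightarrow>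
        (\<forall>i\<le>s j. i \<le> n \<longrightarrow> d (\<eta> i) (\<alpha> j i) \<le> K)"
    and \<alpha>: "\<And>j. geod (\<alpha> j) (s j)" and s: "\<And>j. j \<le> s j"
  shows "\<exists>K. \<forall>t. d (a \<otimes> \<sigma> t) (\<rho> t) \<le> K"
proof -
  obtain \<eta> l where \<eta>: "\<And>j. geod (\<eta> j) (l j)" "\<And>j. \<eta> j 0 = \<one>" "\<And>j. \<eta> j (l j) = b j"
    and \<eta>lim: "\<And>T. \<exists>J. \<forall>j\<ge>J. T \<le> l j \<and> (\<forall>i\<le>T. \<eta> j i = \<rho> i)"
    using \<rho> unfolding limit_ray_def h(1) by blast
  obtain \<theta> k where \<theta>: "\<And>j. geod (\<theta> j) (k j)" "\<And>j. \<theta> j 0 = \<one>" "\<And>j. \<theta> j (k j) = inv a \<otimes> b (r j) \<otimes> a"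
    and \<theta>lim: "\<And>T. \<exists>J. \<forall>j\<ge>J. T \<le> k j \<and> (\<forall>i\<le>T. \<theta> j i = \<sigma> i)"
    using \<sigma> unfolding limit_ray_def h(2) by blast
  obtain K where K: "\<And>j \<eta> n i. geod \<eta> n \<Longrightarrow> d (\<eta> 0) \<one> \<le> d a \<one> \<Longrightarrow> d (\<eta> n) (b j) \<le> d a \<one> \<Longrightarrow>
        i\<le>s j \<Longrightarrow> i \<le> n \<Longrightarrow> d (\<eta> i) (\<alpha> j i) \<le> K" using fellow by meson
  have "d (a \<otimes> \<sigma> t) (\<rho> t) \<le> 2 * K" for t
  proof -
    obtain J where J: "\<forall>j\<ge>J. t \<le> l j \<and> (\<forall>i\<le>t. \<eta> j i = \<rho> i)" using \<eta>lim by blast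
    obtain J' where J': "\<forall>j\<ge>J'. t \<le> k j \<and> (\<forall>i\<le>t. \<theta> j i = \<sigma> i)" using \<theta>lim by blast
    define j where "j = max t (max J J')"
    have rj: "j \<le> r j" using r by (rule strict_mono_imp_increasing)
    let ?m = "r j"
    have m: "t \<le> s ?m" using s[of ?m] rj by (simp add: j_def)
    have 1: "t \<le> l ?m" "\<eta> ?m t = \<rho> t" using J rj by (auto simp: j_def)
    have 2: "t \<le> k j" "\<theta> j t = \<sigma> t" using J' by (auto simp: j_def)
    have "d (\<eta> ?m t) (\<alpha> ?m t) \<le> K" using K[OF \<eta>(1)[of ?m]] \<eta>(2,3) b m 1(1) by simp
    moreover have "d (a \<otimes> \<theta> j t) (\<alpha> ?m t) \<le> K"
    proof (rule K[OF geod_translate[OF \<theta>(1)[of j] a]])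
      show "d (a \<otimes> \<theta> j 0) \<one> \<le> d a \<one>" using \<theta>(2) a by simp
      have "a \<otimes> \<theta> j (k j) = b ?m \<otimes> a" using \<theta>(3) a b by (simp add: m_assoc[symmetric])
      then show "d (a \<otimes> \<theta> j (k j)) (b ?m) \<le> d a \<one>" using d_translate[of "b ?m" a \<one>] a b by simp
    qed (use m 2 in auto)
    moreover have X: "\<alpha> ?m t \<in> carrier G" "\<rho> t \<in> carrier G" "a \<otimes> \<sigma> t \<in> carrier G"
      using \<alpha>[of ?m] m \<eta>(1)[of ?m] \<theta>(1)[of j] 1 2 a by (auto simp: geod_def)
    ultimately show ?thesis using 1(2) 2(2) d_tri[OF X(3,1,2)] d_sym[OF X(1,2)] by simp
  qed
  then show ?thesis by blast
qed

text \<open>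
  A first limit ray serves to find a robust sequence, and the limits along the conjugates of this
  sequence are the asymptotic rays that are needed.
\<close>

theorem four_point_of_limits:
  assumes H: "H \<lhd> G" "infinite H"
    and limits: "\<And>a b. a \<in> carrier G \<Longrightarrow> range b \<subseteq> H \<Longrightarrow> (\<forall>j. j \<le> d \<one> (b j)) \<Longrightarrow>
      \<exists>r \<rho>. strict_mono (r :: nat \<Rightarrow> nat) \<and> limit_ray D (\<lambda>j. inv a \<otimes> b (r j) \<otimes> a) \<rho>"
  shows four_point
proof -
  interpret H: normal H G by (rule H)
  have Hc: "H \<subseteq> carrier G" using H.subset .
  have "\<forall>j. \<exists>h. h \<in> H \<and> j \<le> d \<one> h"
  proof
    fix j
    obtain h where "h \<in> H" "j \<le> d \<one> h" by (rule far_element[OF H(2) Hc])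
    then show "\<exists>h. h \<in> H \<and> j \<le> d \<one> h" by blast
  qed
  from choice[OF this] obtain b1 where b1: "\<And>j. b1 j \<in> H" "\<And>j. j \<le> d \<one> (b1 j)" by blast
  have lim: "\<exists>r \<rho>. strict_mono (r :: nat \<Rightarrow> nat) \<and> limit_ray D (\<lambda>j. inv a \<otimes> b (r j) \<otimes> a) \<rho>"
    if "a \<in> carrier G" "\<And>j. b j \<in> H" "\<And>j. j \<le> d \<one> (b j)" for a b
    by (rule limits) (use that in auto)
  from lim[OF one_closed b1] obtain r1 \<gamma> where "limit_ray D (\<lambda>j. inv \<one> \<otimes> b1 (r1 j) \<otimes> \<one>) \<gamma>"
    by (elim exE conjE)
  then have \<gamma>: "\<And>n. stable D \<gamma> n" "\<gamma> 0 = \<one>" by (simp_all add: limit_ray_def)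
  obtain E where E: "\<forall>j. \<exists>b \<alpha> s. b \<in> H \<and> meeting D E b \<alpha> s \<and> j \<le> s \<and> j \<le> d \<one> b"
    using robust_sequence_exists[OF H \<gamma>] by blast
  from choice[OF E] obtain b0
    where "\<forall>j. \<exists>\<alpha> s. b0 j \<in> H \<and> meeting D E (b0 j) \<alpha> s \<and> j \<le> s \<and> j \<le> d \<one> (b0 j)" ..
  from choice[OF this] obtain \<alpha>0
    where "\<forall>j. \<exists>s. b0 j \<in> H \<and> meeting D E (b0 j) (\<alpha>0 j) s \<and> j \<le> s \<and> j \<le> d \<one> (b0 j)" ..
  from choice[OF this] obtain s0 where b0: "\<And>j. b0 j \<in> H" "\<And>j. meeting D E (b0 j) (\<alpha>0 j) (s0 j)"
    "\<And>j. j \<le> s0 j" "\<And>j. j \<le> d \<one> (b0 j)" by blast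
  obtain r0 \<rho>0 where r0: "strict_mono (r0 :: nat \<Rightarrow> nat)" "limit_ray D (\<lambda>j. inv \<one> \<otimes> b0 (r0 j) \<otimes> \<one>) \<rho>0"
    using lim[OF one_closed b0(1,4)] by (elim exE conjE)
  define b \<alpha> s where "b j = b0 (r0 j)" and "\<alpha> j = \<alpha>0 (r0 j)" and "s j = s0 (r0 j)" for j
  have r0j: "j \<le> r0 j" for j using r0(1) by (rule strict_mono_imp_increasing)
  have b: "\<And>j. b j \<in> H" "\<And>j. meeting D E (b j) (\<alpha> j) (s j)" "\<And>j. j \<le> s j" "\<And>j. j \<le> d \<one> (b j)"
    unfolding b_def \<alpha>_def s_def using b0(1,2) le_trans[OF r0j b0(3)] le_trans[OF r0j b0(4)] by blast+
  have bc: "b j \<in> carrier G" for j using b(1) Hc by blast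
  have "inv \<one> \<otimes> b0 (r0 j) \<otimes> \<one> = b j" for j using bc[of j] by (simp add: b_def)
  then have \<rho>0: "limit_ray D b \<rho>0" using r0(2) by simp
  have "\<forall>a\<in>carrier G. \<exists>r \<rho>. strict_mono (r :: nat \<Rightarrow> nat) \<and> limit_ray D (\<lambda>j. inv a \<otimes> b (r j) \<otimes> a) \<rho>"
    using lim[OF _ b(1,4)] by blast
  from bchoice[OF this] obtain r where "\<forall>a\<in>carrier G. \<exists>\<rho>. strict_mono (r a :: nat \<Rightarrow> nat) \<and>
    limit_ray D (\<lambda>j. inv a \<otimes> b (r a j) \<otimes> a) \<rho>" ..
  from bchoice[OF this] obtain \<rho> where \<rho>: "\<And>a. a \<in> carrier G \<Longrightarrow> strict_mono (r a :: nat \<Rightarrow> nat)"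
     "\<And>a. a \<in> carrier G \<Longrightarrow> limit_ray D (\<lambda>j. inv a \<otimes> b (r a j) \<otimes> a) (\<rho> a)" by blast
  have near: "\<exists>K. \<forall>t. d (a \<otimes> \<rho> a t) (\<rho>0 t) \<le> K" if a: "a \<in> carrier G" for a
  proof (rule limit_rays_fellow_travel[OF \<rho>0 \<rho>(2)[OF a] \<rho>(1)[OF a] a HOL.refl HOL.refl bc])
    show "\<exists>K. \<forall>j \<eta> n. geod \<eta> n \<and> d (\<eta> 0) \<one> \<le> C \<and> d (\<eta> n) (b j) \<le> C \<longrightarrow>
        (\<forall>i\<le>s j. i \<le> n \<longrightarrow> d (\<eta> i) (\<alpha> j i) \<le> K)" for C

    proof -
      obtain K where "\<forall>b \<alpha> s \<eta> n. meeting D E b \<alpha> s \<and> geod \<eta> n \<and> d (\<eta> 0) \<one> \<le> C \<and> d (\<eta> n) b \<le> C \<longrightarrow>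
        s \<le> n + K \<and> (\<forall>i\<le>s. i \<le> n \<longrightarrow> d (\<eta> i) (\<alpha> i) \<le> K)" using meeting_fellow_travel[of D E C] ..
      then show ?thesis using b(2) by blast
    qed
    show "geod (\<alpha> j) (s j)" for j using b(2)[of j] unfolding meeting_def stable_def by blast
  qed (use b in auto)
  show ?thesis
  proof (rule four_point_of_asymptotic_stable_rays[of \<one> D "\<lambda>a i. a \<otimes> \<rho> a i"])
    show "\<one> \<in> carrier G" by simp
    show "stable D (\<lambda>i. a \<otimes> \<rho> a i) n" if "a \<in> carrier G" for a n
      using stable_translate[OF _ that] \<rho>(2)[OF that] unfolding limit_ray_def by blast
    show "a \<otimes> \<rho> a 0 = a" if "a \<in> carrier G" for a
      using \<rho>(2)[OF that] that unfolding limit_ray_def by simp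
    fix a assume a: "a \<in> carrier G"
    obtain K where K: "\<And>t. d (a \<otimes> \<rho> a t) (\<rho>0 t) \<le> K" using near[OF a] by blast
    obtain K' where K': "\<And>t. d (\<one> \<otimes> \<rho> \<one> t) (\<rho>0 t) \<le> K'" using near[OF one_closed] by blast
    have X: "\<rho> x t \<in> carrier G" if "x \<in> carrier G" for x t
      using \<rho>(2)[OF that] unfolding limit_ray_def stable_def geod_def by blast
    have X0: "\<rho>0 t \<in> carrier G" for t using \<rho>0 unfolding limit_ray_def stable_def geod_def by blast
    have "d (a \<otimes> \<rho> a t) (\<one> \<otimes> \<rho> \<one> t) \<le> K + K'" for t
    proof -
      have "d (a \<otimes> \<rho> a t) (\<one> \<otimes> \<rho> \<one> t) \<le> d (a \<otimes> \<rho> a t) (\<rho>0 t) + d (\<rho>0 t) (\<one> \<otimes> \<rho> \<one> t)"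
        by (rule d_tri) (use X X0 a in auto)
      then show ?thesis using K[of t] K'[of t] d_sym[of "\<rho>0 t" "\<one> \<otimes> \<rho> \<one> t"] X X0 by simp
    qed
    then show "\<exists>K. \<forall>t. d (a \<otimes> \<rho> a t) (\<one> \<otimes> \<rho> \<one> t) \<le> K" by blast
  qed
qed

end

section \<open>Stability of quasi-geodesics in hyperbolic spaces\<close>

context discrete_geodesic_space
begin

definition slim :: "nat \<Rightarrow> bool" where
  "slim \<delta> \<longleftrightarrow> (\<forall>\<alpha> \<beta> \<gamma> l m n. geod \<alpha> l \<and> geod \<beta> m \<and> geod \<gamma> n \<and>
     \<alpha> l = \<beta> 0 \<and> \<beta> m = \<gamma> 0 \<and> \<gamma> n = \<alpha> 0 \<longrightarrow>
     (\<forall>i\<le>l. (\<exists>j\<le>m. d (\<alpha> i) (\<beta> j) \<le> \<delta>) \<or> (\<exists>j\<le>n. d (\<alpha> i) (\<gamma> j) \<le> \<delta>)))"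

text \<open>
  Unlike \<open>qg\<close>, this admits jumps and any multiplicative constant, so that it is preserved by
  quasi-isometries.
\<close>

definition coarse_qg :: "nat \<Rightarrow> (nat \<Rightarrow> 'a) \<Rightarrow> nat \<Rightarrow> bool" where
  "coarse_qg L p m \<longleftrightarrow> (\<forall>i\<le>m. p i \<in> X) \<and>
     (\<forall>i j. i \<le> j \<and> j \<le> m \<longrightarrow> d (p i) (p j) \<le> L * (j - i) + L \<and> j - i \<le> L * d (p i) (p j) + L)"

lemma slimD:
  assumes "slim \<delta>" "geod \<alpha> l" "geod \<beta> m" "geod \<gamma> n" "\<alpha> 0 = \<beta> 0" "\<beta> m = \<gamma> 0" "\<gamma> n = \<alpha> l" "i \<le> l"
  shows "(\<exists>j\<le>m. d (\<alpha> i) (\<beta> j) \<le> \<delta>) \<or> (\<exists>j\<le>n. d (\<alpha> i) (\<gamma> j) \<le> \<delta>)"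
proof -
  have r: "geod (\<lambda>i. \<beta> (m - i)) m" "geod (\<lambda>i. \<gamma> (n - i)) n" using geod_rev assms(3,4) by blast+
  have "(\<exists>j\<le>n. d (\<alpha> i) (\<gamma> (n - j)) \<le> \<delta>) \<or> (\<exists>j\<le>m. d (\<alpha> i) (\<beta> (m - j)) \<le> \<delta>)"
    using assms(1)[unfolded slim_def, rule_format, of \<alpha> l "\<lambda>i. \<gamma> (n - i)" n "\<lambda>i. \<beta> (m - i)" m i]
      assms(2,5-8) r by simp
  then show ?thesis using diff_le_self by blast
qed

text \<open>
  The logarithmic estimate behind the Morse lemma: halving the path \<open>N\<close> times, the geodesic
  is followed through \<open>N\<close> slim triangles.
\<close>

lemma geodesic_near_short_path:
  assumes sl: "slim \<delta>"
  shows "geod \<alpha> n \<Longrightarrow> \<alpha> 0 = p a \<Longrightarrow> \<alpha> n = p (a + m) \<Longrightarrow> m \<le> 2 ^ N \<Longrightarrow>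
    (\<And>i. i \<le> m \<Longrightarrow> p (a + i) \<in> X) \<Longrightarrow> (\<And>i. i < m \<Longrightarrow> d (p (a + i)) (p (a + Suc i)) \<le> S) \<Longrightarrow> i \<le> n \<Longrightarrow>
    \<exists>j\<le>m. d (\<alpha> i) (p (a + j)) \<le> \<delta> * N + S"
proof (induction N arbitrary: \<alpha> n a m i)
  case 0
  have X: "p a \<in> X" "p (a + m) \<in> X" using 0(5)[of 0] 0(5)[of m] by auto
  have "d (p a) (p (a + m)) \<le> S"
  proof (cases m)
    case 0 then show ?thesis using X by simp
  next
    case (Suc k) then show ?thesis using \<open>m \<le> 2 ^ 0\<close> 0(6)[of 0] by simp
  qed
  moreover have "d (p a) (p (a + m)) = n" "d (\<alpha> 0) (\<alpha> i) = i"
    using geod_d[OF 0(1), of 0 n] geod_d[OF 0(1), of 0 i] 0(2,3,7) by simp_all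
  moreover have "d (\<alpha> i) (p a) = d (\<alpha> 0) (\<alpha> i)" using d_sym X 0(1,2,7) by (simp add: geod_def)
  ultimately have "d (\<alpha> i) (p (a + 0)) \<le> \<delta> * 0 + S" using 0(7) by simp
  then show ?case by blast
next
  case (Suc N)
  define h where "h = m div 2"
  have h: "h \<le> 2 ^ N" "m - h \<le> 2 ^ N" "h \<le> m" using Suc(5) by (auto simp: h_def)
  have X: "p a \<in> X" "p (a + h) \<in> X" "p (a + m) \<in> X" using Suc(6)[of 0] Suc(6)[of h] Suc(6)[of m] h by auto
  obtain \<beta> k where \<beta>: "geod \<beta> k" "\<beta> 0 = p a" "\<beta> k = p (a + h)" using geod_between[OF X(1,2)] by blast
  obtain \<gamma> l where \<gamma>: "geod \<gamma> l" "\<gamma> 0 = p (a + h)" "\<gamma> l = p (a + m)" using geod_between[OF X(2,3)] by blast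
  have \<alpha>X: "\<alpha> i \<in> X" using Suc by (simp add: geod_def)
  have "(\<exists>j\<le>k. d (\<alpha> i) (\<beta> j) \<le> \<delta>) \<or> (\<exists>j\<le>l. d (\<alpha> i) (\<gamma> j) \<le> \<delta>)"
    by (rule slimD[OF sl Suc(2) \<beta>(1) \<gamma>(1)]) (use Suc \<beta> \<gamma> in simp_all)
  then show ?case
  proof (elim disjE exE conjE)
    fix j assume j: "j \<le> k" "d (\<alpha> i) (\<beta> j) \<le> \<delta>"
    obtain j' where j': "j' \<le> h" "d (\<beta> j) (p (a + j')) \<le> \<delta> * N + S"
      using Suc(1)[OF \<beta> h(1) Suc(6,7) j(1)] h(3) by auto
    have "d (\<alpha> i) (p (a + j')) \<le> d (\<alpha> i) (\<beta> j) + d (\<beta> j) (p (a + j'))"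
      using d_tri \<alpha>X Suc(6)[of j'] j j' \<beta>(1) h by (simp add: geod_def)
    then have "d (\<alpha> i) (p (a + j')) \<le> \<delta> * Suc N + S" using j j' by simp
    moreover have "j' \<le> m" using j' h by simp
    ultimately show ?thesis by blast
  next
    fix j assume j: "j \<le> l" "d (\<alpha> i) (\<gamma> j) \<le> \<delta>"
    have e: "\<gamma> l = p (a + h + (m - h))" using \<gamma> h by simp
    have pX: "p (a + h + i) \<in> X" if "i \<le> m - h" for i using Suc(6)[of "h + i"] that h by (simp add: add.assoc)
    have pS: "d (p (a + h + i)) (p (a + h + Suc i)) \<le> S" if "i < m - h" for i
      using Suc(7)[of "h + i"] that h by (simp add: add.assoc)
    obtain j' where j': "j' \<le> m - h" "d (\<gamma> j) (p (a + h + j')) \<le> \<delta> * N + S"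
      using Suc(1)[OF \<gamma>(1,2) e h(2) pX pS j(1)] by blast
    have "d (\<alpha> i) (p (a + h + j')) \<le> d (\<alpha> i) (\<gamma> j) + d (\<gamma> j) (p (a + h + j'))"
      using d_tri \<alpha>X pX[of j'] j j' \<gamma>(1) by (simp add: geod_def)
    then have "d (\<alpha> i) (p (a + (h + j'))) \<le> \<delta> * Suc N + S" using j j' by (simp add: add.assoc)
    moreover have "h + j' \<le> m" using j' h by simp
    ultimately show ?thesis by blast
  qed
qed

lemma geodesic_near_subpath:
  assumes sl: "slim \<delta>" and p: "coarse_qg L p m" and a: "a \<le> m" and b: "b \<le> m"
    and \<alpha>: "geod \<alpha> n" "\<alpha> 0 = p a" "\<alpha> n = p b" and N: "L * n + L \<le> 2 ^ N" and i: "i \<le> n"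
  shows "\<exists>j\<le>m. d (\<alpha> i) (p j) \<le> \<delta> * N + 2 * L"
proof -
  have pX: "\<And>i. i \<le> m \<Longrightarrow> p i \<in> X" using p by (simp add: coarse_qg_def)
  have S: "d (p i) (p (Suc i)) \<le> 2 * L" if "i < m" for i
    using p that unfolding coarse_qg_def by (metis Suc_leI add_diff_cancel_left' le_SucI mult.right_neutral mult_2 order_refl plus_1_eq_Suc add.commute)
  have main: "\<exists>j\<le>m. d (\<alpha> i) (p j) \<le> \<delta> * N + 2 * L"
    if hyp: "a \<le> b" "b \<le> m" "geod \<alpha> n" "\<alpha> 0 = p a" "\<alpha> n = p b" "i \<le> n" for a b \<alpha> i
  proof -
    have "b - a \<le> L * d (p a) (p b) + L" using p that unfolding coarse_qg_def by blast
    moreover have "d (p a) (p b) = n" using geod_d[OF hyp(3), of 0 n] hyp by simp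
    ultimately have "b - a \<le> 2 ^ N" using N by simp
    moreover have "p (a + i) \<in> X" if "i \<le> b - a" for i using pX that \<open>b \<le> m\<close> \<open>a \<le> b\<close> by simp
    moreover have "d (p (a + i)) (p (a + Suc i)) \<le> 2 * L" if "i < b - a" for i
      using S[of "a + i"] that \<open>b \<le> m\<close> by simp
    moreover have "\<alpha> n = p (a + (b - a))" using that by simp
    ultimately obtain j where "j \<le> b - a" "d (\<alpha> i) (p (a + j)) \<le> \<delta> * N + 2 * L"
      using geodesic_near_short_path[OF sl, of \<alpha> n p a "b - a" N "2 * L" i] hyp(3,4,6) by blast
    moreover have "a + j \<le> m" using calculation that by simp
    ultimately show ?thesis by blast
  qed
  show ?thesis
  proof (cases "a \<le> b")
    case True show ?thesis using main[OF True b \<alpha> i] .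
  next
    case False
    then have ba: "b \<le> a" by simp
    have "\<exists>j\<le>m. d (\<alpha> (n - (n - i))) (p j) \<le> \<delta> * N + 2 * L"
      using main[OF ba a geod_rev[OF \<alpha>(1)], of "n - i"] \<alpha>(2,3) by simp
    then show ?thesis using i by simp
  qed
qed

lemma exp_beats_linear: "\<exists>N0. \<forall>N\<ge>N0. a * N + b \<le> 2 ^ (N::nat)"
proof -
  have sq: "n * n \<le> 2 ^ n * 2" for n :: nat
  proof (induction n rule: less_induct)
    case (less n)
    show ?case
    proof (cases "n \<le> 3")
      case True
      then have "n = 0 \<or> n = 1 \<or> n = 2 \<or> n = 3" by linarith
      then show ?thesis by auto
    next
      case False
      then obtain k where k: "n = Suc k" "3 \<le> k" by (cases n) auto
      have "k * k \<le> 2 ^ k * 2" using less[of k] k by simp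
      moreover have "2 * k + 1 \<le> k * k" using mult_le_mono1[OF k(2), of k] k(2) by linarith
      ultimately show ?thesis unfolding k by simp
    qed
  qed
  have "a * N + b \<le> 2 ^ N" if "2 * a + 2 * b + 2 \<le> N" for N
  proof -
    have "(2 * a + 2 * b + 2) * N \<le> N * N" using mult_le_mono1[OF that] .
    also have "\<dots> \<le> 2 ^ N * 2" using sq .
    finally have "2 * (a * N) + 2 * (b * N) + 2 * N \<le> 2 ^ N * 2" by (simp add: algebra_simps)
    moreover have "b \<le> b * N" using that by simp
    ultimately show ?thesis by linarith
  qed
  then show ?thesis by blast
qed

text \<open>
  Let \<open>D\<close> be the largest distance of a point \<open>\<alpha> x\<close> from the path. Points of \<open>\<alpha>\<close> at distance \<open>2D\<close> on
  either side of \<open>\<alpha> x\<close> can be joined to the path by geodesics that stay \<open>D\<close>-far from \<open>\<alpha> x\<close>, and the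
  part of the path in between has length linear in \<open>D\<close>. So \<open>D\<close> is at most logarithmic in \<open>D\<close>.
\<close>

lemma geodesic_near_coarse_qg:
  assumes sl: "slim \<delta>"
  shows "\<exists>R. \<forall>p m \<alpha> n. coarse_qg L p m \<and> geod \<alpha> n \<and> \<alpha> 0 = p 0 \<and> \<alpha> n = p m \<longrightarrow>
    (\<forall>i\<le>n. \<exists>j\<le>m. d (\<alpha> i) (p j) \<le> R)"
proof -
  define \<epsilon> where "\<epsilon> = Suc \<delta>"
  obtain N0 where N0: "\<And>N. N \<ge> N0 \<Longrightarrow> (6 * L * \<epsilon>) * N + (6 * L * (\<epsilon> + 2 * \<delta> + 2 * L) + L) \<le> 2 ^ N"
    using exp_beats_linear by blast
  have "\<exists>j\<le>m. d (\<alpha> i0) (p j) \<le> \<epsilon> * N0 + 2 * \<delta> + 2 * L"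
    if p: "coarse_qg L p m" and \<alpha>: "geod \<alpha> n" "\<alpha> 0 = p 0" "\<alpha> n = p m" and i0: "i0 \<le> n" for p m \<alpha> n i0
  proof -
    have pX: "\<And>i. i \<le> m \<Longrightarrow> p i \<in> X" using p by (simp add: coarse_qg_def)
    have \<alpha>X: "\<And>i. i \<le> n \<Longrightarrow> \<alpha> i \<in> X" using \<alpha> by (simp add: geod_def)
    define r where "r i = Min ((\<lambda>j. d (\<alpha> i) (p j)) ` {..m})" for i
    have r_le: "r i \<le> d (\<alpha> i) (p j)" if "j \<le> m" for i j unfolding r_def using that by (intro Min_le) auto
    have r_ex: "\<exists>j\<le>m. d (\<alpha> i) (p j) = r i" for i
      using Min_in[of "(\<lambda>j. d (\<alpha> i) (p j)) ` {..m}"] unfolding r_def by fastforce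
    define D where "D = Max (r ` {..n})"
    have D_ge: "r i \<le> D" if "i \<le> n" for i unfolding D_def using that by (intro Max_ge) auto
    obtain x where x: "x \<le> n" "r x = D"
      using Max_in[of "r ` {..n}"] unfolding D_def by fastforce
    have "D \<le> \<epsilon> * N0 + 2 * \<delta> + 2 * L"
    proof (rule ccontr)
      assume "\<not> D \<le> \<epsilon> * N0 + 2 * \<delta> + 2 * L"
      then have big: "\<epsilon> * N0 + 2 * \<delta> + 2 * L < D" by simp
      \<comment> \<open>The scale \<open>N\<close> at which \<open>D\<close> lies just above the logarithmic estimate.\<close>
      obtain N where N: "N0 \<le> N" "\<epsilon> * N + 2 * \<delta> + 2 * L < D" "D \<le> \<epsilon> * Suc N + 2 * \<delta> + 2 * L"
      proof -
        define P where "P N \<longleftrightarrow> \<epsilon> * N + 2 * \<delta> + 2 * L < D" for N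
        have P0: "P N0" using big by (simp add: P_def)
        have bd: "y \<le> D" if "P y" for y using that unfolding P_def \<epsilon>_def by (auto simp: algebra_simps)
        have "P (Greatest P)" using GreatestI_nat[where P = P, OF P0 bd] .
        moreover have "N0 \<le> Greatest P" using Greatest_le_nat[where P = P, OF P0 bd] .
        moreover have "\<not> P (Suc (Greatest P))"
          using Greatest_le_nat[where P = P and k = "Suc (Greatest P)", OF _ bd] by auto
        ultimately show thesis using that[of "Greatest P"] unfolding P_def by simp
      qed
      have len: "L * (6 * D) + L \<le> 2 ^ N"
      proof -
        have "L * (6 * D) \<le> L * (6 * (\<epsilon> * Suc N + 2 * \<delta> + 2 * L))" using N(3) by (intro mult_le_mono) auto
        then show ?thesis using N0[OF N(1)] by (simp add: algebra_simps)
      qed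
      define y z where "y = x - 2 * D" and "z = min n (x + 2 * D)"
      have yz: "y \<le> x" "x \<le> z" "z \<le> n" "z - y \<le> 4 * D" using x by (auto simp: y_def z_def)
      obtain j1 where j1: "j1 \<le> m" "d (\<alpha> y) (p j1) = r y" using r_ex by blast
      obtain j2 where j2: "j2 \<le> m" "d (\<alpha> z) (p j2) = r z" using r_ex by blast
      have r0: "r 0 = 0" using r_le[of 0 0] \<alpha>(2) pX[of 0] by simp
      have rn: "r n = 0" using r_le[of m n] \<alpha>(3) pX[of m] by simp
      have XX: "\<alpha> x \<in> X" "\<alpha> y \<in> X" "\<alpha> z \<in> X" "p j1 \<in> X" "p j2 \<in> X" using \<alpha>X pX yz x j1 j2 by auto
      obtain u where u: "geod u (r y)" "u 0 = \<alpha> y" "u (r y) = p j1" using geod_between[OF XX(2,4)] j1 by metis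
      obtain w where w: "geod w (r z)" "w 0 = \<alpha> z" "w (r z) = p j2" using geod_between[OF XX(3,5)] j2 by metis
      define e where "e = d (p j1) (p j2)"
      obtain v where v: "geod v e" "v 0 = p j1" "v e = p j2" using geod_between[OF XX(4,5)] e_def by metis
      define f where "f = d (\<alpha> y) (p j2)"
      obtain t where t: "geod t f" "t 0 = \<alpha> y" "t f = p j2" using geod_between[OF XX(2,5)] f_def by metis
      let ?\<alpha> = "\<lambda>i. \<alpha> (y + i)"
      have a: "geod ?\<alpha> (z - y)" using geod_sub[OF \<alpha>(1), of y "z - y"] yz by simp
      have wr: "geod (\<lambda>i. w (r z - i)) (r z)" using geod_rev[OF w(1)] .
      have e6: "e \<le> 6 * D"
      proof -
        have "d (p j1) (p j2) \<le> d (p j1) (\<alpha> y) + d (\<alpha> y) (p j2)" "d (\<alpha> y) (p j2) \<le> d (\<alpha> y) (\<alpha> z) + d (\<alpha> z) (p j2)"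
          using d_tri XX by blast+
        moreover have "d (\<alpha> y) (\<alpha> z) = z - y" using geod_d[OF \<alpha>(1)] yz by simp
        ultimately show ?thesis using D_ge[of y] D_ge[of z] j1 j2 yz d_sym[OF XX(2,4)] by (simp add: e_def)
      qed
      \<comment> \<open>At an end of \<open>\<alpha>\<close> the distance to the path is \<open>0\<close> and \<open>u\<close> or \<open>w\<close> is constant; otherwise the
        end of \<open>\<alpha>\<close> was not reached, and \<open>\<alpha> y\<close> or \<open>\<alpha> z\<close> has distance exactly \<open>2D\<close> from \<open>\<alpha> x\<close>.\<close>
      have far_u: "D \<le> d (\<alpha> x) (u i)" if i: "i \<le> r y" for i
      proof (cases "y = 0")
        case True
        then have "u i = p 0" using i r0 u \<alpha> by simp
        then show ?thesis using r_le[of 0 x] x by simp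
      next
        case False
        have uX: "u i \<in> X" using u i by (simp add: geod_def)
        have "d (\<alpha> x) (\<alpha> y) \<le> d (\<alpha> x) (u i) + d (u i) (\<alpha> y)" using d_tri XX uX by blast
        moreover have "d (\<alpha> x) (\<alpha> y) = 2 * D" using geod_d'[OF \<alpha>(1), of x y] False x yz by (simp add: y_def)
        moreover have "d (u i) (\<alpha> y) = i" using geod_d[OF u(1), of 0 i] i u d_sym[OF XX(2) uX] by simp
        ultimately show ?thesis using i D_ge[of y] yz by simp
      qed
      have far_w: "D \<le> d (\<alpha> x) (w i)" if i: "i \<le> r z" for i
      proof (cases "n < x + 2 * D")
        case True
        then have "w i = p m" using i rn w \<alpha> by (simp add: z_def min_def split: if_splits)
        then show ?thesis using r_le[of m x] x by simp
      next
        case False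
        have uX: "w i \<in> X" using w i by (simp add: geod_def)
        have "d (\<alpha> x) (\<alpha> z) \<le> d (\<alpha> x) (w i) + d (w i) (\<alpha> z)" using d_tri XX uX by blast
        moreover have "d (\<alpha> x) (\<alpha> z) = 2 * D" using geod_d[OF \<alpha>(1), of x z] False x yz by (simp add: z_def)
        moreover have "d (w i) (\<alpha> z) = i" using geod_d[OF w(1), of 0 i] i w d_sym[OF XX(3) uX] by simp
        ultimately show ?thesis using i D_ge[of z] yz by simp
      qed
      have big2: "2 * \<delta> < D" using N(2) by simp
      have "(\<exists>j\<le>f. d (?\<alpha> (x - y)) (t j) \<le> \<delta>) \<or> (\<exists>j\<le>r z. d (?\<alpha> (x - y)) (w (r z - j)) \<le> \<delta>)"
        by (rule slimD[OF sl a t(1) wr]) (use t w yz in auto)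
      moreover have "\<not> d (\<alpha> x) (w (r z - j)) \<le> \<delta>" for j using far_w[of "r z - j"] big2 by simp
      ultimately obtain j where j: "j \<le> f" "d (\<alpha> x) (t j) \<le> \<delta>" using yz by auto
      have tX: "t j \<in> X" using t j by (simp add: geod_def)
      have "(\<exists>i\<le>r y. d (t j) (u i) \<le> \<delta>) \<or> (\<exists>i\<le>e. d (t j) (v i) \<le> \<delta>)"
        by (rule slimD[OF sl t(1) u(1) v(1)]) (use t u v j in auto)
      moreover have "\<not> d (t j) (u i) \<le> \<delta>" if "i \<le> r y" for i
      proof -
        have "u i \<in> X" using u that by (simp add: geod_def)
        then show ?thesis using far_u[OF that] d_tri[OF XX(1) tX, of "u i"] j big2 by simp
      qed
      ultimately obtain i where i: "i \<le> e" "d (t j) (v i) \<le> \<delta>" by blast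
      have vX: "v i \<in> X" using v i by (simp add: geod_def)
      have "L * e \<le> L * (6 * D)" using e6 by simp
      then have "L * e + L \<le> 2 ^ N" using len by linarith
      then obtain k where k: "k \<le> m" "d (v i) (p k) \<le> \<delta> * N + 2 * L"
        using geodesic_near_subpath[OF sl p j1(1) j2(1) v _ i(1)] by blast
      have "d (\<alpha> x) (p k) \<le> d (\<alpha> x) (t j) + d (t j) (p k)" "d (t j) (p k) \<le> d (t j) (v i) + d (v i) (p k)"
        using d_tri XX tX vX pX[OF k(1)] by blast+
      then have "D \<le> \<delta> * N + 2 * \<delta> + 2 * L" using r_le[OF k(1), of x] x i j k by simp
      then show False using N(2) by (simp add: \<epsilon>_def)
    qed
    then show ?thesis using r_ex[of i0] D_ge[OF i0] by fastforce
  qed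
  then show ?thesis by blast
qed

text \<open>
  Each point of the geodesic is near the path before index \<open>i\<close> or near the path after it. At the last
  point of the first kind both happen, so the path returns there, and the excursion containing
  \<open>i\<close> is short.
\<close>

lemma coarse_qg_near_geodesic:
  assumes sl: "slim \<delta>"
  shows "\<exists>R. \<forall>p m \<alpha> n. coarse_qg L p m \<and> geod \<alpha> n \<and> \<alpha> 0 = p 0 \<and> \<alpha> n = p m \<longrightarrow>
    (\<forall>i\<le>m. \<exists>j\<le>n. d (p i) (\<alpha> j) \<le> R)"
proof -
  obtain R where R: "\<And>p m \<alpha> n i. coarse_qg L p m \<Longrightarrow> geod \<alpha> n \<Longrightarrow> \<alpha> 0 = p 0 \<Longrightarrow> \<alpha> n = p m \<Longrightarrow>
    i\<le>n \<Longrightarrow> \<exists>j\<le>m. d (\<alpha> i) (p j) \<le> R" using geodesic_near_coarse_qg[OF sl] by metis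
  define R' where "R' = L * (L * (2 * R + 1) + L) + L + R"
  have "\<exists>j\<le>n. d (p i) (\<alpha> j) \<le> R'"
    if p: "coarse_qg L p m" and \<alpha>: "geod \<alpha> n" "\<alpha> 0 = p 0" "\<alpha> n = p m" and i: "i \<le> m" for p m \<alpha> n i
  proof -
    have pX: "\<And>i. i \<le> m \<Longrightarrow> p i \<in> X" using p by (simp add: coarse_qg_def)
    have \<alpha>X: "\<And>i. i \<le> n \<Longrightarrow> \<alpha> i \<in> X" using \<alpha> by (simp add: geod_def)
    define P where "P l \<longleftrightarrow> l \<le> n \<and> (\<exists>j\<le>i. d (\<alpha> l) (p j) \<le> R)" for l
    have "P 0" unfolding P_def using \<alpha>(2) pX[of 0] by (metis d_self le0)
    define l where "l = Greatest P"
    have bd: "y \<le> n" if "P y" for y using that by (simp add: P_def)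
    have Pl: "P l" unfolding l_def using GreatestI_nat[where P = P, OF \<open>P 0\<close> bd] .
    then obtain j where j: "j \<le> i" "d (\<alpha> l) (p j) \<le> R" and ln: "l \<le> n" by (auto simp: P_def)
    have nP: "\<not> P (Suc l)"
      using Greatest_le_nat[where P = P and k = "Suc l", OF _ bd] by (auto simp: l_def)
    have "\<exists>j'. i \<le> j' \<and> j' \<le> m \<and> d (p j) (p j') \<le> 2 * R + 1"
    proof (cases "l = n")
      case True
      then show ?thesis using j i d_sym[of "\<alpha> l" "p j"] pX \<alpha>X ln \<alpha>(3) by (intro exI[of _ m]) auto
    next
      case False
      then have Sl: "Suc l \<le> n" using ln by simp
      obtain j' where j': "j' \<le> m" "d (\<alpha> (Suc l)) (p j') \<le> R" using R[OF p \<alpha> Sl] by blast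
      then have "i \<le> j'" using nP Sl unfolding P_def by (metis nat_le_linear)
      have X: "p j \<in> X" "p j' \<in> X" "\<alpha> l \<in> X" "\<alpha> (Suc l) \<in> X" using pX \<alpha>X j i j' Sl by auto
      have "d (p j) (p j') \<le> d (p j) (\<alpha> l) + d (\<alpha> l) (p j')" "d (\<alpha> l) (p j') \<le> d (\<alpha> l) (\<alpha> (Suc l)) + d (\<alpha> (Suc l)) (p j')"
        using d_tri X by blast+
      moreover have "d (\<alpha> l) (\<alpha> (Suc l)) = 1" using geod_d[OF \<alpha>(1), of l "Suc l"] Sl by simp
      ultimately have "d (p j) (p j') \<le> 2 * R + 1" using j(2) j'(2) d_sym[OF X(1,3)] by linarith
      then show ?thesis using \<open>i \<le> j'\<close> j' by blast
    qed
    then obtain j' where j': "i \<le> j'" "j' \<le> m" "d (p j) (p j') \<le> 2 * R + 1" by blast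
    have "j' - j \<le> L * d (p j) (p j') + L" using p j j' i unfolding coarse_qg_def by (meson le_trans)
    also have "\<dots> \<le> L * (2 * R + 1) + L" using mult_le_mono2[OF j'(3), of L] by linarith
    finally have "i - j \<le> L * (2 * R + 1) + L" using j' by simp
    then have "L * (i - j) \<le> L * (L * (2 * R + 1) + L)" by (rule mult_le_mono2)
    moreover have "d (p j) (p i) \<le> L * (i - j) + L" using p j i unfolding coarse_qg_def by blast
    moreover have "d (p i) (\<alpha> l) \<le> d (p i) (p j) + d (p j) (\<alpha> l)" using d_tri pX \<alpha>X ln j i by auto
    moreover have "d (p i) (p j) = d (p j) (p i)" "d (p j) (\<alpha> l) = d (\<alpha> l) (p j)" using d_sym pX \<alpha>X ln j i by auto
    ultimately have "d (p i) (\<alpha> l) \<le> R'" using j unfolding R'_def by linarith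
    then show ?thesis using ln by blast
  qed
  then show ?thesis by blast
qed

theorem coarse_qg_stability:
  assumes sl: "slim \<delta>"
  shows "\<exists>R. \<forall>p m q n. coarse_qg L p m \<and> coarse_qg L q n \<and> p 0 = q 0 \<and> p m = q n \<longrightarrow>
    (\<forall>i\<le>m. \<exists>j\<le>n. d (p i) (q j) \<le> R)"
proof -
  obtain R where R: "\<And>p m \<alpha> n i. coarse_qg L p m \<Longrightarrow> geod \<alpha> n \<Longrightarrow> \<alpha> 0 = p 0 \<Longrightarrow> \<alpha> n = p m \<Longrightarrow>
    i\<le>n \<Longrightarrow> \<exists>j\<le>m. d (\<alpha> i) (p j) \<le> R" using geodesic_near_coarse_qg[OF sl] by metis
  obtain R' where R': "\<And>p m \<alpha> n i. coarse_qg L p m \<Longrightarrow> geod \<alpha> n \<Longrightarrow> \<alpha> 0 = p 0 \<Longrightarrow> \<alpha> n = p m \<Longrightarrow>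
    i\<le>m \<Longrightarrow> \<exists>j\<le>n. d (p i) (\<alpha> j) \<le> R'" using coarse_qg_near_geodesic[OF sl] by metis
  have "\<exists>j\<le>n. d (p i) (q j) \<le> R' + R"
    if p: "coarse_qg L p m" and q: "coarse_qg L q n" and e: "p 0 = q 0" "p m = q n" and i: "i \<le> m" for p m q n i
  proof -
    have X: "p 0 \<in> X" "p m \<in> X" "p i \<in> X" using p i by (auto simp: coarse_qg_def)
    obtain \<alpha> l where \<alpha>: "geod \<alpha> l" "\<alpha> 0 = p 0" "\<alpha> l = p m" using geod_between[OF X(1,2)] by blast
    obtain k where k: "k \<le> l" "d (p i) (\<alpha> k) \<le> R'" using R'[OF p \<alpha> i] by blast
    obtain j where j: "j \<le> n" "d (\<alpha> k) (q j) \<le> R" using R[OF q \<alpha>(1)] \<alpha>(2,3) e k by metis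
    have "\<alpha> k \<in> X" "q j \<in> X" using \<alpha>(1) q j k by (auto simp: geod_def coarse_qg_def)
    then have "d (p i) (q j) \<le> R' + R" using d_tri[of "p i" "\<alpha> k" "q j"] X j k by linarith
    then show ?thesis using j by blast
  qed
  then show ?thesis by blast
qed

end

section \<open>Cayley graphs and word metrics\<close>

text \<open>
  Loops, which are edges in the sense of \<open>cayley_edge\<close> if \<open>\<one> \<in> A\<close>, do not affect shortest paths.
\<close>

definition word_dist :: "('a, 'b) monoid_scheme \<Rightarrow> 'a set \<Rightarrow> 'a \<Rightarrow> 'a \<Rightarrow> nat" where
  "word_dist G A x y = (LEAST n. (x, y) \<in> {(x, y). cayley_edge G A x y} ^^ n)"

lemma vertex_eq_iff [simp]: "vertex g = vertex h \<longleftrightarrow> g = h"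
  by (auto simp: vertex_def fun_eq_iff split: if_splits)

lemma edge_point_same [simp]: "edge_point g g t = vertex g"
  by (auto simp: edge_point_def vertex_def fun_eq_iff)

lemma edge_point_swap: "edge_point h g (1 - t) = edge_point g h t"
  by (auto simp: edge_point_def fun_eq_iff)

lemma geodesic_d:
  assumes "geodesic X d I \<gamma>" "s \<in> I" "t \<in> I"
  shows "d (\<gamma> s) (\<gamma> t) = \<bar>s - t\<bar>"
proof -
  have "1 / 1 * \<bar>s - t\<bar> - 0 \<le> d (\<gamma> s) (\<gamma> t) \<and> d (\<gamma> s) (\<gamma> t) \<le> 1 * \<bar>s - t\<bar> + 0"
    using assms unfolding quasi_geodesic_def by blast
  then show ?thesis by simp
qed

locale cayley = group G for G (structure) +
  fixes A
  assumes gen: "finite_symmetric_generating_set G A"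
begin

abbreviation "wd \<equiv> word_dist G A"
abbreviation "E \<equiv> {(x, y). cayley_edge G A x y}"
abbreviation "cg \<equiv> cayley_graph G A"
abbreviation "cd \<equiv> cayley_dist G A"

lemma A_props: "A \<subseteq> carrier G" "\<And>a. a \<in> A \<Longrightarrow> inv a \<in> A" "generate G A = carrier G" "finite A"
  using gen by (auto simp: finite_symmetric_generating_set_def)

lemma edge_in: "cayley_edge G A x y \<Longrightarrow> x \<in> carrier G \<and> y \<in> carrier G"
  by (simp add: cayley_edge_def)

lemma edge_sym: "cayley_edge G A x y \<Longrightarrow> cayley_edge G A y x"
  using A_props(2)[of "inv x \<otimes> y"] by (auto simp: cayley_edge_def inv_mult_group)

lemma edge_translate: "cayley_edge G A x y \<Longrightarrow> g \<in> carrier G \<Longrightarrow> cayley_edge G A (g \<otimes> x) (g \<otimes> y)"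
  by (auto simp: cayley_edge_def inv_mult_group m_assoc) (simp add: m_assoc[symmetric])

lemma edge_mult: "x \<in> carrier G \<Longrightarrow> a \<in> A \<Longrightarrow> cayley_edge G A x (x \<otimes> a)"
  using A_props(1) by (auto simp: cayley_edge_def m_assoc[symmetric])

lemma relpow_sym: "(x, y) \<in> E ^^ n \<Longrightarrow> (y, x) \<in> E ^^ n"
proof (induction n arbitrary: y)
  case (Suc n)
  obtain z where z: "(x, z) \<in> E ^^ n" "(z, y) \<in> E" using Suc.prems(1) by (rule relpow_Suc_E)
  have "(y, z) \<in> E" using z(2) edge_sym[of z y] by simp
  then show ?case using Suc.IH[OF z(1)] by (rule relpow_Suc_I2)
qed auto

lemma relpow_translate: "(x, y) \<in> E ^^ n \<Longrightarrow> g \<in> carrier G \<Longrightarrow> (g \<otimes> x, g \<otimes> y) \<in> E ^^ n"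
proof (induction n arbitrary: y)
  case (Suc n)
  obtain z where z: "(x, z) \<in> E ^^ n" "(z, y) \<in> E" using Suc.prems(1) by (rule relpow_Suc_E)
  have "(g \<otimes> x, g \<otimes> z) \<in> E ^^ n" using Suc.IH[OF z(1)] Suc.prems(2) .
  moreover have "(g \<otimes> z, g \<otimes> y) \<in> E" using z(2) edge_translate[of z y g] Suc.prems(2) by simp
  ultimately show ?case by (rule relpow_Suc_I)
qed auto

lemma reachable:
  assumes "x \<in> carrier G" "y \<in> carrier G"
  shows "\<exists>n. (x, y) \<in> E ^^ n"
proof -
  have "\<exists>n. (x, x \<otimes> g) \<in> E ^^ n" if "g \<in> generate G A" "x \<in> carrier G" for g x
    using that
  proof (induction arbitrary: x rule: generate.induct)
    case one
    then show ?case by (intro exI[of _ 0]) simp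
  next
    case (incl h)
    then show ?case using edge_mult[of x h] by (intro exI[of _ 1]) auto
  next
    case (inv h)
    then show ?case using edge_mult[of x "inv h"] A_props(2) by (intro exI[of _ 1]) auto
  next
    case (eng h1 h2)
    have c: "h1 \<in> carrier G" "h2 \<in> carrier G" using eng.hyps A_props(3) by auto
    obtain n where "(x, x \<otimes> h1) \<in> E ^^ n" using eng by blast
    moreover obtain m where "(x \<otimes> h1, x \<otimes> h1 \<otimes> h2) \<in> E ^^ m" using eng c by blast
    ultimately have "(x, x \<otimes> h1 \<otimes> h2) \<in> E ^^ (n + m)" by (auto simp: relpow_add)
    then show ?case using eng.prems c by (auto simp: m_assoc)
  qed
  from this[of "inv x \<otimes> y" x] show ?thesis
    using assms A_props(3) by (simp add: m_assoc[symmetric])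
qed

lemma wd_relpow: "x \<in> carrier G \<Longrightarrow> y \<in> carrier G \<Longrightarrow> (x, y) \<in> E ^^ wd x y"
  unfolding word_dist_def by (rule LeastI_ex) (rule reachable)

lemma wd_le: "(x, y) \<in> E ^^ n \<Longrightarrow> wd x y \<le> n"
  unfolding word_dist_def by (rule Least_le)

lemma wd_edge_le: "cayley_edge G A x y \<Longrightarrow> wd x y \<le> 1"
  by (rule wd_le) simp

lemma wd_1_edge: "x \<in> carrier G \<Longrightarrow> y \<in> carrier G \<Longrightarrow> wd x y = 1 \<Longrightarrow> cayley_edge G A x y"
  using wd_relpow[of x y] by simp

lemma wd_tri: "x \<in> carrier G \<Longrightarrow> y \<in> carrier G \<Longrightarrow> z \<in> carrier G \<Longrightarrow> wd x z \<le> wd x y + wd y z"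
  using wd_relpow[of x y] wd_relpow[of y z] by (auto intro!: wd_le simp: relpow_add)

lemma wd_sym: "x \<in> carrier G \<Longrightarrow> y \<in> carrier G \<Longrightarrow> wd x y = wd y x"
  using wd_le[OF relpow_sym[OF wd_relpow[of x y]]] wd_le[OF relpow_sym[OF wd_relpow[of y x]]] by simp

lemma finite_sphere: "finite {y. (\<one>, y) \<in> E ^^ n}"
proof (induction n)
  case (Suc n)
  have "{y. (\<one>, y) \<in> E ^^ Suc n} \<subseteq> (\<lambda>(z, a). z \<otimes> a) ` ({y. (\<one>, y) \<in> E ^^ n} \<times> A)"
  proof
    fix y assume "y \<in> {y. (\<one>, y) \<in> E ^^ Suc n}"
    then obtain z where z: "(\<one>, z) \<in> E ^^ n" "cayley_edge G A z y" by auto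
    then have "y = z \<otimes> (inv z \<otimes> y)" by (auto simp: cayley_edge_def m_assoc[symmetric])
    then show "y \<in> (\<lambda>(z, a). z \<otimes> a) ` ({y. (\<one>, y) \<in> E ^^ n} \<times> A)"
      using z by (auto simp: cayley_edge_def intro!: image_eqI[of _ _ "(z, inv z \<otimes> y)"])
  qed
  then show ?case using Suc A_props(4) by (meson finite_SigmaI finite_imageI finite_subset)
qed simp

sublocale discrete_geodesic_group G wd
proof unfold_locales
  show "wd x y = 0 \<longleftrightarrow> x = y" if "x \<in> carrier G" "y \<in> carrier G" for x y
    using wd_relpow[OF that] wd_le[of x x 0] by auto
  show "wd x y = wd y x" if "x \<in> carrier G" "y \<in> carrier G" for x y
    using wd_sym that .
  show "wd x z \<le> wd x y + wd y z" if "x \<in> carrier G" "y \<in> carrier G" "z \<in> carrier G" for x y z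
    using wd_tri that .
  show "wd (g \<otimes> x) (g \<otimes> y) = wd x y" if "g \<in> carrier G" "x \<in> carrier G" "y \<in> carrier G" for g x y
  proof (rule antisym)
    show "wd (g \<otimes> x) (g \<otimes> y) \<le> wd x y" using relpow_translate wd_relpow that by (intro wd_le) blast
    have "(inv g \<otimes> (g \<otimes> x), inv g \<otimes> (g \<otimes> y)) \<in> E ^^ wd (g \<otimes> x) (g \<otimes> y)"
      using that by (intro relpow_translate wd_relpow) auto
    then show "wd x y \<le> wd (g \<otimes> x) (g \<otimes> y)" using that by (intro wd_le) (simp add: m_assoc[symmetric])
  qed
  show "finite {x \<in> carrier G. wd \<one> x \<le> n}" for n
  proof (rule finite_subset)
    show "{x \<in> carrier G. wd \<one> x \<le> n} \<subseteq> (\<Union>k\<le>n. {y. (\<one>, y) \<in> E ^^ k})" using wd_relpow by auto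
    show "finite (\<Union>k\<le>n. {y. (\<one>, y) \<in> E ^^ k})" using finite_sphere by auto
  qed
  fix x y assume xy: "x \<in> carrier G" "y \<in> carrier G"
  obtain f where f: "f 0 = x" "f (wd x y) = y" "\<And>i. i < wd x y \<Longrightarrow> (f i, f (Suc i)) \<in> E"
    using wd_relpow[OF xy] unfolding relpow_fun_conv by blast
  have c: "f i \<in> carrier G" if "i \<le> wd x y" for i
  proof (cases i)
    case 0 then show ?thesis using f(1) xy by simp
  next
    case (Suc k) then show ?thesis using f(3)[of k] that edge_in[of "f k" "f (Suc k)"] by simp
  qed
  have le: "wd (f i) (f (i + k)) \<le> k" if "i + k \<le> wd x y" for i k
    using that
  proof (induction k)
    case 0 then show ?case using c[of i] by (intro wd_le) simp
  next
    case (Suc k)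
    have "wd (f (i + k)) (f (i + Suc k)) \<le> 1" using f(3)[of "i + k"] Suc by (intro wd_edge_le) auto
    then show ?case using wd_tri[OF c c c, of i "i + k" "i + Suc k"] Suc by simp
  qed
  have dd: "wd (f i) (f j) = j - i" if ij: "i \<le> j" "j \<le> wd x y" for i j
  proof -
    have "wd (f 0) (f i) \<le> i" "wd (f i) (f j) \<le> j - i" "wd (f j) (f (wd x y)) \<le> wd x y - j"
      using le[of 0 i] le[of i "j - i"] le[of j "wd x y - j"] ij by auto
    moreover have "wd x y \<le> wd (f 0) (f i) + wd (f i) (f (wd x y))"
      using wd_tri[OF c c c, of 0 i "wd x y"] ij f by simp
    moreover have "wd (f i) (f (wd x y)) \<le> wd (f i) (f j) + wd (f j) (f (wd x y))"
      using wd_tri[OF c c c, of i j "wd x y"] ij by simp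
    ultimately show ?thesis using ij by linarith
  qed
  show "\<exists>p. (\<forall>i\<le>wd x y. p i \<in> carrier G) \<and> p 0 = x \<and> p (wd x y) = y \<and>
        (\<forall>i j. i \<le> j \<and> j \<le> wd x y \<longrightarrow> wd (p i) (p j) = j - i)"
  proof (intro exI[of _ f] conjI allI impI)
    show "f i \<in> carrier G" if "i \<le> wd x y" for i using c[OF that] .
    show "wd (f i) (f j) = j - i" if "i \<le> j \<and> j \<le> wd x y" for i j using dd that by simp
  qed (rule f(1), rule f(2))
qed

sublocale M: Metric_space cg cd
  by (rule Metric_space_cayley_graph) (use gen is_group in auto)

lemma vertex_in [simp]: "g \<in> carrier G \<Longrightarrow> vertex g \<in> cg"
  by (auto simp: cayley_graph_def)

lemma chain_dist_le: "cayley_chain G A p q l \<Longrightarrow> cd p q \<le> l"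
  using cayley_chain_in[of G A p q l]
  by (auto simp: cayley_dist_def intro!: cInf_lower bdd_belowI[of _ 0] dest: cayley_chain_in)

lemma relpow_chain: "(x, y) \<in> E ^^ n \<Longrightarrow> x \<in> carrier G \<Longrightarrow> cayley_chain G A (vertex x) (vertex y) (real n)"
proof (induction n arbitrary: y)
  case 0
  then show ?case using cayley_chain.refl[of "vertex x" G A] by simp
next
  case (Suc n)
  then obtain z where z: "(x, z) \<in> E ^^ n" "cayley_edge G A z y" by auto
  then show ?case using cayley_chain.step[of G A "vertex x" z y 0 n 1] Suc by (simp add: add.commute)
qed

text \<open>
  The weight \<open>1 - q g\<close> is the distance of \<open>q\<close> from an end \<open>g\<close> of its edge. In terms of barycentric
  coordinates the expression does not depend on the choice of an edge through \<open>q\<close>.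
\<close>

definition from_vertex :: "'a \<Rightarrow> ('a \<Rightarrow> real) \<Rightarrow> real" where
  "from_vertex x q = Min ((\<lambda>g. real (wd x g) + (1 - q g)) ` {g. 0 < q g})"

lemma from_vertex_vertex [simp]: "from_vertex x (vertex g) = wd x g"
proof -
  have "{h. 0 < vertex g h} = {g}" by (auto simp: vertex_def split: if_splits)
  then show ?thesis by (simp add: from_vertex_def vertex_def)
qed

lemma wd_edge_diff:
  assumes "cayley_edge G A g h" "x \<in> carrier G"
  shows "wd x g \<le> wd x h + 1" "wd x h \<le> wd x g + 1"
  using wd_tri[of x g h] wd_tri[of x h g] wd_edge_le[OF assms(1)] wd_edge_le[OF edge_sym[OF assms(1)]]
    edge_in[OF assms(1)] assms(2) by linarith+

lemma from_vertex_edge: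
  assumes e: "cayley_edge G A g h" "g \<noteq> h" and t: "t \<in> {0..1}" and x: "x \<in> carrier G"
  shows "from_vertex x (edge_point g h t) = min (real (wd x g) + t) (real (wd x h) + 1 - t)"
proof -
  consider "t = 0" | "t = 1" | "0 < t" "t < 1" using t by fastforce
  then show ?thesis
  proof cases
    case 1 then show ?thesis using wd_edge_diff[OF e(1) x] by simp
  next
    case 2 then show ?thesis using wd_edge_diff[OF e(1) x] by simp
  next
    case 3
    have v: "edge_point g h t g = 1 - t" "edge_point g h t h = t"
      "\<And>k. k \<noteq> g \<Longrightarrow> k \<noteq> h \<Longrightarrow> edge_point g h t k = 0"
      using e(2) by (auto simp: edge_point_def vertex_def)
    have "{k. 0 < edge_point g h t k} = {g, h}"
    proof (rule equalityI; rule subsetI)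
      fix k assume "k \<in> {k. 0 < edge_point g h t k}"
      then show "k \<in> {g, h}" using v(3)[of k] by fastforce
    qed (use 3 v in auto)
    then show ?thesis using v by (simp add: from_vertex_def algebra_simps)
  qed
qed

lemma chain_from_vertex:
  "cayley_chain G A p q l \<Longrightarrow> p = vertex x \<Longrightarrow> x \<in> carrier G \<Longrightarrow> from_vertex x q \<le> l"
proof (induction rule: cayley_chain.induct)
  case (refl p)
  then show ?case using d_self[of x] by simp
next
  case (step p g h s l t)
  then have IH: "from_vertex x (edge_point g h s) \<le> l" by simp
  show ?case
  proof (cases "g = h")
    case False
    then show ?thesis using IH step from_vertex_edge[of g h s x] from_vertex_edge[of g h t x] by auto
  qed (use IH in simp)
qed

lemma from_vertex_le: "x \<in> carrier G \<Longrightarrow> q \<in> cg \<Longrightarrow> from_vertex x q \<le> cd (vertex x) q"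
  using cayley_chain_exists[OF is_group gen, of "vertex x" q]
  by (auto simp: cayley_dist_def intro!: cInf_greatest intro: chain_from_vertex)

lemma cd_vertex:
  assumes "x \<in> carrier G" "y \<in> carrier G"
  shows "cd (vertex x) (vertex y) = wd x y"
  using from_vertex_le[of x "vertex y"] chain_dist_le[OF relpow_chain[OF wd_relpow]] assms
  by (simp add: antisym)

lemma cd_edge:
  assumes "cayley_edge G A g h" "s \<in> {0..1}" "t \<in> {0..1}"
  shows "cd (edge_point g h s) (edge_point g h t) \<le> \<bar>s - t\<bar>"
  by (rule chain_dist_le[OF cayley_chain_edge[OF assms]])

lemma cd_vertex_edge:
  assumes e: "cayley_edge G A g h" "g \<noteq> h" and t: "t \<in> {0..1}" and x: "x \<in> carrier G"
  shows "cd (vertex x) (edge_point g h t) = min (real (wd x g) + t) (real (wd x h) + 1 - t)"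
proof (rule antisym)
  have c: "g \<in> carrier G" "h \<in> carrier G" "edge_point g h t \<in> cg"
    using edge_in[OF e(1)] edge_point_in_cayley_graph[OF e(1) t] by auto
  have "cd (vertex x) (edge_point g h t) \<le> real (wd x g) + t"
    using M.triangle[of "vertex x" "vertex g" "edge_point g h t"] cd_edge[OF e(1), of 0 t] t x c
    by (simp add: cd_vertex)
  moreover have "cd (vertex x) (edge_point g h t) \<le> real (wd x h) + 1 - t"
    using M.triangle[of "vertex x" "vertex h" "edge_point g h t"] cd_edge[OF e(1), of 1 t] t x c
    by (simp add: cd_vertex)
  ultimately show "cd (vertex x) (edge_point g h t) \<le> min (real (wd x g) + t) (real (wd x h) + 1 - t)" by simp
  show "min (real (wd x g) + t) (real (wd x h) + 1 - t) \<le> cd (vertex x) (edge_point g h t)"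
    using from_vertex_le[OF x c(3)] from_vertex_edge[OF e t x] by simp
qed

lemma point_cases:
  assumes "p \<in> cg"
  obtains (vert) g where "g \<in> carrier G" "p = vertex g"
    | (edge) g h t where "cayley_edge G A g h" "g \<noteq> h" "0 < t" "t < 1" "p = edge_point g h t"
proof -
  consider g where "g \<in> carrier G" "p = vertex g"
    | g h t where "cayley_edge G A g h" "t \<in> {0..1}" "p = edge_point g h t"
    using assms by (auto simp: cayley_graph_def)
  then show thesis
  proof cases
    case 1 then show ?thesis using vert by blast
  next
    case (2 g h t)
    then have "g \<in> carrier G" "h \<in> carrier G" using edge_in by auto
    consider "g = h" | "t = 0" | "t = 1" | "g \<noteq> h" "0 < t" "t < 1" using 2 by fastforce
    then show ?thesis by cases (use 2 vert edge \<open>g \<in> carrier G\<close> \<open>h \<in> carrier G\<close> in auto)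
  qed
qed

lemma near_vertex:
  assumes "p \<in> cg"
  shows "\<exists>g. g \<in> carrier G \<and> cd (vertex g) p \<le> 1"
  using assms
proof (cases rule: point_cases)
  case (vert g)
  then show ?thesis using cd_vertex[of g g] by auto
next
  case (edge g h t)
  then show ?thesis using cd_edge[of g h 0 t] edge_in[of g h] by (intro exI[of _ g]) auto
qed

text \<open>
  At an integer the value is a vertex whatever the next entry of the sequence is, so a finite sequence
  may be continued arbitrarily.
\<close>

definition interpolate :: "(nat \<Rightarrow> 'a) \<Rightarrow> real \<Rightarrow> 'a \<Rightarrow> real" where
  "interpolate v t = edge_point (v (nat \<lfloor>t\<rfloor>)) (v (Suc (nat \<lfloor>t\<rfloor>))) (frac t)"

lemma interpolate_nat [simp]: "interpolate v (real i) = vertex (v i)"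
  by (simp add: interpolate_def frac_def)

lemma interpolate_cell:
  assumes "0 \<le> r" "r \<le> 1"
  shows "interpolate v (real i + r) = edge_point (v i) (v (Suc i)) r"
proof (cases "r = 1")
  case True
  have "interpolate v (real i + r) = interpolate v (real (Suc i))" using True by (simp add: add.commute)
  then show ?thesis using True unfolding interpolate_nat by simp
next
  case False
  then have "\<lfloor>real i + r\<rfloor> = int i" using assms by (intro floor_unique) auto
  then show ?thesis by (simp add: interpolate_def frac_def)
qed

lemma real_cell:
  assumes "0 \<le> t"
  obtains i r where "t = real i + r" "0 \<le> r" "r < 1"
proof
  show "t = real (nat \<lfloor>t\<rfloor>) + frac t" using assms by (simp add: frac_def)
qed (auto simp: frac_lt_1)

lemma interpolate_geodesic:
  assumes v: "geod v n"
  shows "geodesic cg cd {0..real n} (interpolate v)"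
proof -
  have c: "v i \<in> carrier G" if "i \<le> n" for i using v that by (simp add: geod_def)
  have ed: "cayley_edge G A (v i) (v (Suc i))" if "i < n" for i
    using v that c[of i] c[of "Suc i"] by (intro wd_1_edge) (auto simp: geod_def)
  have cell_in: "interpolate v t \<in> cg" if "t \<in> {0..real n}" for t
  proof -
    have "0 \<le> t" using that by simp
    then obtain i r where ir: "t = real i + r" "0 \<le> r" "r < 1" by (rule real_cell)
    show ?thesis
    proof (cases "i < n")
      case True
      then show ?thesis using edge_point_in_cayley_graph[OF ed[OF True], of r] ir interpolate_cell[of r v i] by simp
    next
      case False
      then have "t = real n" using ir that by auto
      then show ?thesis using c[of n] by simp
    qed
  qed
  have cell: "cd (interpolate v (real i + r)) (interpolate v (real i + r')) \<le> \<bar>r - r'\<bar>"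
    if "i < n" "r \<in> {0..1}" "r' \<in> {0..1}" for i r r'
    using cd_edge[OF ed[OF that(1)] that(2,3)] that interpolate_cell by simp
  have lip: "cd (interpolate v s) (interpolate v t) \<le> t - s" if st: "0 \<le> s" "s \<le> t" "t \<le> real n" for s t
  proof -
    obtain i r where ir: "s = real i + r" "0 \<le> r" "r < 1" by (rule real_cell[OF st(1)])
    have "0 \<le> t" using st by linarith
    then obtain j r' where jr: "t = real j + r'" "0 \<le> r'" "r' < 1" by (rule real_cell)
    have ij: "i \<le> j" using ir jr st by linarith
    have sX: "interpolate v s \<in> cg" and tX: "interpolate v t \<in> cg" using cell_in st by auto
    have tj: "cd (vertex (v j)) (interpolate v t) \<le> r'"
    proof (cases "j < n")
      case True then show ?thesis using cell[of j 0 r'] jr by simp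
    next
      case False
      then have "t = real j" "j = n" using jr st by linarith+
      then show ?thesis using c[of n] M.mdist_zero[of "vertex (v n)"] jr(2) by simp
    qed
    show ?thesis
    proof (cases "i = j")
      case True
      show ?thesis
      proof (cases "j < n")
        case j: True
        then show ?thesis using cell[of j r r'] ir jr st True by simp
      next
        case False
        then have "s = t" using True ir jr st by linarith
        then show ?thesis using sX by simp
      qed
    next
      case False
      then have ij': "Suc i \<le> j" using ij by simp
      then have jn: "j \<le> n" using jr st by linarith
      have "cd (interpolate v s) (vertex (v (Suc i))) \<le> 1 - r"
        using cell[of i r 1] ij' jn ir interpolate_nat[of v "Suc i"] by (simp add: add.commute)
      moreover have "cd (vertex (v (Suc i))) (vertex (v j)) = real j - real (Suc i)"
        using cd_vertex[OF c c, of "Suc i" j] geod_d[OF v ij' jn] ij' jn by (simp add: of_nat_diff)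
      moreover have "cd (interpolate v s) (interpolate v t) \<le> cd (interpolate v s) (vertex (v (Suc i)))
          + cd (vertex (v (Suc i))) (interpolate v t)"
        "cd (vertex (v (Suc i))) (interpolate v t) \<le> cd (vertex (v (Suc i))) (vertex (v j))
          + cd (vertex (v j)) (interpolate v t)"
        using M.triangle sX tX vertex_in c ij' jn by auto
      ultimately show ?thesis using tj ir jr by simp
    qed
  qed
  have eq: "cd (interpolate v s) (interpolate v t) = t - s" if st: "0 \<le> s" "s \<le> t" "t \<le> real n" for s t
  proof (rule antisym[OF lip[OF st]])
    have "cd (interpolate v (real 0)) (interpolate v (real n)) = real n"
      using cd_vertex[OF c c, of 0 n] geod_d[OF v, of 0 n] unfolding interpolate_nat by simp
    then have "cd (interpolate v 0) (interpolate v (real n)) = real n" by simp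
    moreover have "cd (interpolate v 0) (interpolate v (real n)) \<le> cd (interpolate v 0) (interpolate v s)
          + cd (interpolate v s) (interpolate v (real n))"
      "cd (interpolate v s) (interpolate v (real n)) \<le> cd (interpolate v s) (interpolate v t)
          + cd (interpolate v t) (interpolate v (real n))"
      using M.triangle[OF cell_in cell_in cell_in, of 0 s "real n"]
        M.triangle[OF cell_in cell_in cell_in, of s t "real n"] st by simp_all
    ultimately show "t - s \<le> cd (interpolate v s) (interpolate v t)"
      using lip[of 0 s] lip[of t "real n"] st by simp
  qed
  have "cd (interpolate v s) (interpolate v t) = \<bar>s - t\<bar>" if "s \<in> {0..real n}" "t \<in> {0..real n}" for s t
    using eq[of s t] eq[of t s] that M.commute[of "interpolate v s" "interpolate v t"] by (cases "s \<le> t") auto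
  then show ?thesis unfolding quasi_geodesic_def using cell_in by (auto simp: is_interval_cc)
qed

lemma interpolate_ray:
  assumes v: "\<And>n. geod v n"
  shows "geodesic cg cd {0..} (interpolate v)"
  unfolding quasi_geodesic_def
proof (intro conjI ballI)
  show "is_interval {0::real..}" by (simp add: is_interval_ci)
  fix s t :: real assume st: "s \<in> {0..}" "t \<in> {0..}"
  obtain n where n: "max s t \<le> real n" using real_arch_simple by blast
  have "geodesic cg cd {0..real n} (interpolate v)" using interpolate_geodesic[OF v] .
  then show "1 / 1 * \<bar>s - t\<bar> - 0 \<le> cd (interpolate v s) (interpolate v t)"
    "cd (interpolate v s) (interpolate v t) \<le> 1 * \<bar>s - t\<bar> + 0"
    using st n unfolding quasi_geodesic_def by auto
next
  show "interpolate v \<in> {0..} \<rightarrow> cg"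
  proof
    fix t :: real assume t: "t \<in> {0..}"
    obtain n where n: "t \<le> real n" using real_arch_simple by blast
    have "geodesic cg cd {0..real n} (interpolate v)" using interpolate_geodesic[OF v] .
    then show "interpolate v t \<in> cg" using t n unfolding quasi_geodesic_def by auto
  qed
qed simp

text \<open>
  Used only for curves that are at vertices at integer times.
\<close>

definition vertices :: "(real \<Rightarrow> 'a \<Rightarrow> real) \<Rightarrow> nat \<Rightarrow> 'a" where
  "vertices \<gamma> i = (SOME g. \<gamma> (real i) = vertex g)"

lemma verticesI: "\<gamma> (real i) = vertex g \<Longrightarrow> vertices \<gamma> i = g"
  unfolding vertices_def by (metis (mono_tags) someI vertex_eq_iff)

text \<open>
  A point at integer distance from a vertex is a vertex, and a point at distances \<open>r\<close> and \<open>1 - r\<close>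
  from two adjacent vertices lies on the edge between them. Consequently, convergence of geodesics
  that start at a vertex amounts to eventual equality on compact sets.
\<close>

lemma geodesic_rigid:
  assumes \<gamma>: "geodesic cg cd I \<gamma>" and I: "{0..real n} \<subseteq> I" and x: "x \<in> carrier G" "\<gamma> 0 = vertex x"
  shows "geod (vertices \<gamma>) n" and "vertices \<gamma> 0 = x"
    and "\<And>i. i \<le> n \<Longrightarrow> \<gamma> (real i) = vertex (vertices \<gamma> i)"
    and "\<And>t. t \<in> {0..real n} \<Longrightarrow> \<gamma> t = interpolate (vertices \<gamma>) t"
proof -
  have \<gamma>X: "\<gamma> t \<in> cg" if "t \<in> {0..real n}" for t using \<gamma> I that unfolding quasi_geodesic_def by auto
  have d: "cd (\<gamma> s) (\<gamma> t) = \<bar>s - t\<bar>" if "s \<in> {0..real n}" "t \<in> {0..real n}" for s t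
    using geodesic_d[OF \<gamma>] I that by blast
  show v0: "vertices \<gamma> 0 = x" using x by (intro verticesI) simp
  have "\<exists>g\<in>carrier G. \<gamma> (real i) = vertex g" if i: "i \<le> n" for i
  proof -
    have di: "cd (vertex x) (\<gamma> (real i)) = real i" using d[of 0 "real i"] i x by simp
    have "\<gamma> (real i) \<in> cg" using \<gamma>X i by simp
    then show ?thesis
    proof (cases rule: point_cases)
      case (edge g h t)
      have "min (real (wd x g) + t) (real (wd x h) + 1 - t) = real i"
        using cd_vertex_edge[OF edge(1,2) _ x(1), of t] edge di by simp
      then have "real (wd x g) + t = real i \<or> real (wd x h) + 1 - t = real i" by linarith
      then have "(\<exists>k::int. t = of_int k)"
        by (metis add_diff_cancel_left' diff_diff_eq2 of_int_diff of_int_of_nat_eq add.commute of_nat_Suc diff_add_cancel)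
      then show ?thesis using edge(3,4) by auto
    qed auto
  qed
  then have vi: "\<gamma> (real i) = vertex (vertices \<gamma> i) \<and> vertices \<gamma> i \<in> carrier G" if "i \<le> n" for i
    using that verticesI by metis
  then show "\<And>i. i \<le> n \<Longrightarrow> \<gamma> (real i) = vertex (vertices \<gamma> i)" by blast
  have wdv: "real (wd (vertices \<gamma> i) (vertices \<gamma> j)) = \<bar>real i - real j\<bar>" if "i \<le> n" "j \<le> n" for i j
    using d[of "real i" "real j"] that vi cd_vertex by simp
  show gv: "geod (vertices \<gamma>) n"
    unfolding geod_def
  proof (intro conjI allI impI)
    fix i j assume "i \<le> j \<and> j \<le> n"
    then have "real (wd (vertices \<gamma> i) (vertices \<gamma> j)) = real (j - i)" using wdv[of i j] by (simp add: of_nat_diff)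
    then show "wd (vertices \<gamma> i) (vertices \<gamma> j) = j - i" by (simp only: of_nat_eq_iff)
  qed (use vi in blast)
  fix t assume t: "t \<in> {0..real n}"
  have "0 \<le> t" using t by simp
  then obtain i r where ir: "t = real i + r" "0 \<le> r" "r < 1" by (rule real_cell)
  show "\<gamma> t = interpolate (vertices \<gamma>) t"
  proof (cases "r = 0")
    case True
    then show ?thesis using vi[of i] ir t by simp
  next
    case False
    then have r: "0 < r" "r < 1" using ir by auto
    then have i: "Suc i \<le> n" using ir t by (simp add: Suc_le_eq)
    let ?v = "vertices \<gamma> i" and ?w = "vertices \<gamma> (Suc i)"
    have c: "?v \<in> carrier G" "?w \<in> carrier G" using vi[of i] vi[of "Suc i"] i by auto
    have wv: "wd ?w ?v = 1" using wdv[of "Suc i" i] i by simp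
    have dv: "cd (vertex ?v) (\<gamma> t) = r" using d[of "real i" t] vi[of i] i t ir by simp
    have dw: "cd (vertex ?w) (\<gamma> t) = 1 - r" using d[of "real (Suc i)" t] vi[of "Suc i"] i t ir by simp
    have int: "interpolate (vertices \<gamma>) t = edge_point ?v ?w r" using interpolate_cell[of r] ir by simp
    show ?thesis using \<gamma>X[OF t]
    proof (cases rule: point_cases)
      case (vert g)
      then have "real (wd ?v g) = r" using dv cd_vertex[OF c(1)] by simp
      then show ?thesis using r by (metis less_irrefl of_nat_0_less_iff of_nat_less_1_iff not_less_iff_gr_or_eq less_one of_nat_0 )
    next
      case (edge g h s)
      have gh: "g \<in> carrier G" "h \<in> carrier G" using edge_in[OF edge(1)] by auto
      have 1: "min (real (wd ?v g) + s) (real (wd ?v h) + 1 - s) = r"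
        using cd_vertex_edge[OF edge(1,2) _ c(1), of s] edge dv by simp
      have 2: "min (real (wd ?w g) + s) (real (wd ?w h) + 1 - s) = 1 - r"
        using cd_vertex_edge[OF edge(1,2) _ c(2), of s] edge dw by simp
      have small: "k = 0" if "real k < 1" for k :: nat using that by simp
      have "(?v = g \<and> s = r) \<or> (?v = h \<and> 1 - s = r)"
      proof (cases "real (wd ?v g) + s = r")
        case True
        then have "wd ?v g = 0" using edge r by (intro small) linarith
        then show ?thesis using True d_zero[OF c(1) gh(1)] by simp
      next
        case False
        then have *: "real (wd ?v h) + 1 - s = r" using 1 by linarith
        then have "wd ?v h = 0" using edge r by (intro small) linarith
        then show ?thesis using * d_zero[OF c(1) gh(2)] by simp
      qed
      then show ?thesis
      proof (elim disjE conjE)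
        assume a: "?v = g" "s = r"
        have "real (wd ?w h) + 1 - s = 1 - r" using 2 a wv r by (simp add: min_def split: if_splits)
        then have "?w = h" using a d_zero[OF c(2) gh(2)] by simp
        then show ?thesis using int edge a by simp
      next
        assume a: "?v = h" "1 - s = r"
        have "real (wd ?w g) + s = 1 - r" using 2 a wv r by (simp add: min_def split: if_splits)
        then have "?w = g" using a d_zero[OF c(2) gh(1)] by simp
        then show ?thesis using int edge a edge_point_swap[of h g s] by simp
      qed
    qed
  qed
qed

end

section \<open>Hyperbolicity and the Morse property in the word metric\<close>

text \<open>
  For \<open>u\<close> on the side from \<open>x\<close> to \<open>y\<close> the Gromov product of \<open>x\<close> and \<open>y\<close> at \<open>u\<close> vanishes, so that of
  \<open>z\<close> with \<open>x\<close> or with \<open>y\<close> is small, i.e. \<open>u\<close> is almost between \<open>z\<close> and \<open>x\<close>, say. It is then close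
  to the point of that side with the same difference of distances from the ends.
\<close>

lemma (in Metric_space) four_point_imp_hyperbolic:
  assumes fp: "\<And>w x y z. w \<in> M \<Longrightarrow> x \<in> M \<Longrightarrow> y \<in> M \<Longrightarrow> z \<in> M \<Longrightarrow>
    d x y + d z w \<le> max (d x z + d y w) (d y z + d x w) + \<delta>" and \<delta>: "0 \<le> \<delta>"
  shows "gromov_hyperbolic M d"
proof -
  have side: "\<exists>v\<in>{0..d p q}. d u (\<beta> v) \<le> 2 * \<delta>"
    if X: "p \<in> M" "q \<in> M" "u \<in> M" and \<beta>: "geodesic_between M d p q \<beta>" and close: "d p u + d q u \<le> d p q + \<delta>"
    for p q u \<beta>
  proof -
    define v where "v = (d p q + d p u - d q u) / 2"
    have v: "v \<in> {0..d p q}"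
      using triangle[OF X(1,2,3)] triangle[OF X(2,1,3)] triangle[OF X(1,3,2)] commute by (auto simp: v_def field_simps)
    have \<beta>g: "geodesic M d {0..d p q} \<beta>" "\<beta> 0 = p" "\<beta> (d p q) = q" using \<beta> by (auto simp: geodesic_between_def)
    have \<beta>v: "\<beta> v \<in> M" using \<beta>g(1) v unfolding quasi_geodesic_def by auto
    have "d p (\<beta> v) = v" "d q (\<beta> v) = d p q - v"
      using geodesic_d[OF \<beta>g(1), of 0 v] geodesic_d[OF \<beta>g(1), of "d p q" v] v \<beta>g(2,3) by auto
    moreover have "d p q + d u (\<beta> v) \<le> max (d p u + d q (\<beta> v)) (d q u + d p (\<beta> v)) + \<delta>"
      using fp[OF \<beta>v X(1,2,3)] .
    ultimately have "d u (\<beta> v) \<le> 2 * \<delta>" using close \<delta> unfolding v_def by argo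
    then show ?thesis using v by blast
  qed
  show ?thesis
    unfolding gromov_hyperbolic_def
  proof (intro exI[of _ "2 * \<delta>"] conjI ballI allI impI)
    show "0 \<le> 2 * \<delta>" using \<delta> by simp
    fix x y z \<alpha> \<beta> \<gamma> t
    assume X: "x \<in> M" "y \<in> M" "z \<in> M"
      and g: "geodesic_between M d x y \<alpha> \<and> geodesic_between M d y z \<beta> \<and> geodesic_between M d z x \<gamma>"
      and t: "t \<in> {0..d x y}"
    have \<alpha>: "geodesic M d {0..d x y} \<alpha>" "\<alpha> 0 = x" "\<alpha> (d x y) = y" using g by (auto simp: geodesic_between_def)
    have u: "\<alpha> t \<in> M" using \<alpha>(1) t unfolding quasi_geodesic_def by auto
    have xu: "d x (\<alpha> t) = t" "d y (\<alpha> t) = d x y - t"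
      using geodesic_d[OF \<alpha>(1), of 0 t] geodesic_d[OF \<alpha>(1), of "d x y" t] t \<alpha>(2,3) by auto
    have "d x y + d z (\<alpha> t) \<le> max (d x z + d y (\<alpha> t)) (d y z + d x (\<alpha> t)) + \<delta>" using fp[OF u X] .
    then have "d z (\<alpha> t) + d x (\<alpha> t) \<le> d z x + \<delta> \<or> d y (\<alpha> t) + d z (\<alpha> t) \<le> d y z + \<delta>"
      using xu commute[of x z] by linarith
    then show "(\<exists>v\<in>{0..d y z}. d (\<alpha> t) (\<beta> v) \<le> 2 * \<delta>) \<or> (\<exists>w\<in>{0..d z x}. d (\<alpha> t) (\<gamma> w) \<le> 2 * \<delta>)"
      using side[OF X(3,1) u] side[OF X(2,3) u] g by blast
  qed
qed

context cayley
begin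

lemma hyperbolic_of_four_point:
  assumes four_point
  shows "gromov_hyperbolic cg cd"
proof -
  obtain \<delta> where \<delta>: "\<And>w x y z. w \<in> carrier G \<Longrightarrow> x \<in> carrier G \<Longrightarrow> y \<in> carrier G \<Longrightarrow> z \<in> carrier G \<Longrightarrow>
     wd x y + wd z w \<le> max (wd x z + wd y w) (wd y z + wd x w) + \<delta>"
    using assms unfolding four_point_def by blast
  show ?thesis
  proof (rule M.four_point_imp_hyperbolic)
    fix w x y z assume X: "w \<in> cg" "x \<in> cg" "y \<in> cg" "z \<in> cg"
    obtain \<phi> where \<phi>: "\<And>p. p \<in> cg \<Longrightarrow> \<phi> p \<in> carrier G \<and> cd (vertex (\<phi> p)) p \<le> 1" using near_vertex by metis
    have close: "\<bar>cd p q - real (wd (\<phi> p) (\<phi> q))\<bar> \<le> 2" if "p \<in> cg" "q \<in> cg" for p q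
    proof -
      have V: "vertex (\<phi> p) \<in> cg" "vertex (\<phi> q) \<in> cg" using \<phi> that by auto
      have "cd (vertex (\<phi> p)) (vertex (\<phi> q)) = wd (\<phi> p) (\<phi> q)" using cd_vertex \<phi> that by blast
      moreover have "cd p q \<le> cd p (vertex (\<phi> p)) + cd (vertex (\<phi> p)) q"
        "cd (vertex (\<phi> p)) q \<le> cd (vertex (\<phi> p)) (vertex (\<phi> q)) + cd (vertex (\<phi> q)) q"
        "cd (vertex (\<phi> p)) (vertex (\<phi> q)) \<le> cd (vertex (\<phi> p)) p + cd p (vertex (\<phi> q))"
        "cd p (vertex (\<phi> q)) \<le> cd p q + cd q (vertex (\<phi> q))"
        using M.triangle V that by blast+
      ultimately show ?thesis using \<phi>[OF that(1)] \<phi>[OF that(2)] M.commute[of p "vertex (\<phi> p)"] M.commute[of q "vertex (\<phi> q)"]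
        by linarith
    qed
    have "real (wd (\<phi> x) (\<phi> y) + wd (\<phi> z) (\<phi> w)) \<le>
        real (max (wd (\<phi> x) (\<phi> z) + wd (\<phi> y) (\<phi> w)) (wd (\<phi> y) (\<phi> z) + wd (\<phi> x) (\<phi> w)) + \<delta>)"
      using \<delta>[of "\<phi> w" "\<phi> x" "\<phi> y" "\<phi> z"] \<phi> X by (simp only: of_nat_le_iff)
    then show "cd x y + cd z w \<le> max (cd x z + cd y w) (cd y z + cd x w) + (real \<delta> + 8)"
      using close[of x y] close[of z w] close[of x z] close[of y w] close[of y z] close[of x w] X
      unfolding of_nat_add of_nat_max by linarith
  qed simp
qed

lemma interpolate_between:
  assumes v: "geod v n"
  shows "geodesic_between cg cd (vertex (v 0)) (vertex (v n)) (interpolate v)"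
    "cd (vertex (v 0)) (vertex (v n)) = real n"
proof -
  have X: "v 0 \<in> carrier G" "v n \<in> carrier G" using v by (auto simp: geod_def)
  show e: "cd (vertex (v 0)) (vertex (v n)) = real n"
    using cd_vertex[OF X] geod_d[OF v, of 0 n] by simp
  show "geodesic_between cg cd (vertex (v 0)) (vertex (v n)) (interpolate v)"
    unfolding geodesic_between_def e using interpolate_geodesic[OF v] interpolate_nat[of v 0] by simp
qed

lemma slim_of_hyperbolic:
  assumes "gromov_hyperbolic cg cd"
  shows "\<exists>\<delta>. slim \<delta>"
proof -
  obtain \<delta> where \<delta>: "0 \<le> \<delta>" "\<And>x y z \<alpha> \<beta> \<gamma> u. x \<in> cg \<Longrightarrow> y \<in> cg \<Longrightarrow> z \<in> cg \<Longrightarrow>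
        geodesic_between cg cd x y \<alpha> \<Longrightarrow> geodesic_between cg cd y z \<beta> \<Longrightarrow> geodesic_between cg cd z x \<gamma> \<Longrightarrow>
        u\<in>{0..cd x y} \<Longrightarrow> (\<exists>v\<in>{0..cd y z}. cd (\<alpha> u) (\<beta> v) \<le> \<delta>) \<or> (\<exists>w\<in>{0..cd z x}. cd (\<alpha> u) (\<gamma> w) \<le> \<delta>)"
    using assms unfolding gromov_hyperbolic_def by blast
  have round: "\<exists>j\<le>n. wd g (v j) \<le> nat \<lceil>\<delta>\<rceil> + 1"
    if v: "geod v n" and g: "g \<in> carrier G" and t: "t \<in> {0..real n}" "cd (vertex g) (interpolate v t) \<le> \<delta>" for v n g t
  proof -
    have "0 \<le> t" using t by simp
    then obtain j r where jr: "t = real j + r" "0 \<le> r" "r < 1" by (rule real_cell)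
    have jn: "j \<le> n" using jr t by auto
    have X: "v j \<in> carrier G" using v jn by (simp add: geod_def)
    have gd: "geodesic cg cd {0..real n} (interpolate v)" using interpolate_geodesic[OF v] .
    have "interpolate v t \<in> cg" using gd t unfolding quasi_geodesic_def by auto
    moreover have "cd (interpolate v t) (vertex (v j)) = r"
      using geodesic_d[OF gd t(1), of "real j"] jn jr by simp
    ultimately have "cd (vertex g) (vertex (v j)) \<le> \<delta> + r"
      using M.triangle[of "vertex g" "interpolate v t" "vertex (v j)"] t(2) g X by simp
    then have "real (wd g (v j)) \<le> \<delta> + 1" using cd_vertex[OF g X] jr by simp
    then have "wd g (v j) \<le> nat \<lceil>\<delta>\<rceil> + 1" using \<delta>(1) by linarith
    then show ?thesis using jn by blast
  qed
  have "slim (nat \<lceil>\<delta>\<rceil> + 1)"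
    unfolding slim_def
  proof (intro allI impI)
    fix \<alpha> \<beta> \<gamma> l m n i
    assume a: "geod \<alpha> l \<and> geod \<beta> m \<and> geod \<gamma> n \<and> \<alpha> l = \<beta> 0 \<and> \<beta> m = \<gamma> 0 \<and> \<gamma> n = \<alpha> 0" and i: "i \<le> l"
    have g: "geod \<alpha> l" "geod \<beta> m" "geod \<gamma> n" using a by auto
    have X: "\<alpha> 0 \<in> carrier G" "\<beta> 0 \<in> carrier G" "\<gamma> 0 \<in> carrier G" "\<alpha> i \<in> carrier G" using g i by (auto simp: geod_def)
    note b = interpolate_between[OF g(1)] interpolate_between[OF g(2)] interpolate_between[OF g(3)]
    have "(\<exists>v\<in>{0..real m}. cd (interpolate \<alpha> (real i)) (interpolate \<beta> v) \<le> \<delta>) \<or>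
       (\<exists>w\<in>{0..real n}. cd (interpolate \<alpha> (real i)) (interpolate \<gamma> w) \<le> \<delta>)"
      using \<delta>(2)[of "vertex (\<alpha> 0)" "vertex (\<beta> 0)" "vertex (\<gamma> 0)" "interpolate \<alpha>" "interpolate \<beta>" "interpolate \<gamma>" "real i"]
        b X a i by simp
    then show "(\<exists>j\<le>m. wd (\<alpha> i) (\<beta> j) \<le> nat \<lceil>\<delta>\<rceil> + 1) \<or> (\<exists>j\<le>n. wd (\<alpha> i) (\<gamma> j) \<le> nat \<lceil>\<delta>\<rceil> + 1)"
      using round[OF g(2) X(4)] round[OF g(3) X(4)] unfolding interpolate_nat by blast
  qed
  then show ?thesis by blast
qed

text \<open>
  A path of vertices becomes a map on an interval by rounding down, which adds \<open>2\<close> to the additive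
  constant.
\<close>

lemma stable_of_morse:
  assumes \<gamma>: "geodesic cg cd {0..} \<gamma>" "\<gamma> 0 = vertex x" "x \<in> carrier G" and M: "is_morse cg cd M {0..} \<gamma>"
  shows "stable (\<lambda>c. nat \<lceil>M 3 (real c + 2)\<rceil> + 1) (vertices \<gamma>) n"
proof -
  let ?v = "vertices \<gamma>"
  note rigid = geodesic_rigid[OF \<gamma>(1) _ \<gamma>(3,2)]
  have vg: "geod ?v n" for n using rigid(1)[of n] by auto
  have v: "\<gamma> (real i) = vertex (?v i)" for i using rigid(3)[of i i] by auto
  show ?thesis
    unfolding stable_def
  proof (intro conjI allI impI)
    show "geod ?v n" by (rule vg)
    fix s t c p m i
    assume a: "s \<le> t \<and> t \<le> n \<and> qg c p m \<and> p 0 = ?v s \<and> p m = ?v t" and i: "i \<le> m"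
    have p: "qg c p m" using a by blast
    have pX: "p i \<in> carrier G" if "i \<le> m" for i using p that by (simp add: qg_def)
    have lip: "wd (p i) (p (i + k)) \<le> k" if "i + k \<le> m" for i k
      using that
    proof (induction k)
      case (Suc k)
      have "wd (p (i + k)) (p (Suc (i + k))) \<le> 1" using p Suc.prems by (simp add: qg_def)
      then show ?case using wd_tri[OF pX pX pX, of i "i + k" "i + Suc k"] Suc by simp
    qed (use pX in simp)
    define \<sigma> where "\<sigma> u = vertex (p (nat \<lfloor>u\<rfloor>))" for u :: real
    have est: "1 / 3 * \<bar>u - w\<bar> - (real c + 2) \<le> cd (\<sigma> u) (\<sigma> w) \<and> cd (\<sigma> u) (\<sigma> w) \<le> 3 * \<bar>u - w\<bar> + (real c + 2)"
      if uw: "0 \<le> u" "u \<le> w" "w \<le> real m" for u w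
    proof -
      define i j where "i = nat \<lfloor>u\<rfloor>" and "j = nat \<lfloor>w\<rfloor>"
      have ij: "i \<le> j" "j \<le> m" using uw unfolding i_def j_def by (auto intro!: nat_mono floor_mono simp: le_floor_iff) linarith
      have fl: "real i \<le> u" "u < real i + 1" "real j \<le> w" "w < real j + 1" using uw unfolding i_def j_def by linarith+
      have "cd (\<sigma> u) (\<sigma> w) = wd (p i) (p j)" unfolding \<sigma>_def i_def[symmetric] j_def[symmetric] using cd_vertex pX ij by simp
      moreover have "j - i \<le> 3 * wd (p i) (p j) + c" using p ij by (simp add: qg_def)
      then have "real j - real i \<le> 3 * real (wd (p i) (p j)) + real c" using ij(1) by linarith
      moreover have "wd (p i) (p j) \<le> j - i" using lip[of i "j - i"] ij by simp
      then have "real (wd (p i) (p j)) \<le> real j - real i" using ij(1) by linarith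
      moreover have "\<bar>u - w\<bar> = w - u" "0 \<le> real c" using uw by auto
      ultimately have "w - u \<le> 3 * cd (\<sigma> u) (\<sigma> w) + 3 * (real c + 2) \<and>
          cd (\<sigma> u) (\<sigma> w) \<le> 3 * (w - u) + (real c + 2)"
        using fl uw(2) by argo
      then show ?thesis using \<open>\<bar>u - w\<bar> = w - u\<close> by (simp add: field_simps)
    qed
    have "quasi_geodesic cg cd 3 (real c + 2) {0..real m} \<sigma>"
      unfolding quasi_geodesic_def
    proof (intro conjI ballI)
      show "\<sigma> \<in> {0..real m} \<rightarrow> cg"
      proof
        fix u assume "u \<in> {0..real m}"
        then have "nat \<lfloor>u\<rfloor> \<le> m" by (simp add: nat_le_iff floor_le_iff)
        then show "\<sigma> u \<in> cg" using pX by (simp add: \<sigma>_def)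
      qed
      fix u w :: real assume uw: "u \<in> {0..real m}" "w \<in> {0..real m}"
      have "1 / 3 * \<bar>u - w\<bar> - (real c + 2) \<le> cd (\<sigma> u) (\<sigma> w) \<and> cd (\<sigma> u) (\<sigma> w) \<le> 3 * \<bar>u - w\<bar> + (real c + 2)"
      proof (cases "u \<le> w")
        case True then show ?thesis using est[of u w] uw by simp
      next
        case False
        then have "1 / 3 * \<bar>w - u\<bar> - (real c + 2) \<le> cd (\<sigma> w) (\<sigma> u) \<and> cd (\<sigma> w) (\<sigma> u) \<le> 3 * \<bar>w - u\<bar> + (real c + 2)"
          using est[of w u] uw by simp
        then show ?thesis using M.commute[of "\<sigma> u" "\<sigma> w"] abs_minus_commute[of u w] by simp
      qed
      then show "1 / 3 * \<bar>u - w\<bar> - (real c + 2) \<le> cd (\<sigma> u) (\<sigma> w)"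
        "cd (\<sigma> u) (\<sigma> w) \<le> 3 * \<bar>u - w\<bar> + (real c + 2)" by auto
    qed (auto simp: is_interval_cc)
    moreover have "\<sigma> 0 = \<gamma> (real s)" "\<sigma> (real m) = \<gamma> (real t)" using a v by (auto simp: \<sigma>_def)
    moreover have "real s \<le> real t" "{real s..real t} \<subseteq> {0..}" using a by auto
    ultimately have "\<forall>u\<in>{0..real m}. \<exists>w\<in>{real s..real t}. cd (\<sigma> u) (\<gamma> w) \<le> M 3 (real c + 2)"
      using M[unfolded is_morse_def, rule_format, of "real s" "real t" 3 "real c + 2" 0 "real m" \<sigma>] by auto
    moreover have "real i \<in> {0..real m}" using i by simp
    ultimately obtain w where w: "w \<in> {real s..real t}" "cd (\<sigma> (real i)) (\<gamma> w) \<le> M 3 (real c + 2)" by blast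
    define j where "j = nat \<lfloor>w\<rfloor>"
    have j: "s \<le> j" "j \<le> t" "real j \<le> w" "w < real j + 1" using w(1) unfolding j_def by (auto simp: le_nat_iff le_floor_iff) linarith+
    have jX: "?v j \<in> carrier G" using vg[of j] by (simp add: geod_def)
    have "cd (\<gamma> w) (\<gamma> (real j)) \<le> 1" using geodesic_d[OF \<gamma>(1), of w "real j"] j w(1) by auto
    moreover have "\<gamma> w \<in> cg" using \<gamma>(1) w(1) unfolding quasi_geodesic_def by auto
    ultimately have "cd (vertex (p i)) (vertex (?v j)) \<le> M 3 (real c + 2) + 1"
      using M.triangle[of "vertex (p i)" "\<gamma> w" "vertex (?v j)"] w(2) pX[OF i] jX v[of j] by (simp add: \<sigma>_def)
    then have "real (wd (p i) (?v j)) \<le> M 3 (real c + 2) + 1" using cd_vertex[OF pX[OF i] jX] by simp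
    then have "wd (p i) (?v j) \<le> nat \<lceil>M 3 (real c + 2)\<rceil> + 1" by linarith
    then show "\<exists>j\<in>{s..t}. wd (p i) (?v j) \<le> nat \<lceil>M 3 (real c + 2)\<rceil> + 1" using j by auto
  qed
qed

end

section \<open>Geodesics in Cayley graphs of hyperbolic groups\<close>

context cayley
begin

lemma subgroup_word_dist:
  assumes H: "subgroup H G" and B: "finite_symmetric_generating_set (G\<lparr>carrier := H\<rparr>) B"
  shows "\<exists>L. \<forall>x\<in>H. \<forall>y\<in>H. wd x y \<le> L * word_dist (G\<lparr>carrier := H\<rparr>) B x y"
proof -
  interpret H: subgroup H G by (rule H)
  interpret K: cayley "G\<lparr>carrier := H\<rparr>" B
    by (intro cayley.intro cayley_axioms.intro B) (rule H.subgroup_is_group[OF is_group])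
  define L where "L = (\<Sum>b\<in>B. wd \<one> b)"
  have Hc: "H \<subseteq> carrier G" by (rule H.subset)
  have edge: "wd x y \<le> L" if e: "cayley_edge (G\<lparr>carrier := H\<rparr>) B x y" for x y
  proof -
    have xy: "x \<in> H" "y \<in> H" using e by (auto simp: cayley_edge_def)
    have xyB: "inv x \<otimes> y \<in> B"
      using e m_inv_consistent[OF H xy(1)] by (simp add: cayley_edge_def)
    have c: "x \<in> carrier G" "y \<in> carrier G" using xy Hc by blast+
    have "wd x y = wd \<one> (inv x \<otimes> y)"
      using d_translate[of "inv x" x y] c by simp
    also have "\<dots> \<le> L" unfolding L_def using xyB K.A_props(4) by (intro member_le_sum) auto
    finally show ?thesis .
  qed
  have "wd x y \<le> L * n" if "(x, y) \<in> K.E ^^ n" "x \<in> H" for x y n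
    using that
  proof (induction n arbitrary: y)
    case 0
    then show ?case using Hc d_self[of x] by auto
  next
    case (Suc n)
    obtain z where z: "(x, z) \<in> K.E ^^ n" "(z, y) \<in> K.E" using Suc.prems(1) by (rule relpow_Suc_E)
    have X: "x \<in> carrier G" "z \<in> carrier G" "y \<in> carrier G"
      using z(2) K.edge_in[of z y] Suc.prems(2) Hc by auto
    have "wd x z \<le> L * n" using Suc.IH[OF z(1)] Suc.prems(2) by blast
    moreover have "wd z y \<le> L" using edge z(2) by simp
    ultimately show ?case using wd_tri[OF X] by simp
  qed
  then have "\<forall>x\<in>H. \<forall>y\<in>H. wd x y \<le> L * K.wd x y" using K.wd_relpow by simp
  then show ?thesis by blast
qed

lemma word_dist_comparable:
  assumes "finite_symmetric_generating_set G A'"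
  shows "\<exists>L. \<forall>x\<in>carrier G. \<forall>y\<in>carrier G. wd x y \<le> L * word_dist G A' x y"
  using subgroup_word_dist[OF subgroup_self, of A'] assms by simp

text \<open>
  Sampling at integer times and rounding to vertices turns quasi-geodesics of the Cayley graph into
  sequences of vertices, whose constants change in a controlled way under a change of generators.
\<close>

lemma sample_coarse_qg:
  assumes A': "cayley G A'"
    and L: "\<And>x y. x \<in> carrier G \<Longrightarrow> y \<in> carrier G \<Longrightarrow> word_dist G A' x y \<le> L * wd x y"
    and L': "\<And>x y. x \<in> carrier G \<Longrightarrow> y \<in> carrier G \<Longrightarrow> wd x y \<le> L' * word_dist G A' x y"
    and kc: "1 \<le> k" "0 \<le> c" and \<sigma>: "quasi_geodesic cg cd k c {a..b} \<sigma>" and ab: "a \<le> b"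
    and \<phi>: "\<And>p. p \<in> cg \<Longrightarrow> \<phi> p \<in> carrier G \<and> cd (vertex (\<phi> p)) p \<le> 1"
    and Q: "Q = nat \<lceil>real L * k + real L * (c + 2) + k * real L' + 1 + k * (c + 2)\<rceil>"
  shows "discrete_geodesic_space.coarse_qg (carrier G) (word_dist G A') Q
    (\<lambda>i. \<phi> (\<sigma> (min (a + real i) b))) (nat \<lceil>b - a\<rceil>)"
proof -
  interpret A': cayley G A' by (rule A')
  define R where "R = real L * k + real L * (c + 2) + k * real L' + 1 + k * (c + 2)"
  have QR: "R \<le> real Q" unfolding Q R_def by linarith
  have nn: "0 \<le> real L * k" "0 \<le> real L * (c + 2)" "0 \<le> k * real L'" "0 \<le> k * (c + 2)" using kc by auto
  define p where "p i = \<sigma> (min (a + real i) b)" for i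
  have dom: "min (a + real i) b \<in> {a..b}" for i using ab by auto
  have pX: "p i \<in> cg" for i using \<sigma> dom[of i] unfolding quasi_geodesic_def p_def by auto
  have \<phi>X: "\<phi> (p i) \<in> carrier G" for i using \<phi>[OF pX] by blast
  have "A'.wd (\<phi> (p i)) (\<phi> (p j)) \<le> Q * (j - i) + Q \<and> j - i \<le> Q * A'.wd (\<phi> (p i)) (\<phi> (p j)) + Q"
    if ij: "i \<le> j" "j \<le> nat \<lceil>b - a\<rceil>" for i j
  proof -
    define s t where "s = min (a + real i) b" and "t = min (a + real j) b"
    have jb: "real j < b - a + 1" using ij(2) ab by linarith
    have st: "0 \<le> t - s" "t - s \<le> real j - real i" "real j - real i - 1 \<le> t - s"
      using ij(1) jb unfolding s_def t_def by auto
    define w where "w = real (wd (\<phi> (p i)) (\<phi> (p j)))"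
    define w' where "w' = real (A'.wd (\<phi> (p i)) (\<phi> (p j)))"
    have V: "vertex (\<phi> (p i)) \<in> cg" "vertex (\<phi> (p j)) \<in> cg" using \<phi>X by auto
    have "cd (vertex (\<phi> (p i))) (vertex (\<phi> (p j))) = w" using cd_vertex \<phi>X w_def by blast
    moreover have "cd (p i) (p j) \<le> cd (p i) (vertex (\<phi> (p i))) + cd (vertex (\<phi> (p i))) (p j)"
        "cd (vertex (\<phi> (p i))) (p j) \<le> cd (vertex (\<phi> (p i))) (vertex (\<phi> (p j))) + cd (vertex (\<phi> (p j))) (p j)"
        "cd (vertex (\<phi> (p i))) (vertex (\<phi> (p j))) \<le> cd (vertex (\<phi> (p i))) (p i) + cd (p i) (vertex (\<phi> (p j)))"
        "cd (p i) (vertex (\<phi> (p j))) \<le> cd (p i) (p j) + cd (p j) (vertex (\<phi> (p j)))"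
      using M.triangle V pX by blast+
    moreover have "cd (p i) (vertex (\<phi> (p i))) \<le> 1" "cd (vertex (\<phi> (p i))) (p i) \<le> 1"
      "cd (p j) (vertex (\<phi> (p j))) \<le> 1" "cd (vertex (\<phi> (p j))) (p j) \<le> 1"
      using \<phi>[OF pX] M.commute by metis+
    ultimately have close: "cd (p i) (p j) \<le> w + 2" "w \<le> cd (p i) (p j) + 2" by linarith+
    have "1 / k * \<bar>s - t\<bar> - c \<le> cd (p i) (p j) \<and> cd (p i) (p j) \<le> k * \<bar>s - t\<bar> + c"
      using \<sigma> dom[of i] dom[of j] unfolding quasi_geodesic_def p_def s_def t_def by blast
    then have est: "(t - s) / k - c \<le> cd (p i) (p j)" "cd (p i) (p j) \<le> k * (t - s) + c" using st(1) by auto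
    have w'L: "w' \<le> real L * w"
      using L[OF \<phi>X \<phi>X, of i j] unfolding w_def w'_def by (metis of_nat_le_iff of_nat_mult)
    have wL': "w \<le> real L' * w'"
      using L'[OF \<phi>X \<phi>X, of i j] unfolding w_def w'_def by (metis of_nat_le_iff of_nat_mult)
    have w'0: "0 \<le> w'" by (simp add: w'_def)
    have "w \<le> k * (real j - real i) + c + 2"
      using close(2) est(2) mult_left_mono[OF st(2), of k] kc by linarith
    then have "w' \<le> real L * (k * (real j - real i) + c + 2)" using w'L by (smt (verit) mult_left_mono of_nat_0_le_iff)
    also have "\<dots> = (real L * k) * (real j - real i) + real L * (c + 2)" by (simp add: algebra_simps)
    also have "\<dots> \<le> real Q * (real j - real i) + real Q"
    proof (intro add_mono mult_right_mono)
      show "real L * k \<le> real Q" "real L * (c + 2) \<le> real Q" using QR nn unfolding R_def by linarith+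
    qed (use ij(1) in simp)
    finally have 1: "w' \<le> real Q * (real j - real i) + real Q" .
    have "(t - s) / k \<le> real L' * w' + c + 2" using est(1) close(1) wL' by linarith
    then have "t - s \<le> k * (real L' * w' + c + 2)" using kc by (simp add: field_simps)
    then have "real j - real i \<le> (k * real L') * w' + (1 + k * (c + 2))" using st(3) by (simp add: algebra_simps)
    also have "\<dots> \<le> real Q * w' + real Q"
    proof (intro add_mono mult_right_mono)
      show "k * real L' \<le> real Q" "1 + k * (c + 2) \<le> real Q" using QR nn unfolding R_def by linarith+
    qed (rule w'0)
    finally have 2: "real j - real i \<le> real Q * w' + real Q" .
    have "real (A'.wd (\<phi> (p i)) (\<phi> (p j))) \<le> real (Q * (j - i) + Q)" using 1 ij(1) by (simp add: w'_def of_nat_diff)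
    moreover have "real (j - i) \<le> real (Q * A'.wd (\<phi> (p i)) (\<phi> (p j)) + Q)" using 2 ij(1) by (simp add: w'_def of_nat_diff)
    ultimately show ?thesis by (simp only: of_nat_le_iff)
  qed
  then show ?thesis unfolding A'.coarse_qg_def using \<phi>X unfolding p_def by blast
qed

text \<open>
  A geodesic for \<open>A\<close> and a quasi-geodesic with the same endpoints both become coarse quasi-geodesics
  for the generating set \<open>A'\<close>, where they are close to each other by the Morse lemma.
\<close>

theorem geodesics_uniformly_morse:
  assumes A': "finite_symmetric_generating_set G A'"
    and hyp: "gromov_hyperbolic (cayley_graph G A') (cayley_dist G A')"
  shows "\<exists>N. morse_gauge N \<and> (\<forall>I \<gamma>. geodesic cg cd I \<gamma> \<longrightarrow> is_morse cg cd N I \<gamma>)"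
proof -
  have cA': "cayley G A'" by (intro cayley.intro cayley_axioms.intro is_group A')
  interpret A': cayley G A' by (rule cA')
  obtain \<delta> where \<delta>: "A'.slim \<delta>" using A'.slim_of_hyperbolic[OF hyp] by blast
  obtain L where L: "\<And>x y. x \<in> carrier G \<Longrightarrow> y \<in> carrier G \<Longrightarrow> A'.wd x y \<le> L * wd x y"
    using A'.word_dist_comparable[OF gen] by blast
  obtain L' where L': "\<And>x y. x \<in> carrier G \<Longrightarrow> y \<in> carrier G \<Longrightarrow> wd x y \<le> L' * A'.wd x y"
    using word_dist_comparable[OF A'] by blast
  obtain \<phi> where \<phi>: "\<And>p. p \<in> cg \<Longrightarrow> \<phi> p \<in> carrier G \<and> cd (vertex (\<phi> p)) p \<le> 1" using near_vertex by metis
  have main: "\<exists>R\<ge>0. \<forall>\<gamma> s t a b \<sigma>. s \<le> t \<and> geodesic cg cd {s..t} \<gamma> \<and> a \<le> b \<and> quasi_geodesic cg cd k c {a..b} \<sigma> \<and>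
      \<sigma> a = \<gamma> s \<and> \<sigma> b = \<gamma> t \<longrightarrow> (\<forall>u\<in>{a..b}. \<exists>v\<in>{s..t}. cd (\<sigma> u) (\<gamma> v) \<le> R)"
    if kc: "1 \<le> k" "0 \<le> c" for k c
  proof -
    define Q where "Q = nat \<lceil>real L * k + real L * (c + 2) + k * real L' + 1 + k * (c + 2)\<rceil>"
    obtain R where R: "\<And>p m q n i. A'.coarse_qg Q p m \<Longrightarrow> A'.coarse_qg Q q n \<Longrightarrow> p 0 = q 0 \<Longrightarrow> p m = q n \<Longrightarrow>
      i\<le>m \<Longrightarrow> \<exists>j\<le>n. A'.wd (p i) (q j) \<le> R" using A'.coarse_qg_stability[OF \<delta>, of Q] by metis
    have "\<exists>v\<in>{s..t}. cd (\<sigma> u) (\<gamma> v) \<le> k + c + 2 + real L' * R"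
      if st: "s \<le> t" and \<gamma>: "geodesic cg cd {s..t} \<gamma>" and ab: "a \<le> b" and \<sigma>: "quasi_geodesic cg cd k c {a..b} \<sigma>"
        and e: "\<sigma> a = \<gamma> s" "\<sigma> b = \<gamma> t" and u: "u \<in> {a..b}" for \<gamma> s t a b \<sigma> u
    proof -
      define p where "p i = \<phi> (\<sigma> (min (a + real i) b))" for i
      define q where "q i = \<phi> (\<gamma> (min (s + real i) t))" for i
      have p: "A'.coarse_qg Q p (nat \<lceil>b - a\<rceil>)"
        unfolding p_def by (rule sample_coarse_qg[OF cA' L L' kc \<sigma> ab \<phi> Q_def])
      have \<gamma>': "quasi_geodesic cg cd k c {s..t} \<gamma>"
        unfolding quasi_geodesic_def
      proof (intro conjI ballI)
        fix x y assume xy: "x \<in> {s..t}" "y \<in> {s..t}"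
        have "1 * \<bar>x - y\<bar> \<le> k * \<bar>x - y\<bar>" using kc(1) by (rule mult_right_mono) simp
        moreover have "\<bar>x - y\<bar> / k \<le> \<bar>x - y\<bar>" using calculation kc(1) by (simp add: field_simps)
        ultimately show "1 / k * \<bar>x - y\<bar> - c \<le> cd (\<gamma> x) (\<gamma> y)" "cd (\<gamma> x) (\<gamma> y) \<le> k * \<bar>x - y\<bar> + c"
          using geodesic_d[OF \<gamma> xy] kc by auto
      qed (use \<gamma> in \<open>auto simp: quasi_geodesic_def\<close>)
      have q: "A'.coarse_qg Q q (nat \<lceil>t - s\<rceil>)"
        unfolding q_def by (rule sample_coarse_qg[OF cA' L L' kc \<gamma>' st \<phi> Q_def])
      have e0: "p 0 = q 0" using e ab st by (simp add: p_def q_def)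
      have "min (a + real (nat \<lceil>b - a\<rceil>)) b = b" "min (s + real (nat \<lceil>t - s\<rceil>)) t = t" by linarith+
      then have e1: "p (nat \<lceil>b - a\<rceil>) = q (nat \<lceil>t - s\<rceil>)" using e by (simp add: p_def q_def)
      define i where "i = nat \<lfloor>u - a\<rfloor>"
      have ri: "real i = of_int \<lfloor>u - a\<rfloor>" using u by (simp add: i_def)
      have ui: "a + real i \<le> u" "u < a + real i + 1"
        unfolding ri using floor_correct[of "u - a"] by linarith+
      have im: "i \<le> nat \<lceil>b - a\<rceil>" using ui(1) u by (simp add: le_nat_iff le_ceiling_iff)
      obtain j where j: "A'.wd (p i) (q j) \<le> R" using R[OF p q e0 e1 im] by blast
      define x where "x = min (a + real i) b"
      define y where "y = min (s + real j) t"
      have x: "x \<in> {a..b}" "\<bar>u - x\<bar> \<le> 1" using ui u unfolding x_def by auto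
      have y: "y \<in> {s..t}" using st by (auto simp: y_def)
      have X: "\<sigma> u \<in> cg" "\<sigma> x \<in> cg" "\<gamma> y \<in> cg" using \<sigma> \<gamma> x(1) y u unfolding quasi_geodesic_def by auto
      have pi: "p i = \<phi> (\<sigma> x)" and qj: "q j = \<phi> (\<gamma> y)" by (auto simp: p_def q_def x_def y_def)
      have pq: "p i \<in> carrier G" "q j \<in> carrier G" "vertex (p i) \<in> cg" "vertex (q j) \<in> cg"
        unfolding pi qj using \<phi> X by auto
      have "cd (\<sigma> u) (\<sigma> x) \<le> k * \<bar>u - x\<bar> + c" using \<sigma> u x(1) unfolding quasi_geodesic_def by blast
      also have "\<dots> \<le> k + c" using mult_left_mono[OF x(2), of k] kc by simp
      finally have 1: "cd (\<sigma> u) (\<sigma> x) \<le> k + c" .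
      have 2: "cd (\<sigma> x) (vertex (p i)) \<le> 1" unfolding pi using \<phi>[OF X(2)] M.commute by metis
      have "wd (p i) (q j) \<le> L' * R" using L'[OF pq(1,2)] mult_le_mono2[OF j, of L'] by linarith
      then have "real (wd (p i) (q j)) \<le> real (L' * R)" by (simp only: of_nat_le_iff)
      then have 3: "cd (vertex (p i)) (vertex (q j)) \<le> real L' * real R" using cd_vertex[OF pq(1,2)] by simp
      have 4: "cd (vertex (q j)) (\<gamma> y) \<le> 1" unfolding qj using \<phi>[OF X(3)] by blast
      have "cd (\<sigma> u) (\<gamma> y) \<le> k + c + 2 + real L' * R"
        using M.triangle[OF X(1,2,3)] M.triangle[OF X(2) pq(3) X(3)] M.triangle[OF pq(3,4) X(3)] 1 2 3 4
        by linarith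
      then show ?thesis using y by blast
    qed
    moreover have "0 \<le> k + c + 2 + real L' * R" using kc by simp
    ultimately show ?thesis by blast
  qed
  define N where "N k c = (SOME R. 0 \<le> R \<and> (\<forall>\<gamma> s t a b \<sigma>. s \<le> t \<and> geodesic cg cd {s..t} \<gamma> \<and> a \<le> b \<and>
      quasi_geodesic cg cd k c {a..b} \<sigma> \<and> \<sigma> a = \<gamma> s \<and> \<sigma> b = \<gamma> t \<longrightarrow> (\<forall>u\<in>{a..b}. \<exists>v\<in>{s..t}. cd (\<sigma> u) (\<gamma> v) \<le> R)))" for k c
  have N: "0 \<le> N k c \<and> (\<forall>\<gamma> s t a b \<sigma>. s \<le> t \<and> geodesic cg cd {s..t} \<gamma> \<and> a \<le> b \<and>
      quasi_geodesic cg cd k c {a..b} \<sigma> \<and> \<sigma> a = \<gamma> s \<and> \<sigma> b = \<gamma> t \<longrightarrow> (\<forall>u\<in>{a..b}. \<exists>v\<in>{s..t}. cd (\<sigma> u) (\<gamma> v) \<le> N k c))"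
    if "1 \<le> k" "0 \<le> c" for k c
    unfolding N_def by (rule someI_ex) (rule main[OF that])
  have sub: "geodesic cg cd {s..t} \<gamma>" if "geodesic cg cd I \<gamma>" "{s..t} \<subseteq> I" for I \<gamma> s t
    using that unfolding quasi_geodesic_def by (auto simp: is_interval_cc)
  have "is_morse cg cd N I \<gamma>" if \<gamma>: "geodesic cg cd I \<gamma>" for I \<gamma>
    unfolding is_morse_def
  proof (intro allI impI)
    fix s t k c a b \<sigma>
    assume "s \<le> t \<and> {s..t} \<subseteq> I" "1 \<le> k" "0 \<le> c"
      "a \<le> b \<and> quasi_geodesic cg cd k c {a..b} \<sigma> \<and> \<sigma> a = \<gamma> s \<and> \<sigma> b = \<gamma> t"
    then show "\<forall>u\<in>{a..b}. \<exists>v\<in>{s..t}. cd (\<sigma> u) (\<gamma> v) \<le> N k c"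
      using N[of k c] sub[OF \<gamma>, of s t] by blast
  qed
  moreover have "morse_gauge N" unfolding morse_gauge_def using N by blast
  ultimately show ?thesis by blast
qed

end

section \<open>Compactness and the Morse boundary\<close>

lemma eventually_constant_subsequence:
  fixes f :: "nat \<Rightarrow> nat \<Rightarrow> 'c"
  assumes fin: "\<And>i. finite (range (\<lambda>n. f n i))"
  shows "\<exists>r v. strict_mono (r :: nat \<Rightarrow> nat) \<and> (\<forall>T. \<exists>J. \<forall>j\<ge>J. \<forall>i\<le>T. f (r j) i = v i)"
proof -
  interpret subseqs "\<lambda>i s. \<exists>c. \<forall>j. f (s j) i = c"
  proof
    fix i and s :: "nat \<Rightarrow> nat" assume s: "strict_mono s"
    have "finite (range (\<lambda>j. f (s j) i))" by (rule finite_subset[OF _ fin[of i]]) auto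
    then obtain j0 where "infinite {j. f (s j) i = f (s j0) i}"
      using pigeonhole_infinite[of UNIV "\<lambda>j. f (s j) i"] by auto
    then obtain r' :: "nat \<Rightarrow> nat" where r': "strict_mono r'" "\<And>n. r' n \<in> {j. f (s j) i = f (s j0) i}"
      using infinite_enumerate by blast
    then have "\<forall>j. f ((s \<circ> r') j) i = f (s j0) i" by simp
    then show "\<exists>r' :: nat \<Rightarrow> nat. strict_mono r' \<and> (\<exists>c. \<forall>j. f ((s \<circ> r') j) i = c)" using r'(1) by blast
  qed
  have "\<exists>c. \<forall>j. f ((diagseq \<circ> (+) (Suc i)) j) i = c" for i
    by (rule diagseq_holds) auto
  then obtain v where v: "\<And>i j. f (diagseq (Suc i + j)) i = v i" by (auto simp: choice_iff) metis
  have "f (diagseq j) i = v i" if "Suc T \<le> j" "i \<le> T" for T i j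
    using v[of i "j - Suc i"] that by simp
  then show ?thesis using subseq_diagseq by blast
qed

lemma asymptotic_equiv:
  assumes "Metric_space X d"
  shows "equiv (morse_rays X d e) (asymptotic X d e)"
proof -
  interpret Metric_space X d by (rule assms)
  have inX: "\<alpha> s \<in> X" if "\<alpha> \<in> morse_rays X d e" "0 \<le> s" for \<alpha> s
    using that by (auto simp: morse_rays_def morse_rays_of_gauge_def quasi_geodesic_def)
  show ?thesis
  proof (rule equivI)
    show "asymptotic X d e \<subseteq> morse_rays X d e \<times> morse_rays X d e" by (auto simp: asymptotic_def)
    show "refl_on (morse_rays X d e) (asymptotic X d e)"
    proof (rule refl_onI)
      fix \<alpha> assume a: "\<alpha> \<in> morse_rays X d e"
      then have "\<And>s. 0 \<le> s \<Longrightarrow> d (\<alpha> s) (\<alpha> s) \<le> 0" using inX by simp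
      then show "(\<alpha>, \<alpha>) \<in> asymptotic X d e" using a unfolding asymptotic_def by blast
    qed
    show "sym (asymptotic X d e)"
      by (rule symI) (auto simp: asymptotic_def commute)
    show "trans (asymptotic X d e)"
    proof (rule transI)
      fix \<alpha> \<beta> \<gamma> assume ab: "(\<alpha>, \<beta>) \<in> asymptotic X d e" and bc: "(\<beta>, \<gamma>) \<in> asymptotic X d e"
      obtain D where D: "\<forall>s\<ge>0. \<exists>t\<ge>0. d (\<alpha> s) (\<beta> t) \<le> D" "\<forall>t\<ge>0. \<exists>s\<ge>0. d (\<alpha> s) (\<beta> t) \<le> D"
        using ab unfolding asymptotic_def by blast
      obtain D' where D': "\<forall>s\<ge>0. \<exists>t\<ge>0. d (\<beta> s) (\<gamma> t) \<le> D'" "\<forall>t\<ge>0. \<exists>s\<ge>0. d (\<beta> s) (\<gamma> t) \<le> D'"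
        using bc unfolding asymptotic_def by blast
      have R: "\<alpha> \<in> morse_rays X d e" "\<beta> \<in> morse_rays X d e" "\<gamma> \<in> morse_rays X d e"
        using ab bc by (auto simp: asymptotic_def)
      have tri: "d (\<alpha> s) (\<gamma> u) \<le> D + D'" if "0 \<le> s" "0 \<le> t" "0 \<le> u" "d (\<alpha> s) (\<beta> t) \<le> D" "d (\<beta> t) (\<gamma> u) \<le> D'" for s t u
        using triangle[OF inX[OF R(1)] inX[OF R(2)] inX[OF R(3)], of s t u] that by linarith
      have "\<exists>u\<ge>0. d (\<alpha> s) (\<gamma> u) \<le> D + D'" if s: "0 \<le> s" for s
      proof -
        obtain t where t: "0 \<le> t" "d (\<alpha> s) (\<beta> t) \<le> D" using D(1) s by blast
        obtain u where u: "0 \<le> u" "d (\<beta> t) (\<gamma> u) \<le> D'" using D'(1) t by blast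
        show ?thesis using tri[OF s t(1) u(1) t(2) u(2)] u by blast
      qed
      moreover have "\<exists>s\<ge>0. d (\<alpha> s) (\<gamma> u) \<le> D + D'" if u: "0 \<le> u" for u
      proof -
        obtain t where t: "0 \<le> t" "d (\<beta> t) (\<gamma> u) \<le> D'" using D'(2) u by blast
        obtain s where s: "0 \<le> s" "d (\<alpha> s) (\<beta> t) \<le> D" using D(2) t by blast
        show ?thesis using tri[OF s(1) t(1) u s(2) t(2)] s by blast
      qed
      ultimately show "(\<alpha>, \<gamma>) \<in> asymptotic X d e" using R unfolding asymptotic_def by blast
    qed
  qed
qed

context discrete_geodesic_space
begin

definition stable_at :: "nat \<Rightarrow> nat \<Rightarrow> (nat \<Rightarrow> 'a) \<Rightarrow> bool" where
  "stable_at c K v \<longleftrightarrow> (\<forall>s t p m. s \<le> t \<and> qg c p m \<and> p 0 = v s \<and> p m = v t \<longrightarrow>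
     (\<forall>i\<le>m. \<exists>j\<in>{s..t}. d (p i) (v j) \<le> K))"

lemma stable_at_mono: "stable_at c K v \<Longrightarrow> K \<le> K' \<Longrightarrow> stable_at c K' v"
  unfolding stable_at_def by (meson order_trans)

lemma stable_of_stable_at: "geod v n \<Longrightarrow> (\<And>c. stable_at c (D c) v) \<Longrightarrow> stable D v n"
  unfolding stable_def stable_at_def by blast

text \<open>
  The ray \<open>w\<close> follows \<open>v\<close> up to its projection of \<open>v T\<close>, which is far out because \<open>w\<close> comes within
  \<open>K\<close> of \<open>v T\<close>; the resulting bound is independent of \<open>K\<close>.
\<close>

lemma stable_ray_fellow_travel:
  assumes v: "\<And>n. stable D v n" and w: "\<And>n. geod w n" and 0: "w 0 = v 0"
    and K: "\<And>i. \<exists>j. d (v i) (w j) \<le> K"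
  shows "d (w t) (v t) \<le> 2 * D 0"
proof -
  have vg: "geod v n" for n using v by (simp add: stable_def)
  have X: "v i \<in> X" "w i \<in> X" for i using vg[of i] w[of i] by (auto simp: geod_def)
  define T where "T = t + K"
  obtain j where j: "d (v T) (w j) \<le> K" using K by blast
  define n where "n = max j t"
  obtain k where k: "k \<le> n" "\<And>i. i \<le> n \<Longrightarrow> d (v T) (w k) \<le> d (v T) (w i)" using closest_exists by blast
  have "d (v T) (w k) \<le> K" using k(2)[of j] j by (simp add: n_def)
  moreover have "d (v 0) (v T) \<le> d (v 0) (w k) + d (w k) (v T)" using d_tri X by blast
  moreover have "d (v 0) (v T) = T" "d (v 0) (w k) = k"
    using geod_d[OF vg, of 0 T T] geod_d[OF w, of 0 k k] 0 by auto
  ultimately have "t \<le> k" using d_sym[OF X(1)[of T] X(2)[of k]] by (simp add: T_def)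
  then obtain i where i: "i \<le> T" "d (w t) (v i) \<le> D (4 * 0 + 4 * 0)"
    using project_near[OF v[of T] w[of n] X(1)[of T] k, of 0 0 t] 0 X by auto
  have "t \<le> i + D 0 + 0" "i \<le> t + D 0 + 0"
    using geod_close_index[OF w[of t] vg[of i], of t i 0 "D 0"] i 0 X by auto
  moreover have "d (w t) (v t) \<le> d (w t) (v i) + d (v i) (v t)" using d_tri X by blast
  moreover have "d (v i) (v t) = (t - i) + (i - t)" using geod_d'[OF vg, of i "max i t" t] by simp
  ultimately show ?thesis using i(2) by simp
qed

lemma stable_at_of_fellow_travel:
  assumes v: "\<And>n. stable D v n" and w: "\<And>n. geod w n" and E: "\<And>t. d (w t) (v t) \<le> E"
  shows "stable_at c (D (c + 4 * E + 4 * E) + E) w"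
  unfolding stable_at_def
proof (intro allI impI)
  fix s t p m i
  assume a: "s \<le> t \<and> qg c p m \<and> p 0 = w s \<and> p m = w t" and i: "i \<le> m"
  have X: "v i \<in> X" "w i \<in> X" for i using v[of i] w[of i] by (auto simp: stable_def geod_def)
  have st: "s \<le> t" and p: "qg c p m" using a by auto
  have e: "d (p 0) (v s) \<le> E" "d (p m) (v t) \<le> E" using a E by auto
  obtain j where j: "min s t \<le> j" "j \<le> max s t" "d (p i) (v j) \<le> D (c + 4 * E + 4 * E)"
    using stable_near[OF v[of t] p st le_refl e i] by blast
  have "d (p i) (w j) \<le> d (p i) (v j) + d (v j) (w j)" using d_tri X qg_in[OF p i] by blast
  then have "d (p i) (w j) \<le> D (c + 4 * E + 4 * E) + E" using j(3) E[of j] d_sym[OF X(1,2), of j j] by simp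
  then show "\<exists>j\<in>{s..t}. d (p i) (w j) \<le> D (c + 4 * E + 4 * E) + E" using j st by auto
qed

end

context cayley
begin

abbreviation "rays \<equiv> morse_rays cg cd (vertex \<one>)"
abbreviation "rays_of \<equiv> morse_rays_of_gauge cg cd (vertex \<one>)"
abbreviation "asy \<equiv> asymptotic cg cd (vertex \<one>)"
abbreviation "bdry \<equiv> morse_boundary cg cd (vertex \<one>)"
abbreviation "bdry_set \<equiv> morse_boundary_set cg cd (vertex \<one>)"
abbreviation "strat \<equiv> morse_stratum cg cd (vertex \<one>)"
abbreviation "strat_set \<equiv> morse_stratum_set cg cd (vertex \<one>)"
abbreviation "ray_top \<equiv> ray_topology cg cd (vertex \<one>)"

lemma rays_of_rays: "morse_gauge M \<Longrightarrow> \<gamma> \<in> rays_of M \<Longrightarrow> \<gamma> \<in> rays"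
  by (auto simp: morse_rays_def)

lemma ray_geodesic: "\<gamma> \<in> rays \<Longrightarrow> geodesic cg cd {0..} \<gamma> \<and> \<gamma> 0 = vertex \<one>"
  by (auto simp: morse_rays_def morse_rays_of_gauge_def)

lemma ray_vertices:
  assumes "geodesic cg cd {0..} \<gamma>" "\<gamma> 0 = vertex \<one>"
  shows "geod (vertices \<gamma>) n" "vertices \<gamma> 0 = \<one>" "\<gamma> (real i) = vertex (vertices \<gamma> i)"
    "0 \<le> t \<Longrightarrow> \<gamma> t = interpolate (vertices \<gamma>) t"
proof -
  note r = geodesic_rigid[OF assms(1) _ one_closed assms(2)]
  show "geod (vertices \<gamma>) n" using r(1)[of n] by auto
  show "vertices \<gamma> 0 = \<one>" using r(2)[of 0] by auto
  show "\<gamma> (real i) = vertex (vertices \<gamma> i)" using r(3)[of i i] by auto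
  assume t: "0 \<le> t"
  obtain n where n: "t \<le> real n" using real_arch_simple by blast
  have "{0..real n} \<subseteq> {0..}" by auto
  then show "\<gamma> t = interpolate (vertices \<gamma>) t" using r(4)[of n t] t n by auto
qed

text \<open>
  The constant for which vertices along an \<open>M\<close>-Morse ray are stable, see \<open>stable_of_morse\<close>.
\<close>

definition gauge_bound :: "(real \<Rightarrow> real \<Rightarrow> real) \<Rightarrow> nat \<Rightarrow> nat" where
  "gauge_bound M c = nat \<lceil>M 3 (real c + 2)\<rceil> + 1"

lemma ray_stable:
  assumes "\<gamma> \<in> rays_of M"
  shows "stable (gauge_bound M) (vertices \<gamma>) n"
proof -
  have g: "geodesic cg cd {0..} \<gamma>" "\<gamma> 0 = vertex \<one>" "is_morse cg cd M {0..} \<gamma>"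
    using assms by (auto simp: morse_rays_of_gauge_def)
  show ?thesis using stable_of_morse[OF g(1,2) one_closed g(3)] unfolding gauge_bound_def .
qed

lemma asymptotic_fellow_travel:
  assumes \<alpha>: "\<alpha> \<in> rays_of M" and as: "(\<alpha>, \<gamma>) \<in> asy"
  shows "wd (vertices \<gamma> t) (vertices \<alpha> t) \<le> 2 * gauge_bound M 0"
proof -
  have R: "\<alpha> \<in> rays" "\<gamma> \<in> rays" using as by (auto simp: asymptotic_def)
  note ra = ray_vertices[OF ray_geodesic[OF R(1), THEN conjunct1] ray_geodesic[OF R(1), THEN conjunct2]]
  note rg = ray_vertices[OF ray_geodesic[OF R(2), THEN conjunct1] ray_geodesic[OF R(2), THEN conjunct2]]
  obtain D where D: "\<forall>s\<ge>0. \<exists>t\<ge>0. cd (\<alpha> s) (\<gamma> t) \<le> D" using as unfolding asymptotic_def by blast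
  have D0: "0 \<le> D" using D M.nonneg by (meson order_refl order_trans)
  show ?thesis
  proof (rule stable_ray_fellow_travel[OF ray_stable[OF \<alpha>] rg(1)])
    show "vertices \<gamma> 0 = vertices \<alpha> 0" using ra(2) rg(2) by simp
    fix i
    obtain t where t: "0 \<le> t" "cd (\<alpha> (real i)) (\<gamma> t) \<le> D" using D by (meson of_nat_0_le_iff)
    define j where "j = nat \<lfloor>t\<rfloor>"
    have jt: "\<bar>t - real j\<bar> \<le> 1" using t(1) unfolding j_def by linarith
    have gg: "geodesic cg cd {0..} \<gamma>" using ray_geodesic[OF R(2)] by blast
    have "cd (\<gamma> t) (\<gamma> (real j)) \<le> 1" using geodesic_d[OF gg, of t "real j"] t(1) jt by simp
    moreover have X: "vertices \<alpha> i \<in> carrier G" "vertices \<gamma> j \<in> carrier G"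
      using ra(1)[of i] rg(1)[of j] by (auto simp: geod_def)
    moreover have "\<gamma> t \<in> cg" using gg t(1) unfolding quasi_geodesic_def by auto
    ultimately have "cd (vertex (vertices \<alpha> i)) (vertex (vertices \<gamma> j)) \<le> D + 1"
      using M.triangle[of "vertex (vertices \<alpha> i)" "\<gamma> t" "vertex (vertices \<gamma> j)"] t(2) ra(3)[of i] rg(3)[of j] by simp
    then have "real (wd (vertices \<alpha> i) (vertices \<gamma> j)) \<le> D + 1" using cd_vertex[OF X] by simp
    then have "wd (vertices \<alpha> i) (vertices \<gamma> j) \<le> nat \<lceil>D + 1\<rceil>" by linarith
    then show "\<exists>j. wd (vertices \<alpha> i) (vertices \<gamma> j) \<le> nat \<lceil>D + 1\<rceil>" by blast
  qed
qed

text \<open>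
  The argument \<open>c + 16 * gauge_bound M 0\<close> accounts for detours of length \<open>2 * gauge_bound M 0\<close> at
  both ends of a path.
\<close>

definition class_bound :: "(real \<Rightarrow> real \<Rightarrow> real) \<Rightarrow> nat \<Rightarrow> nat" where
  "class_bound M c = gauge_bound M (c + 16 * gauge_bound M 0) + 2 * gauge_bound M 0"

text \<open>
  All rays in the class of an \<open>M\<close>-Morse ray are stable with constants depending on \<open>M\<close> only.
  Therefore a class in the stratum of \<open>M\<close> cannot contain a ray of bad quality.
\<close>

lemma asymptotic_stable_at:
  assumes \<alpha>: "\<alpha> \<in> rays_of M" and as: "(\<alpha>, \<gamma>) \<in> asy"
  shows "stable_at c (class_bound M c) (vertices \<gamma>)"
proof -
  have R: "\<gamma> \<in> rays" using as by (auto simp: asymptotic_def)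
  have "geod (vertices \<gamma>) n" for n using ray_vertices(1) ray_geodesic[OF R] by blast
  from stable_at_of_fellow_travel[OF ray_stable[OF \<alpha>] this asymptotic_fellow_travel[OF \<alpha> as], of c]
  show ?thesis by (simp add: class_bound_def add.assoc)
qed

lemma fellow_travel_asymptotic:
  assumes R: "\<alpha> \<in> rays" "\<gamma> \<in> rays" and D: "\<And>t. wd (vertices \<gamma> t) (vertices \<alpha> t) \<le> D"
  shows "(\<alpha>, \<gamma>) \<in> asy"
proof -
  have ag: "geodesic cg cd {0..} \<alpha>" and gg: "geodesic cg cd {0..} \<gamma>" using ray_geodesic R by auto
  note ra = ray_vertices[OF ag ray_geodesic[OF R(1), THEN conjunct2]]
  note rg = ray_vertices[OF gg ray_geodesic[OF R(2), THEN conjunct2]]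
  have "cd (\<alpha> t) (\<gamma> t) \<le> real D + 2" if t: "0 \<le> t" for t
  proof -
    define j where "j = nat \<lfloor>t\<rfloor>"
    have jt: "\<bar>t - real j\<bar> \<le> 1" using t unfolding j_def by linarith
    have X: "\<alpha> t \<in> cg" "\<alpha> (real j) \<in> cg" "\<gamma> t \<in> cg" "\<gamma> (real j) \<in> cg"
      using ag gg t unfolding quasi_geodesic_def by auto
    have V: "vertices \<alpha> j \<in> carrier G" "vertices \<gamma> j \<in> carrier G"
      using ra(1)[of j] rg(1)[of j] by (auto simp: geod_def)
    have "cd (\<alpha> t) (\<alpha> (real j)) \<le> 1" "cd (\<gamma> (real j)) (\<gamma> t) \<le> 1"
      using geodesic_d[OF ag, of t "real j"] geodesic_d[OF gg, of "real j" t] t jt by (auto simp: abs_minus_commute)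
    moreover have "cd (\<alpha> (real j)) (\<gamma> (real j)) \<le> real D"
      using cd_vertex[OF V] D[of j] d_sym[OF V] ra(3)[of j] rg(3)[of j] by simp
    ultimately show ?thesis using M.triangle[OF X(1,2,3)] M.triangle[OF X(2,4,3)] by linarith
  qed
  then show ?thesis using R unfolding asymptotic_def by blast
qed

lemma asym_class_eq: "\<alpha> \<in> rays \<Longrightarrow> \<gamma> \<in> rays \<Longrightarrow> asy `` {\<alpha>} = asy `` {\<gamma>} \<longleftrightarrow> (\<alpha>, \<gamma>) \<in> asy"
  using eq_equiv_class_iff[OF asymptotic_equiv[OF M.Metric_space_axioms]] by blast

text \<open>
  Strata are \<open>T\<^sub>1\<close>: rays of the same gauge in the same class stay at uniformly bounded distance, so
  being in another class is detected at a single time, which is an open condition.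
\<close>

lemma open_other_class:
  assumes M: "morse_gauge M" and z: "z \<in> strat_set M"
  shows "openin (ray_top M) {\<gamma> \<in> rays_of M. asy `` {\<gamma>} \<noteq> z}"
proof -
  obtain \<alpha> where \<alpha>: "\<alpha> \<in> rays_of M" "z = asy `` {\<alpha>}" using z by (auto simp: morse_stratum_set_def)
  have \<alpha>R: "\<alpha> \<in> rays" using rays_of_rays[OF M \<alpha>(1)] .
  define V where "V t = {p \<in> cg. 2 * real (gauge_bound M 0) < cd (\<alpha> (real t)) p}" for t :: nat
  define S where "S t = {\<gamma> \<in> rays_of M. \<gamma> ` {real t} \<subseteq> V t}" for t :: nat
  have \<alpha>X: "\<alpha> (real t) \<in> cg" for t using ray_geodesic[OF \<alpha>R] unfolding quasi_geodesic_def by auto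
  have Vo: "openin M.mtopology (V t)" for t
  proof -
    have "V t = cg - M.mcball (\<alpha> (real t)) (2 * real (gauge_bound M 0))"
      using \<alpha>X by (auto simp: V_def M.mcball_def)
    then show ?thesis using M.closedin_mcball by (simp add: openin_diff)
  qed
  have So: "openin (ray_top M) (S t)" for t
    unfolding ray_topology_def S_def
    by (rule topology_generated_by_Basis, rule CollectI, rule exI[of _ "{real t}"], rule exI[of _ "V t"])
      (use Vo in auto)
  have dist: "cd (\<alpha> (real t)) (\<gamma> (real t)) = wd (vertices \<gamma> t) (vertices \<alpha> t)" if "\<gamma> \<in> rays" for \<gamma> t
  proof -
    have "vertices \<alpha> t \<in> carrier G" "vertices \<gamma> t \<in> carrier G"
      using ray_vertices(1)[of \<alpha> t] ray_vertices(1)[of \<gamma> t] ray_geodesic[OF \<alpha>R] ray_geodesic[OF that]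
      by (auto simp: geod_def)
    then show ?thesis using ray_vertices(3)[of \<alpha> t] ray_vertices(3)[of \<gamma> t] ray_geodesic[OF \<alpha>R] ray_geodesic[OF that]
      cd_vertex d_sym by auto
  qed
  have "{\<gamma> \<in> rays_of M. asy `` {\<gamma>} \<noteq> z} = (\<Union>t. S t)"
  proof (rule equalityI; rule subsetI)
    fix \<gamma> assume "\<gamma> \<in> {\<gamma> \<in> rays_of M. asy `` {\<gamma>} \<noteq> z}"
    then have g: "\<gamma> \<in> rays_of M" "asy `` {\<alpha>} \<noteq> asy `` {\<gamma>}" using \<alpha>(2) by auto
    have gR: "\<gamma> \<in> rays" using rays_of_rays[OF M g(1)] .
    have "(\<alpha>, \<gamma>) \<notin> asy" using g(2) asym_class_eq[OF \<alpha>R gR] by blast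
    then obtain t where "\<not> wd (vertices \<gamma> t) (vertices \<alpha> t) \<le> 2 * gauge_bound M 0"
      using fellow_travel_asymptotic[OF \<alpha>R gR] by blast
    then have "2 * real (gauge_bound M 0) < cd (\<alpha> (real t)) (\<gamma> (real t))" unfolding dist[OF gR] by linarith
    moreover have "\<gamma> (real t) \<in> cg" using ray_geodesic[OF gR] unfolding quasi_geodesic_def by auto
    ultimately show "\<gamma> \<in> (\<Union>t. S t)" using g(1) by (auto simp: S_def V_def)
  next
    fix \<gamma> assume "\<gamma> \<in> (\<Union>t. S t)"
    then obtain t where g: "\<gamma> \<in> rays_of M" "2 * real (gauge_bound M 0) < cd (\<alpha> (real t)) (\<gamma> (real t))"
      by (auto simp: S_def V_def)
    have gR: "\<gamma> \<in> rays" using rays_of_rays[OF M g(1)] .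
    have "(\<alpha>, \<gamma>) \<notin> asy"
    proof
      assume "(\<alpha>, \<gamma>) \<in> asy"
      from asymptotic_fellow_travel[OF \<alpha>(1) this, of t] g(2) show False unfolding dist[OF gR] by linarith
    qed
    then show "\<gamma> \<in> {\<gamma> \<in> rays_of M. asy `` {\<gamma>} \<noteq> z}" using g(1) \<alpha>(2) asym_class_eq[OF \<alpha>R gR] by auto
  qed
  then show ?thesis using So by auto
qed

lemma open_avoiding_finite:
  assumes M: "morse_gauge M" and F: "finite F" "F \<subseteq> strat_set M"
  shows "openin (strat M) (strat_set M - F)"
  unfolding openin_morse_stratum
proof (intro conjI Diff_subset)
  have "{\<gamma> \<in> rays_of M. asy `` {\<gamma>} \<in> strat_set M - F} = {\<gamma> \<in> rays_of M. asy `` {\<gamma>} \<notin> F}"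
    by (auto simp: morse_stratum_set_def)
  moreover have "openin (ray_top M) {\<gamma> \<in> rays_of M. asy `` {\<gamma>} \<notin> F}"
    using F
  proof (induction F rule: finite_induct)
    case empty
    then show ?case using openin_topspace[of "ray_top M"] by (simp add: topspace_ray_topology)
  next
    case (insert z F)
    have "{\<gamma> \<in> rays_of M. asy `` {\<gamma>} \<notin> insert z F} =
        {\<gamma> \<in> rays_of M. asy `` {\<gamma>} \<noteq> z} \<inter> {\<gamma> \<in> rays_of M. asy `` {\<gamma>} \<notin> F}" by auto
    then show ?case using insert open_other_class[OF M, of z] by (simp add: openin_Int)
  qed
  ultimately show "openin (ray_top M)
     {\<gamma> \<in> rays_of M. asy `` {\<gamma>} \<in> strat_set M - F}" by simp
qed

lemma boundary_member:
  assumes "z \<in> bdry_set"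
  obtains \<alpha> M where "morse_gauge M" "\<alpha> \<in> rays_of M" "z = asy `` {\<alpha>}"
  using assms unfolding morse_boundary_set_def quotient_def morse_rays_def by blast

text \<open>
  Otherwise the classes \<open>f (xs n)\<close> contain rays that get worse and worse, so only finitely many of
  these classes lie in any given stratum. Apart from \<open>f x\<close> they therefore form a closed set in the direct
  limit topology, and by continuity almost all of them equal \<open>f x\<close>. But the rays in the single class
  \<open>f x\<close> are uniformly stable.
\<close>

lemma bound_along_convergent_sequence:
  assumes f: "continuous_map Y (bdry) f"
    and x: "x \<in> topspace Y" and xs: "\<And>n. xs n \<in> topspace Y"
    and lim: "\<And>V. openin Y V \<Longrightarrow> x \<in> V \<Longrightarrow> \<exists>J. \<forall>n\<ge>J. xs n \<in> V"
  shows "\<exists>n. \<forall>\<gamma>\<in>f (xs n). stable_at c n (vertices \<gamma>)"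
proof (rule ccontr)
  assume "\<not> ?thesis"
  then obtain \<gamma> where \<gamma>: "\<And>n. \<gamma> n \<in> f (xs n)" "\<And>n. \<not> stable_at c n (vertices (\<gamma> n))" by metis
  have small: "n < class_bound M c" if "\<alpha> \<in> rays_of M" "f (xs n) = asy `` {\<alpha>}" for n \<alpha> M
  proof (rule ccontr)
    assume "\<not> ?thesis"
    moreover have "(\<alpha>, \<gamma> n) \<in> asy" using \<gamma>(1)[of n] that by simp
    ultimately show False using asymptotic_stable_at[OF that(1), of "\<gamma> n" c] stable_at_mono \<gamma>(2)[of n]
      by (meson not_less)
  qed
  have fX: "f y \<in> bdry_set" if "y \<in> topspace Y" for y
    using continuous_map_image_subset_topspace[OF f] that by (auto simp: topspace_morse_boundary)
  define C where "C = range (\<lambda>n. f (xs n)) - {f x}"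
  define U where "U = bdry_set - C"
  have "openin (bdry) U"
    unfolding openin_morse_boundary
  proof (intro conjI allI impI)
    show "U \<subseteq> bdry_set" by (auto simp: U_def)
    fix M :: "real \<Rightarrow> real \<Rightarrow> real" assume M: "morse_gauge M"
    let ?S = "strat_set M"
    have "C \<inter> ?S \<subseteq> (\<lambda>n. f (xs n)) ` {..<class_bound M c}"
      using small by (auto simp: C_def morse_stratum_set_def)
    then have "finite (C \<inter> ?S)" by (rule finite_subset) simp
    then have "openin (strat M) (?S - C \<inter> ?S)" using open_avoiding_finite[OF M] by blast
    moreover have "?S \<subseteq> bdry_set"
      using rays_of_rays[OF M] by (auto simp: morse_stratum_set_def morse_boundary_set_def intro!: quotientI)
    then have "U \<inter> ?S = ?S - C \<inter> ?S" by (auto simp: U_def)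
    ultimately show "openin (strat M) (U \<inter> ?S)" by simp
  qed
  then have "openin Y {y \<in> topspace Y. f y \<in> U}" using f by (simp add: continuous_map_def)
  moreover have "x \<in> {y \<in> topspace Y. f y \<in> U}" using x fX[OF x] by (simp add: U_def C_def)
  ultimately obtain J where J: "\<And>n. n \<ge> J \<Longrightarrow> f (xs n) \<in> U" using lim by blast
  then have same: "f (xs n) = f x" if "n \<ge> J" for n using that by (auto simp: U_def C_def)
  obtain \<alpha> M where \<alpha>: "morse_gauge M" "\<alpha> \<in> rays_of M" "f x = asy `` {\<alpha>}" using boundary_member[OF fX[OF x]] .
  have "max J (class_bound M c) < class_bound M c"
    using small[OF \<alpha>(2), of "max J (class_bound M c)"] same[of "max J (class_bound M c)"] \<alpha>(3) by simp
  then show False by simp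
qed

lemma geodesics_subconverge:
  assumes v: "\<And>j. geod (v j) (n j)" "\<And>j. v j 0 = \<one>" and n: "\<And>N. \<exists>J. \<forall>j\<ge>J. N \<le> n j"
  shows "\<exists>r \<rho>. strict_mono (r :: nat \<Rightarrow> nat) \<and> (\<forall>m. geod \<rho> m) \<and> \<rho> 0 = \<one> \<and>
    (\<forall>T. \<exists>J. \<forall>j\<ge>J. T \<le> n (r j) \<and> (\<forall>i\<le>T. v (r j) i = \<rho> i))"
proof -
  have "finite (range (\<lambda>j. v j (min i (n j))))" for i
  proof (rule finite_subset[OF _ finite_ball[of i]], rule subsetI)
    fix y assume "y \<in> range (\<lambda>j. v j (min i (n j)))"
    then obtain j where y: "y = v j (min i (n j))" by blast
    have "wd (v j 0) y = min i (n j)" unfolding y using geod_d[OF v(1), of 0 "min i (n j)" j] by simp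
    moreover have "y \<in> carrier G" unfolding y using v(1)[of j] by (simp add: geod_def)
    ultimately show "y \<in> {x \<in> carrier G. wd \<one> x \<le> i}" using v(2) by simp
  qed
  then obtain r \<rho> where r: "strict_mono (r :: nat \<Rightarrow> nat)"
    and \<rho>: "\<And>T. \<exists>J. \<forall>j\<ge>J. \<forall>i\<le>T. v (r j) (min i (n (r j))) = \<rho> i"
    using eventually_constant_subsequence[of "\<lambda>j i. v j (min i (n j))"] by blast
  have conv: "\<exists>J. \<forall>j\<ge>J. T \<le> n (r j) \<and> (\<forall>i\<le>T. v (r j) i = \<rho> i)" for T
  proof -
    obtain J where J: "\<forall>j\<ge>J. \<forall>i\<le>T. v (r j) (min i (n (r j))) = \<rho> i" using \<rho> by blast
    obtain J' where J': "\<forall>j\<ge>J'. T \<le> n j" using n by blast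
    have "T \<le> n (r j) \<and> (\<forall>i\<le>T. v (r j) i = \<rho> i)" if "max J J' \<le> j" for j
    proof -
      have "J' \<le> r j" using that strict_mono_imp_increasing[OF r, of j] by simp
      then have T: "T \<le> n (r j)" using J' by blast
      moreover have "v (r j) i = \<rho> i" if "i \<le> T" for i
        using J \<open>max J J' \<le> j\<close> that T by (metis max.bounded_iff min.absorb1 order_trans)
      ultimately show ?thesis by blast
    qed
    then show ?thesis by blast
  qed
  have "geod \<rho> m" for m
  proof -
    obtain J where J: "\<forall>j\<ge>J. m \<le> n (r j) \<and> (\<forall>i\<le>m. v (r j) i = \<rho> i)" using conv by blast
    then have "geod (v (r J)) m" using v(1)[of "r J"] geod_prefix by blast
    moreover have "\<And>i. i \<le> m \<Longrightarrow> v (r J) i = \<rho> i" using J by blast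
    ultimately show ?thesis unfolding geod_def by auto
  qed
  moreover have "\<rho> 0 = \<one>" using conv[of 0] v(2) by auto
  ultimately show ?thesis using r conv by blast
qed

lemma interpolate_cong:
  assumes "\<And>i. i \<le> m \<Longrightarrow> v i = w i" "0 \<le> t" "t < real m"
  shows "interpolate v t = interpolate w t"
proof -
  have "Suc (nat \<lfloor>t\<rfloor>) \<le> m" using assms(2,3) by linarith
  then show ?thesis unfolding interpolate_def using assms(1)[of "nat \<lfloor>t\<rfloor>"] assms(1)[of "Suc (nat \<lfloor>t\<rfloor>)"] by simp
qed

text \<open>
  The restriction makes the ray extensional, as rays in the Morse boundary are.
\<close>

definition ray_of :: "(nat \<Rightarrow> 'a) \<Rightarrow> real \<Rightarrow> 'a \<Rightarrow> real" where
  "ray_of \<rho> = restrict (interpolate \<rho>) {0..}"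

lemma ray_of_in:
  assumes N: "\<And>I \<gamma>. geodesic cg cd I \<gamma> \<Longrightarrow> is_morse cg cd N I \<gamma>" and \<rho>: "\<And>m. geod \<rho> m" "\<rho> 0 = \<one>"
  shows "ray_of \<rho> \<in> rays_of N"
proof -
  have "geodesic cg cd {0..} (interpolate \<rho>)" by (rule interpolate_ray[OF \<rho>(1)])
  then have g: "geodesic cg cd {0..} (ray_of \<rho>)"
    unfolding quasi_geodesic_def ray_of_def by (auto simp: Pi_iff)
  moreover have "ray_of \<rho> 0 = vertex \<one>" using interpolate_nat[of \<rho> 0] \<rho>(2) by (simp add: ray_of_def)
  moreover have "ray_of \<rho> \<in> extensional {0..}" by (simp add: ray_of_def)
  ultimately show ?thesis using N by (simp add: morse_rays_of_gauge_def)
qed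

text \<open>
  Representatives may be chosen with the common gauge \<open>N\<close>. A subsequence of them agrees with a limit
  ray on longer and longer segments, hence converges in the compact-open topology of the
  stratum of \<open>N\<close>, and a fortiori in the direct limit.
\<close>

lemma boundary_sequentially_compact:
  assumes N: "morse_gauge N" "\<And>I \<gamma>. geodesic cg cd I \<gamma> \<Longrightarrow> is_morse cg cd N I \<gamma>"
    and xs: "\<And>n. xs n \<in> topspace (bdry)"
  shows "\<exists>r x. strict_mono (r :: nat \<Rightarrow> nat) \<and> x \<in> topspace (bdry) \<and>
    (\<forall>V. openin (bdry) V \<and> x \<in> V \<longrightarrow> (\<exists>J. \<forall>n\<ge>J. xs (r n) \<in> V))"
proof -
  have "\<exists>\<beta>. \<beta> \<in> rays_of N \<and> xs n = asy `` {\<beta>}" for n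
  proof -
    obtain \<alpha> M where \<alpha>: "\<alpha> \<in> rays_of M" "xs n = asy `` {\<alpha>}"
      using boundary_member xs[of n] unfolding topspace_morse_boundary by metis
    then have "\<alpha> \<in> rays_of N" using N(2) by (auto simp: morse_rays_of_gauge_def)
    then show ?thesis using \<alpha> by blast
  qed
  then obtain \<beta> where \<beta>: "\<And>n. \<beta> n \<in> rays_of N" "\<And>n. xs n = asy `` {\<beta> n}" by metis
  have \<beta>g: "geodesic cg cd {0..} (\<beta> n)" "\<beta> n 0 = vertex \<one>" for n
    using \<beta>(1)[of n] by (auto simp: morse_rays_of_gauge_def)
  note rv = ray_vertices[OF \<beta>g]
  obtain r \<rho> where r: "strict_mono (r :: nat \<Rightarrow> nat)" and \<rho>: "\<And>m. geod \<rho> m" "\<rho> 0 = \<one>"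
    and conv: "\<And>T. \<exists>J. \<forall>j\<ge>J. T \<le> r j \<and> (\<forall>i\<le>T. vertices (\<beta> (r j)) i = \<rho> i)"
    using geodesics_subconverge[of "\<lambda>j. vertices (\<beta> j)" "\<lambda>j. j"] rv(1,2) by blast
  define b where "b = ray_of \<rho>"
  have b: "b \<in> rays_of N" unfolding b_def by (rule ray_of_in[OF N(2) \<rho>])
  have agree: "\<exists>J. \<forall>j\<ge>J. \<forall>t. 0 \<le> t \<and> t \<le> T \<longrightarrow> \<beta> (r j) t = b t" for T
  proof -
    define m where "m = nat \<lceil>T\<rceil> + 1"
    obtain J where J: "\<forall>j\<ge>J. m \<le> r j \<and> (\<forall>i\<le>m. vertices (\<beta> (r j)) i = \<rho> i)" using conv by blast
    have "\<beta> (r j) t = b t" if j: "J \<le> j" and t: "0 \<le> t" "t \<le> T" for j t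
    proof -
      have "t < real m" using t unfolding m_def by linarith
      then have "interpolate (vertices (\<beta> (r j))) t = interpolate \<rho> t"
        using interpolate_cong[of m "vertices (\<beta> (r j))" \<rho> t] J j t(1) by blast
      then show ?thesis using rv(4)[OF t(1), of "r j"] t(1) by (simp add: b_def ray_of_def)
    qed
    then show ?thesis by blast
  qed
  have ray_lim: "\<exists>J. \<forall>n\<ge>J. \<beta> (r n) \<in> W" if W: "openin (ray_top N) W" "b \<in> W" for W
  proof -
    have "generate_topology_on {{\<gamma> \<in> rays_of N. \<gamma> ` K \<subseteq> U} | K U.
        compact K \<and> K \<subseteq> {0..} \<and> openin M.mtopology U} W"
      using W(1) unfolding ray_topology_def openin_topology_generated_by_iff .
    then show ?thesis using W(2)
    proof (induction rule: generate_topology_on.induct)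
      case (Int A B)
      then obtain J J' where "\<forall>n\<ge>J. \<beta> (r n) \<in> A" "\<forall>n\<ge>J'. \<beta> (r n) \<in> B" by blast
      then show ?case by (intro exI[of _ "max J J'"]) auto
    next
      case (UN K)
      then show ?case by blast
    next
      case (Basis S)
      then obtain K U where S: "S = {\<gamma> \<in> rays_of N. \<gamma> ` K \<subseteq> U}" "compact K" "K \<subseteq> {0..}" by blast
      then obtain T where T: "\<And>t. t \<in> K \<Longrightarrow> t \<le> T"
        using bounded_imp_bdd_above[OF compact_imp_bounded[OF S(2)]] by (auto simp: bdd_above_def)
      obtain J where J: "\<forall>j\<ge>J. \<forall>t. 0 \<le> t \<and> t \<le> T \<longrightarrow> \<beta> (r j) t = b t" using agree by blast
      have "\<beta> (r j) \<in> S" if "J \<le> j" for j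
      proof -
        have "\<beta> (r j) ` K = b ` K" using J that T S(3) by (intro image_cong) auto
        then show ?thesis using Basis(2) \<beta>(1) unfolding S(1) by simp
      qed
      then show ?case by blast
    qed simp
  qed
  show ?thesis
  proof (intro exI[of _ r] exI[of _ "asy `` {b}"] conjI allI impI)
    show "strict_mono r" by fact
    show "asy `` {b} \<in> topspace (bdry)"
      using rays_of_rays[OF N(1) b] by (simp add: topspace_morse_boundary morse_boundary_set_def quotientI)
    fix V assume V: "openin (bdry) V \<and> asy `` {b} \<in> V"
    let ?S = "strat_set N"
    have "openin (strat N) (V \<inter> ?S)"
      using V N(1) unfolding openin_morse_boundary by blast
    then have "openin (ray_top N) {\<gamma> \<in> rays_of N. asy `` {\<gamma>} \<in> V \<inter> ?S}"
      unfolding openin_morse_stratum by blast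
    moreover have "b \<in> {\<gamma> \<in> rays_of N. asy `` {\<gamma>} \<in> V \<inter> ?S}" using b V by (auto simp: morse_stratum_set_def)
    ultimately obtain J where "\<forall>n\<ge>J. \<beta> (r n) \<in> {\<gamma> \<in> rays_of N. asy `` {\<gamma>} \<in> V \<inter> ?S}" using ray_lim by blast
    then show "\<exists>J. \<forall>n\<ge>J. xs (r n) \<in> V" using \<beta>(2) by auto
  qed
qed

end

section \<open>Cannon--Thurston maps of normal hyperbolic subgroups\<close>

lemma cayleyI: "group G \<Longrightarrow> finite_symmetric_generating_set G A \<Longrightarrow> cayley G A"
  by (intro cayley.intro cayley_axioms.intro)

context cayley
begin

lemma geodesic_choice_vertices:
  assumes geo: "geodesic_choice G A geo" and g: "g \<in> carrier G"
  shows "geod (vertices (geo g)) (wd \<one> g)" "vertices (geo g) 0 = \<one>" "vertices (geo g) (wd \<one> g) = g"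
    "\<And>i. i \<le> wd \<one> g \<Longrightarrow> geo g (real i) = vertex (vertices (geo g) i)"
    "\<And>t. 0 \<le> t \<Longrightarrow> t \<le> real (wd \<one> g) \<Longrightarrow> geo g t = interpolate (vertices (geo g)) t"
proof -
  have e: "cd (vertex \<one>) (vertex g) = real (wd \<one> g)" using cd_vertex g by simp
  have b: "geodesic cg cd {0..real (wd \<one> g)} (geo g)" "geo g 0 = vertex \<one>" "geo g (real (wd \<one> g)) = vertex g"
    using geo g unfolding geodesic_choice_def geodesic_between_def e[symmetric] by auto
  note r = geodesic_rigid[OF b(1) order_refl one_closed b(2)]
  show "geod (vertices (geo g)) (wd \<one> g)" "vertices (geo g) 0 = \<one>" by (rule r(1), rule r(2))
  show v: "\<And>i. i \<le> wd \<one> g \<Longrightarrow> geo g (real i) = vertex (vertices (geo g) i)" by (rule r(3))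
  show "vertices (geo g) (wd \<one> g) = g" using v[of "wd \<one> g"] b(3) by simp
  show "\<And>t. 0 \<le> t \<Longrightarrow> t \<le> real (wd \<one> g) \<Longrightarrow> geo g t = interpolate (vertices (geo g)) t" using r(4) by simp
qed

lemma uniform_bound_on_compact_image:
  assumes f: "continuous_map Y (bdry) f"
    and compact: "\<And>xs. (\<And>n. xs n \<in> topspace Y) \<Longrightarrow> \<exists>r x. strict_mono (r :: nat \<Rightarrow> nat) \<and> x \<in> topspace Y \<and>
      (\<forall>V. openin Y V \<and> x \<in> V \<longrightarrow> (\<exists>J. \<forall>n\<ge>J. xs (r n) \<in> V))"
  shows "\<exists>D. \<forall>c. \<forall>x\<in>topspace Y. \<forall>\<gamma>\<in>f x. stable_at c (D c) (vertices \<gamma>)"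
proof -
  have "\<exists>n. \<forall>x\<in>topspace Y. \<forall>\<gamma>\<in>f x. stable_at c n (vertices \<gamma>)" for c
  proof (rule ccontr)
    assume "\<not> ?thesis"
    then have "\<forall>n. \<exists>x. x \<in> topspace Y \<and> (\<exists>\<gamma>\<in>f x. \<not> stable_at c n (vertices \<gamma>))" by blast
    from choice[OF this] obtain xs where xs: "\<And>n. xs n \<in> topspace Y"
      "\<And>n. \<exists>\<gamma>\<in>f (xs n). \<not> stable_at c n (vertices \<gamma>)" by blast
    have "\<exists>r x. strict_mono (r :: nat \<Rightarrow> nat) \<and> x \<in> topspace Y \<and>
      (\<forall>V. openin Y V \<and> x \<in> V \<longrightarrow> (\<exists>J. \<forall>n\<ge>J. xs (r n) \<in> V))" by (rule compact) (rule xs(1))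
    then obtain r x where r: "strict_mono (r :: nat \<Rightarrow> nat)" "x \<in> topspace Y"
      and lim: "\<forall>V. openin Y V \<and> x \<in> V \<longrightarrow> (\<exists>J. \<forall>n\<ge>J. xs (r n) \<in> V)" by (elim exE conjE)
    have "\<exists>n. \<forall>\<gamma>\<in>f (xs (r n)). stable_at c n (vertices \<gamma>)"
    proof (rule bound_along_convergent_sequence[OF f r(2)])
      show "xs (r n) \<in> topspace Y" for n by (rule xs(1))
      show "\<exists>J. \<forall>n\<ge>J. xs (r n) \<in> V" if "openin Y V" "x \<in> V" for V using lim that by simp
    qed
    then obtain n where n: "\<forall>\<gamma>\<in>f (xs (r n)). stable_at c n (vertices \<gamma>)" by (elim exE)
    have "n \<le> r n" using r(1) by (rule strict_mono_imp_increasing)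
    moreover obtain \<gamma> where "\<gamma> \<in> f (xs (r n))" "\<not> stable_at c (r n) (vertices \<gamma>)" using xs(2)[of "r n"] by (elim bexE)
    ultimately show False using n stable_at_mono[of c n "vertices \<gamma>" "r n"] by blast
  qed
  then have "\<forall>c. \<exists>n. \<forall>x\<in>topspace Y. \<forall>\<gamma>\<in>f x. stable_at c n (vertices \<gamma>)" by blast
  from choice[OF this] show ?thesis .
qed

lemma converging_subsequence:
  assumes geo: "geodesic_choice G A geo" and N: "morse_gauge N" "\<And>I \<gamma>. geodesic cg cd I \<gamma> \<Longrightarrow> is_morse cg cd N I \<gamma>"
    and h: "\<And>j. h j \<in> carrier G" "\<And>n. \<exists>J. \<forall>j\<ge>J. n \<le> wd \<one> (h j)"
  shows "\<exists>r x. strict_mono (r :: nat \<Rightarrow> nat) \<and> x \<in> topspace (bdry) \<and>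
    geodesics_converge G A geo (\<lambda>j. h (r j)) x"
proof -
  note gv = geodesic_choice_vertices[OF geo h(1)]
  obtain r \<rho> where r: "strict_mono (r :: nat \<Rightarrow> nat)" and \<rho>: "\<And>m. geod \<rho> m" "\<rho> 0 = \<one>"
    and conv: "\<And>T. \<exists>J. \<forall>j\<ge>J. T \<le> wd \<one> (h (r j)) \<and> (\<forall>i\<le>T. vertices (geo (h (r j))) i = \<rho> i)"
    using geodesics_subconverge[of "\<lambda>j. vertices (geo (h j))" "\<lambda>j. wd \<one> (h j)"] gv(1,2) h(2) by blast
  have b: "ray_of \<rho> \<in> rays_of N" by (rule ray_of_in[OF N(2) \<rho>])
  have bR: "ray_of \<rho> \<in> rays" using rays_of_rays[OF N(1) b] .
  have self: "ray_of \<rho> \<in> asy `` {ray_of \<rho>}" using equiv_class_self[OF asymptotic_equiv[OF M.Metric_space_axioms] bR] .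
  have "geodesics_converge G A geo (\<lambda>j. h (r j)) (asy `` {ray_of \<rho>})"
    unfolding geodesics_converge_def
  proof (intro bexI[OF _ self] allI impI)
    fix T \<epsilon> :: real assume T: "0 \<le> T" and \<epsilon>: "0 < \<epsilon>"
    define m where "m = nat \<lceil>T\<rceil> + 1"
    have Tm: "T < real m" unfolding m_def by linarith
    obtain J where J: "\<And>j. j \<ge> J \<Longrightarrow> m \<le> wd \<one> (h (r j))" "\<And>j i. j \<ge> J \<Longrightarrow> i\<le>m \<Longrightarrow> vertices (geo (h (r j))) i = \<rho> i"
      using conv by blast
    have "T \<le> cd (vertex \<one>) (vertex (h (r j))) \<and> (\<forall>t\<in>{0..T}. cd (geo (h (r j)) t) (ray_of \<rho> t) < \<epsilon>)" if j: "J \<le> j" for j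
    proof (intro conjI ballI)
      have "T \<le> real (wd \<one> (h (r j)))" using J(1)[OF j] Tm by linarith
      then show "T \<le> cd (vertex \<one>) (vertex (h (r j)))" using cd_vertex[OF one_closed h(1)] by simp
      fix t assume t: "t \<in> {0..T}"
      have "interpolate (vertices (geo (h (r j)))) t = interpolate \<rho> t"
        by (rule interpolate_cong[of m]) (use J(2)[OF j] t Tm in auto)
      moreover have "t \<le> real (wd \<one> (h (r j)))" using t \<open>T \<le> real (wd \<one> (h (r j)))\<close> by simp
      ultimately have e: "geo (h (r j)) t = ray_of \<rho> t" using gv(5)[of t "r j"] t by (simp add: ray_of_def)
      have "ray_of \<rho> t \<in> cg" using ray_geodesic[OF bR] t unfolding quasi_geodesic_def by auto
      then show "cd (geo (h (r j)) t) (ray_of \<rho> t) < \<epsilon>" unfolding e using \<epsilon> by simp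
    qed
    then show "\<forall>\<^sub>F n in sequentially. T \<le> cd (vertex \<one>) (vertex (h (r n))) \<and>
        (\<forall>t\<in>{0..T}. cd (geo (h (r n)) t) (ray_of \<rho> t) < \<epsilon>)"
      unfolding eventually_sequentially by blast
  qed
  moreover have "asy `` {ray_of \<rho>} \<in> topspace (bdry)"
    using bR by (simp add: topspace_morse_boundary morse_boundary_set_def quotientI)
  ultimately show ?thesis using r by blast
qed

lemma limit_ray_of_convergence:
  assumes geo: "geodesic_choice G A geo" and h: "\<And>j. h j \<in> carrier G" and conv: "geodesics_converge G A geo h z"
    and z: "z \<in> bdry_set" and st: "\<And>c \<gamma>. \<gamma> \<in> z \<Longrightarrow> stable_at c (D c) (vertices \<gamma>)"
  shows "\<exists>\<rho>. limit_ray D h \<rho>"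
proof -
  note gv = geodesic_choice_vertices[OF geo h]
  obtain \<gamma> where \<gamma>: "\<gamma> \<in> z" and c: "\<And>T \<epsilon>. 0 \<le> T \<Longrightarrow> 0 < \<epsilon> \<Longrightarrow> \<forall>\<^sub>F n in sequentially.
        T \<le> cd (vertex \<one>) (vertex (h n)) \<and> (\<forall>t\<in>{0..T}. cd (geo (h n) t) (\<gamma> t) < \<epsilon>)"
    using conv unfolding geodesics_converge_def by blast
  have "\<gamma> \<in> rays" using \<gamma> z by (auto simp: morse_boundary_set_def quotient_def asymptotic_def)
  then have g: "geodesic cg cd {0..} \<gamma>" "\<gamma> 0 = vertex \<one>" using ray_geodesic by auto
  note rv = ray_vertices[OF g]
  have lim: "\<exists>J. \<forall>j\<ge>J. T \<le> wd \<one> (h j) \<and> (\<forall>i\<le>T. vertices (geo (h j)) i = vertices \<gamma> i)" for T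
  proof -
    obtain J where J: "\<And>j. j \<ge> J \<Longrightarrow> real T \<le> cd (vertex \<one>) (vertex (h j)) \<and> (\<forall>t\<in>{0..real T}. cd (geo (h j) t) (\<gamma> t) < 1/2)"
      using c[of "real T" "1/2"] unfolding eventually_sequentially by auto
    have "T \<le> wd \<one> (h j) \<and> (\<forall>i\<le>T. vertices (geo (h j)) i = vertices \<gamma> i)" if j: "j \<ge> J" for j
    proof (intro conjI allI impI)
      show T: "T \<le> wd \<one> (h j)" using J[OF j] cd_vertex[OF one_closed h] by simp
      fix i assume i: "i \<le> T"
      have X: "vertices (geo (h j)) i \<in> carrier G" "vertices \<gamma> i \<in> carrier G"
        using gv(1)[of j] rv(1)[of i] i T by (auto simp: geod_def)
      have "real i \<in> {0..real T}" using i by simp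
      then have "cd (geo (h j) (real i)) (\<gamma> (real i)) < 1/2" using J[OF j] by blast
      then have "real (wd (vertices (geo (h j)) i) (vertices \<gamma> i)) < 1/2"
        using gv(4)[of i j] i T rv(3)[of i] cd_vertex[OF X] by simp
      then have "wd (vertices (geo (h j)) i) (vertices \<gamma> i) = 0" by linarith
      then show "vertices (geo (h j)) i = vertices \<gamma> i" using d_zero X by blast
    qed
    then show ?thesis by blast
  qed
  have "stable D (vertices \<gamma>) n" for n using stable_of_stable_at[OF rv(1)] st[OF \<gamma>] by blast
  then have "limit_ray D h (vertices \<gamma>)"
    unfolding limit_ray_def using rv(2) gv(1,2,3) lim
    by (intro conjI allI exI[of _ "\<lambda>j. vertices (geo (h j))"] exI[of _ "\<lambda>j. wd \<one> (h j)"]) auto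
  then show ?thesis by blast
qed

text \<open>
  Conjugation by a fixed element changes word length by a bounded amount, so it preserves sequences
  tending to infinity.
\<close>

lemma conjugate_far:
  assumes a: "a \<in> carrier G" and b: "b \<in> carrier G"
  shows "wd \<one> b \<le> wd \<one> (inv a \<otimes> b \<otimes> a) + 2 * wd \<one> a"
proof -
  let ?h = "inv a \<otimes> b \<otimes> a"
  have e: "a \<otimes> ?h = b \<otimes> a" using a b by (simp add: m_assoc[symmetric])
  have "wd \<one> b \<le> wd \<one> a + wd a b" "wd a b \<le> wd a (a \<otimes> ?h) + wd (b \<otimes> a) b"
    using wd_tri[of \<one> a b] wd_tri[of a "a \<otimes> ?h" b] a b e by auto
  moreover have "wd a (a \<otimes> ?h) = wd \<one> ?h" using d_translate[of a \<one> ?h] a b by simp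
  moreover have "wd (b \<otimes> a) b = wd \<one> a" using d_translate[of b a \<one>] wd_sym[of a \<one>] a b by simp
  ultimately show ?thesis by linarith
qed

text \<open>
  Given a sequence in \<open>H\<close> tending to infinity, a subsequence of its conjugates by \<open>a\<close> converges to a
  point of \<open>\<partial>\<^sub>*H\<close>. The Cannon--Thurston map turns this into convergence in \<open>G\<close> to a ray in the
  image of the map, and these rays are uniformly stable.
\<close>

theorem hyperbolic_of_cannon_thurston_map:
  assumes H: "H \<lhd> G" "infinite H" "hyperbolic_group (G\<lparr>carrier := H\<rparr>)"
    and B: "finite_symmetric_generating_set (G\<lparr>carrier := H\<rparr>) B"
    and geo: "geodesic_choice G A geoG" "geodesic_choice (G\<lparr>carrier := H\<rparr>) B geoH"
    and f: "cannon_thurston_map G A geoG H B geoH f"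
  shows "hyperbolic_group G"
proof -
  interpret H: normal H G by (rule H)
  interpret K: cayley "G\<lparr>carrier := H\<rparr>" B
    by (rule cayleyI[OF H.subgroup_is_group[OF is_group] B])
  have Hc: "H \<subseteq> carrier G" using H.subset .
  obtain B' where B': "finite_symmetric_generating_set (G\<lparr>carrier := H\<rparr>) B'"
    "gromov_hyperbolic (cayley_graph (G\<lparr>carrier := H\<rparr>) B') (cayley_dist (G\<lparr>carrier := H\<rparr>) B')"
    using H(3) unfolding hyperbolic_group_def by blast
  obtain N where N: "morse_gauge N" "\<And>I \<gamma>. geodesic K.cg K.cd I \<gamma> \<Longrightarrow> is_morse K.cg K.cd N I \<gamma>"
    using K.geodesics_uniformly_morse[OF B'] by blast
  let ?Y = "morse_boundary K.cg K.cd (vertex \<one>)"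
  have one: "\<one>\<^bsub>G\<lparr>carrier := H\<rparr>\<^esub> = \<one>" by simp
  have cont: "continuous_map ?Y (bdry) f"
    and ct: "\<And>x h. x \<in> topspace ?Y \<Longrightarrow> range h \<subseteq> H \<Longrightarrow> geodesics_converge (G\<lparr>carrier := H\<rparr>) B geoH h x \<Longrightarrow>
       geodesics_converge G A geoG h (f x)"
    using f unfolding cannon_thurston_map_def group_morse_boundary_def one by blast+
  have "\<exists>D. \<forall>c. \<forall>x\<in>topspace ?Y. \<forall>\<gamma>\<in>f x. stable_at c (D c) (vertices \<gamma>)"
    by (rule uniform_bound_on_compact_image[OF cont K.boundary_sequentially_compact[OF N, unfolded one]])
  then obtain D where D: "\<And>c x \<gamma>. x \<in> topspace ?Y \<Longrightarrow> \<gamma> \<in> f x \<Longrightarrow> stable_at c (D c) (vertices \<gamma>)" by blast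
  obtain L where L: "\<And>x y. x \<in> H \<Longrightarrow> y \<in> H \<Longrightarrow> wd x y \<le> L * K.wd x y"
    using subgroup_word_dist[OF H.subgroup_axioms B] by blast
  have four_point
  proof (rule four_point_of_limits[OF H(1,2), of D])
    fix a b assume a: "a \<in> carrier G" and b: "range b \<subseteq> H" "\<forall>j. j \<le> wd \<one> (b j)"
    have bH: "b j \<in> H" for j using b(1) by blast
    have bc: "b j \<in> carrier G" for j using bH Hc by blast
    define h where "h j = inv a \<otimes> b j \<otimes> a" for j
    have hH: "h j \<in> H" for j using H.inv_op_closed1[OF a bH] by (simp add: h_def)
    have far: "\<exists>J. \<forall>j\<ge>J. n \<le> K.wd \<one>\<^bsub>G\<lparr>carrier := H\<rparr>\<^esub> (h j)" for n
    proof (intro exI allI impI)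
      fix j assume j: "L * n + 2 * wd \<one> a + 1 \<le> j"
      have "j \<le> wd \<one> (h j) + 2 * wd \<one> a" using conjugate_far[OF a bc[of j]] b(2) le_trans unfolding h_def by blast
      moreover have "wd \<one> (h j) \<le> L * K.wd \<one> (h j)" using L[OF H.one_closed hH] .
      ultimately have "L * n < L * K.wd \<one> (h j)" using j by linarith
      then show "n \<le> K.wd \<one>\<^bsub>G\<lparr>carrier := H\<rparr>\<^esub> (h j)" by simp
    qed
    have hK: "h j \<in> carrier (G\<lparr>carrier := H\<rparr>)" for j using hH by simp
    obtain r x where r: "strict_mono (r :: nat \<Rightarrow> nat)" "x \<in> topspace ?Y"
      "geodesics_converge (G\<lparr>carrier := H\<rparr>) B geoH (\<lambda>j. h (r j)) x"
      using K.converging_subsequence[OF geo(2) N hK far] unfolding one by blast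
    have conv: "geodesics_converge G A geoG (\<lambda>j. h (r j)) (f x)" using ct[OF r(2) _ r(3)] hH by blast
    have "f x \<in> topspace (bdry)"
      using continuous_map_image_subset_topspace[OF cont] r(2) by blast
    then have fx: "f x \<in> bdry_set" unfolding topspace_morse_boundary .
    have hc: "h (r j) \<in> carrier G" for j using hH Hc by blast
    obtain \<rho> where "limit_ray D (\<lambda>j. h (r j)) \<rho>"
      using limit_ray_of_convergence[OF geo(1) hc conv fx, of D] D[OF r(2)] by blast
    then show "\<exists>r \<rho>. strict_mono (r :: nat \<Rightarrow> nat) \<and> limit_ray D (\<lambda>j. inv a \<otimes> b (r j) \<otimes> a) \<rho>"
      using r(1) unfolding h_def by blast
  qed
  then show ?thesis unfolding hyperbolic_group_def using hyperbolic_of_four_point gen is_group by blast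
qed

end

theorem corollary6p9:
  fixes G :: "('a, 'b) monoid_scheme"
    and H A B :: "'a set"
    and geoG geoH :: "'a \<Rightarrow> real \<Rightarrow> 'a \<Rightarrow> real"
  assumes "morse_local_to_global_group G"
    and "\<not> hyperbolic_group G"
    and "H \<lhd> G"
    and "infinite H"
    and "hyperbolic_group (G\<lparr>carrier := H\<rparr>)"
    and "finite_symmetric_generating_set G A"
    and "finite_symmetric_generating_set (G\<lparr>carrier := H\<rparr>) B"
    and "geodesic_choice G A geoG"
    and "geodesic_choice (G\<lparr>carrier := H\<rparr>) B geoH"
  shows "\<not> (\<exists>f. cannon_thurston_map G A geoG H B geoH f)"
proof
  assume "\<exists>f. cannon_thurston_map G A geoG H B geoH f"
  then obtain f where f: "cannon_thurston_map G A geoG H B geoH f" by blast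
  have "group G" using assms(3) by (simp add: normal_def)
  then interpret cayley G A by (rule cayleyI[OF _ assms(6)])
  from hyperbolic_of_cannon_thurston_map[OF assms(3-5,7-9) f] assms(2) show False by contradiction
qed

end
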